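(* Let $\mathbb{F}$ be a field of characteristic $0$ (not necessarily algebraically closed) and let $M\neq 0$ be an additive subgroup of $\mathbb{F}$ (not necessarily of finite rank). Then every module of the intermediate series over the generalized Virasoro algebra $\mathrm{Vir}[M]$ is isomorphic to one of the following: $A_{a,b}(M)$, $A_a(M)$, $B_a(M)$ for $a,b\in\mathbb{F}$, and their nonzero subquotients.
   Context: $\mathrm{Vir}[M]$ is the Lie algebra over $\mathbb{F}$ with basis $\{L_\mu,c\mid\mu\in M\}$ and brackets $[L_\mu,L_\nu]=(\nu-\mu)L_{\mu+\nu}+\frac{1}{12}(\mu^3-\mu)\delta_{\mu+\nu,0}\,c$ and $[c,L_\mu]=[c,c]=0$ for $\mu,\nu\in M$. A Harish-Chandra module over $\mathrm{Vir}[M]$ is a module $V$ with $V=\bigoplus_{\lambda\in\mathbb{F}}V_\lambda$, where $V_\lambda=\{v\in V\mid L_0v=\lambda v\}$ and $\dim V_\lambda<\infty$ for all $\lambda\in\mathbb{F}$. A module of the intermediate series over $\mathrm{Vir}[M]$ is an indecomposable Harish-Chandra module $V$ such that $\dim V_\lambda\le 1$ for all $\lambda\in\mathbb{F}$. For $a,b\in\mathbb{F}$, the $\mathrm{Vir}[M]$-modules $A_{a,b}(M)$, $A_a(M)$, $B_a(M)$ each have a basis $\{v_\mu\mid\mu\in M\}$, with $c\,v_\mu=0$ and, for all $\mu,\nu\in M$: - $A_{a,b}(M)$: $L_\mu v_\nu=(a+\nu+\mu b)v_{\mu+\nu}$; - $A_a(M)$: $L_\mu v_\nu=(\nu+\mu)v_{\mu+\nu}$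 if $\nu\ne0$, and $L_\mu v_0=\mu(\mu+a)v_\mu$; - $B_a(M)$: $L_\mu v_\nu=\nu v_{\mu+\nu}$ if $\nu\neq-\mu$, and $L_\mu v_{-\mu}=-\mu(\mu+a)v_0$. *)

theory Defs
  imports Complex_Main "HOL-Library.Poly_Mapping" "HOL-Library.Set_Algebras"
begin

section \<open>Lie algebras and their modules\<close>

locale lie_algebra = vector_space scale
  for scale :: "'k::field \<Rightarrow> 'g::ab_group_add \<Rightarrow> 'g" +
  fixes G :: "'g set" and br :: "'g \<Rightarrow> 'g \<Rightarrow> 'g"
  assumes subspace_G: "subspace G"
    and br_closed: "x \<in> G \<Longrightarrow> y \<in> G \<Longrightarrow> br x y \<in> G"
    and br_add_left: "x \<in> G \<Longrightarrow> y \<in> G \<Longrightarrow> z \<in> G \<Longrightarrow> br (x + y) z = br x z + br y z"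
    and br_add_right: "x \<in> G \<Longrightarrow> y \<in> G \<Longrightarrow> z \<in> G \<Longrightarrow> br x (y + z) = br x y + br x z"
    and br_scale_left: "x \<in> G \<Longrightarrow> y \<in> G \<Longrightarrow> br (scale s x) y = scale s (br x y)"
    and br_scale_right: "x \<in> G \<Longrightarrow> y \<in> G \<Longrightarrow> br x (scale s y) = scale s (br x y)"
    and br_self: "x \<in> G \<Longrightarrow> br x x = 0"
    and jacobi: "x \<in> G \<Longrightarrow> y \<in> G \<Longrightarrow> z \<in> G \<Longrightarrow>
      br x (br y z) + br y (br z x) + br z (br x y) = 0"

locale lie_module = lie_algebra scaleG G br + V: vector_space scale
  for scaleG :: "'k::field \<Rightarrow> 'g::ab_group_add \<Rightarrow> 'g" and G br
    and scale :: "'k \<Rightarrow> 'v::ab_group_add \<Rightarrow> 'v" +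
  fixes V :: "'v set" and act :: "'g \<Rightarrow> 'v \<Rightarrow> 'v"
  assumes subspace_V: "V.subspace V"
    and act_closed: "x \<in> G \<Longrightarrow> v \<in> V \<Longrightarrow> act x v \<in> V"
    and act_add_left: "x \<in> G \<Longrightarrow> y \<in> G \<Longrightarrow> v \<in> V \<Longrightarrow> act (x + y) v = act x v + act y v"
    and act_add_right: "x \<in> G \<Longrightarrow> v \<in> V \<Longrightarrow> w \<in> V \<Longrightarrow> act x (v + w) = act x v + act x w"
    and act_scale_left: "x \<in> G \<Longrightarrow> v \<in> V \<Longrightarrow> act (scaleG s x) v = scale s (act x v)"
    and act_scale_right: "x \<in> G \<Longrightarrow> v \<in> V \<Longrightarrow> act x (scale s v) = scale s (act x v)"
    and act_br: "x \<in> G \<Longrightarrow> y \<in> G \<Longrightarrow> v \<in> V \<Longrightarrow> act (br x y) v = act x (act y v) - act y (act x v)"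

definition lie_submodule ::
  "('k::field \<Rightarrow> 'v::ab_group_add \<Rightarrow> 'v) \<Rightarrow> 'g set \<Rightarrow> ('g \<Rightarrow> 'v \<Rightarrow> 'v) \<Rightarrow> 'v set \<Rightarrow> 'v set \<Rightarrow> bool"
  where "lie_submodule scale G act V N \<longleftrightarrow>
    module.subspace scale N \<and> N \<subseteq> V \<and> (\<forall>x\<in>G. \<forall>v\<in>N. act x v \<in> N)"

definition indecomposable ::
  "('k::field \<Rightarrow> 'v::ab_group_add \<Rightarrow> 'v) \<Rightarrow> 'g set \<Rightarrow> ('g \<Rightarrow> 'v \<Rightarrow> 'v) \<Rightarrow> 'v set \<Rightarrow> bool"
  where "indecomposable scale G act V \<longleftrightarrow> V \<noteq> {0} \<and>
    \<not> (\<exists>N1 N2. lie_submodule scale G act V N1 \<and> lie_submodule scale G act V N2 \<and>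
          N1 \<noteq> {0} \<and> N2 \<noteq> {0} \<and> N1 \<inter> N2 = {0} \<and> N1 + N2 = V)"

text \<open>The data of a module, with all operations explicit: a quotient has sets as elements, so its
  operations are not those of a type class.\<close>

record ('k, 'g, 'v) lie_rep =
  rep_space :: "'v set"
  rep_add :: "'v \<Rightarrow> 'v \<Rightarrow> 'v"
  rep_scale :: "'k \<Rightarrow> 'v \<Rightarrow> 'v"
  rep_act :: "'g \<Rightarrow> 'v \<Rightarrow> 'v"

definition rep_of ::
  "('k \<Rightarrow> 'v::ab_group_add \<Rightarrow> 'v) \<Rightarrow> ('g \<Rightarrow> 'v \<Rightarrow> 'v) \<Rightarrow> 'v set \<Rightarrow> ('k, 'g, 'v) lie_rep"
  where "rep_of scale act V =
    \<lparr>rep_space = V, rep_add = (+), rep_scale = scale, rep_act = act\<rparr>"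

text \<open>The quotient \<open>N2 / N1\<close>. Its elements are the cosets \<open>v +o N1\<close>; the sum of two cosets
  is their sum as sets, and a linear map \<open>f\<close> preserving \<open>N1\<close> sends the coset \<open>C\<close> to
  \<open>f ` C + N1\<close>.\<close>

definition quotient_rep ::
  "('k \<Rightarrow> 'v::ab_group_add \<Rightarrow> 'v) \<Rightarrow> ('g \<Rightarrow> 'v \<Rightarrow> 'v) \<Rightarrow> 'v set \<Rightarrow> 'v set \<Rightarrow> ('k, 'g, 'v set) lie_rep"
  where "quotient_rep scale act N2 N1 =
    \<lparr>rep_space = (\<lambda>v. v +o N1) ` N2, rep_add = (+),
     rep_scale = (\<lambda>s C. scale s ` C + N1), rep_act = (\<lambda>x C. act x ` C + N1)\<rparr>"

definition rep_isomorphic ::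
  "'g set \<Rightarrow> ('k, 'g, 'v) lie_rep \<Rightarrow> ('k, 'g, 'w) lie_rep \<Rightarrow> bool"
  where "rep_isomorphic G X Y \<longleftrightarrow> (\<exists>\<phi>. bij_betw \<phi> (rep_space X) (rep_space Y) \<and>
    (\<forall>v\<in>rep_space X. \<forall>w\<in>rep_space X. \<phi> (rep_add X v w) = rep_add Y (\<phi> v) (\<phi> w)) \<and>
    (\<forall>s. \<forall>v\<in>rep_space X. \<phi> (rep_scale X s v) = rep_scale Y s (\<phi> v)) \<and>
    (\<forall>x\<in>G. \<forall>v\<in>rep_space X. \<phi> (rep_act X x v) = rep_act Y x (\<phi> v)))"


section \<open>Spaces with a given basis\<close>

text \<open>The space of all \<open>x :: 'i \<Rightarrow>\<^sub>0 'k\<close> with \<open>Poly_Mapping.keys x \<subseteq> S\<close> has basis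
  \<open>bvec i\<close> for \<open>i \<in> S\<close>.\<close>

abbreviation bvec :: "'i \<Rightarrow> ('i \<Rightarrow>\<^sub>0 'k::zero_neq_one)"
  where "bvec i \<equiv> Poly_Mapping.single i 1"

definition pm_scale :: "'k::field \<Rightarrow> ('i \<Rightarrow>\<^sub>0 'k) \<Rightarrow> ('i \<Rightarrow>\<^sub>0 'k)"
  where "pm_scale s = Poly_Mapping.map ((*) s)"

definition free_space :: "'i set \<Rightarrow> ('i \<Rightarrow>\<^sub>0 'k::field) set"
  where "free_space S = {x. Poly_Mapping.keys x \<subseteq> S}"

definition linear_ext ::
  "('k::field \<Rightarrow> 'v::ab_group_add \<Rightarrow> 'v) \<Rightarrow> ('i \<Rightarrow> 'v) \<Rightarrow> ('i \<Rightarrow>\<^sub>0 'k) \<Rightarrow> 'v"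
  where "linear_ext scale f x = (\<Sum>i\<in>Poly_Mapping.keys x. scale (Poly_Mapping.lookup x i) (f i))"

definition bilinear_ext ::
  "('k::field \<Rightarrow> 'v::ab_group_add \<Rightarrow> 'v) \<Rightarrow> ('i \<Rightarrow> 'j \<Rightarrow> 'v) \<Rightarrow> ('i \<Rightarrow>\<^sub>0 'k) \<Rightarrow> ('j \<Rightarrow>\<^sub>0 'k) \<Rightarrow> 'v"
  where "bilinear_ext scale f x y = linear_ext scale (\<lambda>i. linear_ext scale (f i) y) x"

lemma lookup_pm_scale [simp]: "Poly_Mapping.lookup (pm_scale s x) i = s * Poly_Mapping.lookup x i"
  by (simp add: pm_scale_def Poly_Mapping.map.rep_eq when_def)

interpretation pm: vector_space pm_scale
  by unfold_locales (auto intro!: poly_mapping_eqI simp: lookup_add algebra_simps)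

lemma pm_scale_single [simp]: "pm_scale s (Poly_Mapping.single i a) = Poly_Mapping.single i (s * a)"
  by (simp add: pm_scale_def)

lemma subspace_free_space: "pm.subspace (free_space S)"
  unfolding pm.subspace_def free_space_def
  by (auto simp: in_keys_iff lookup_add subset_iff) (metis add.right_neutral)

lemma free_space_induct [consumes 1, case_names zero add scale single]:
  assumes "x \<in> free_space S"
    and "P 0" and add: "\<And>x y. P x \<Longrightarrow> P y \<Longrightarrow> P (x + y)"
    and scale: "\<And>s x. P x \<Longrightarrow> P (pm_scale s x)"
    and single: "\<And>i. i \<in> S \<Longrightarrow> P (bvec i)"
  shows "P x"
proof -
  have x: "x = (\<Sum>i\<in>Poly_Mapping.keys x. pm_scale (Poly_Mapping.lookup x i) (bvec i))"
    by (rule poly_mapping_eqI)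
      (simp add: lookup_sum lookup_single when_def in_keys_iff if_distrib sum.delta' cong: if_cong)
  have "P (\<Sum>i\<in>A. pm_scale (Poly_Mapping.lookup x i) (bvec i))" if "A \<subseteq> S" "finite A" for A
    using that(2,1) by (induction A) (auto simp del: pm_scale_single intro: assms)
  from this[of "Poly_Mapping.keys x"] x show ?thesis
    using assms(1) by (simp add: free_space_def)
qed

context vector_space
begin

lemma linear_ext_superset:
  "Poly_Mapping.keys x \<subseteq> A \<Longrightarrow> finite A \<Longrightarrow>
    linear_ext scale f x = (\<Sum>i\<in>A. scale (Poly_Mapping.lookup x i) (f i))"
  unfolding linear_ext_def by (rule sum.mono_neutral_left) (auto simp: in_keys_iff)

lemma linear_ext_zero [simp]: "linear_ext scale f 0 = 0"
  by (simp add: linear_ext_def)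

lemma linear_ext_add: "linear_ext scale f (x + y) = linear_ext scale f x + linear_ext scale f y"
  using keys_add[of x y]
  by (simp add: linear_ext_superset[where A = "Poly_Mapping.keys x \<union> Poly_Mapping.keys y"] lookup_add scale_left_distrib
      sum.distrib)

lemma linear_ext_scale: "linear_ext scale f (pm_scale s x) = scale s (linear_ext scale f x)"
proof -
  have "Poly_Mapping.keys (pm_scale s x) \<subseteq> Poly_Mapping.keys x" by (auto simp: in_keys_iff)
  then show ?thesis
    by (simp add: linear_ext_superset[where A = "Poly_Mapping.keys x"] scale_sum_right)
qed

lemma linear_ext_single [simp]: "linear_ext scale f (Poly_Mapping.single i a) = scale a (f i)"
  by (simp add: linear_ext_def)

lemma linear_ext_fun_add:
  "linear_ext scale (\<lambda>i. f i + g i) x = linear_ext scale f x + linear_ext scale g x"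
  by (simp add: linear_ext_def scale_right_distrib sum.distrib)

lemma linear_ext_fun_scale:
  "linear_ext scale (\<lambda>i. scale s (f i)) x = scale s (linear_ext scale f x)"
  by (simp add: linear_ext_def scale_sum_right mult.commute)

lemma bilinear_ext_simps:
  "bilinear_ext scale f 0 y = 0" "bilinear_ext scale f x 0 = 0"
  "bilinear_ext scale f (x + x') y = bilinear_ext scale f x y + bilinear_ext scale f x' y"
  "bilinear_ext scale f x (y + y') = bilinear_ext scale f x y + bilinear_ext scale f x y'"
  "bilinear_ext scale f (pm_scale s x) y = scale s (bilinear_ext scale f x y)"
  "bilinear_ext scale f x (pm_scale s y) = scale s (bilinear_ext scale f x y)"
  "bilinear_ext scale f (Poly_Mapping.single i a) (Poly_Mapping.single j b) = scale (a * b) (f i j)"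
  unfolding bilinear_ext_def linear_ext_add linear_ext_scale linear_ext_fun_add linear_ext_fun_scale
  by (simp_all add: linear_ext_def)

lemma linear_ext_in_subspace:
  "subspace U \<Longrightarrow> x \<in> free_space S \<Longrightarrow> (\<And>i. i \<in> S \<Longrightarrow> f i \<in> U) \<Longrightarrow> linear_ext scale f x \<in> U"
  unfolding linear_ext_def by (auto simp: free_space_def intro!: subspace_sum subspace_scale)

lemma bilinear_ext_in_subspace:
  assumes "subspace U" "x \<in> free_space S" "y \<in> free_space T"
    and "\<And>i j. i \<in> S \<Longrightarrow> j \<in> T \<Longrightarrow> f i j \<in> U"
  shows "bilinear_ext scale f x y \<in> U"
  unfolding bilinear_ext_def
  by (intro linear_ext_in_subspace[OF assms(1,2)] linear_ext_in_subspace[OF assms(1,3)] assms(4))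

end


section \<open>The generalized Virasoro algebra\<close>

datatype 'a vir_gen = Vir_L 'a | Vir_c

definition vir :: "'a::field_char_0 set \<Rightarrow> ('a vir_gen \<Rightarrow>\<^sub>0 'a) set"
  where "vir M = free_space (insert Vir_c (Vir_L ` M))"

fun vir_basis_br :: "'a::field_char_0 vir_gen \<Rightarrow> 'a vir_gen \<Rightarrow> ('a vir_gen \<Rightarrow>\<^sub>0 'a)"
  where
    "vir_basis_br (Vir_L \<mu>) (Vir_L \<nu>) = Poly_Mapping.single (Vir_L (\<mu> + \<nu>)) (\<nu> - \<mu>) +
       (if \<mu> + \<nu> = 0 then Poly_Mapping.single Vir_c (1 / 12 * (\<mu> ^ 3 - \<mu>)) else 0)"
  | "vir_basis_br Vir_c _ = 0"
  | "vir_basis_br _ Vir_c = 0"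

definition vir_br ::
  "('a::field_char_0 vir_gen \<Rightarrow>\<^sub>0 'a) \<Rightarrow> ('a vir_gen \<Rightarrow>\<^sub>0 'a) \<Rightarrow> ('a vir_gen \<Rightarrow>\<^sub>0 'a)"
  where "vir_br = bilinear_ext pm_scale vir_basis_br"

lemmas vir_br_simps = pm.bilinear_ext_simps[where f = vir_basis_br, folded vir_br_def]

lemma vir_br_antisym: "vir_br x y = - vir_br y x"
proof -
  have basis: "vir_basis_br i j = - vir_basis_br j i" for i j :: "'a vir_gen"
  proof (cases "\<exists>\<mu> \<nu>. i = Vir_L \<mu> \<and> j = Vir_L \<nu>")
    case True
    then obtain \<mu> \<nu> where ij: "i = Vir_L \<mu>" "j = Vir_L \<nu>" by blast
    show ?thesis
    proof (cases "\<mu> + \<nu> = 0")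
      case True
      then have "\<nu> = - \<mu>" by (simp add: eq_neg_iff_add_eq_0 add.commute)
      then show ?thesis
        using ij by (intro poly_mapping_eqI) (simp add: lookup_add lookup_minus lookup_single when_def field_simps)
    next
      case False
      then show ?thesis
        using ij by (intro poly_mapping_eqI) (simp add: lookup_single when_def add.commute)
    qed
  next
    case False
    then show ?thesis by (cases i; cases j) auto
  qed
  have "x \<in> free_space UNIV" "y \<in> free_space UNIV" by (auto simp: free_space_def)
  then show ?thesis
  proof (induction x rule: free_space_induct)
    case (single i)
    from single(2) show ?case
      by (induction y rule: free_space_induct)
        (auto simp: vir_br_simps basis[of i] pm.scale_right_distrib)
  qed (auto simp: vir_br_simps)
qed

lemma vir_jacobi: "vir_br x (vir_br y z) + vir_br y (vir_br z x) + vir_br z (vir_br x y) = 0"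
proof -
  have c: "vir_br y (bvec Vir_c) = 0" "vir_br (bvec Vir_c) y = 0" for y :: "'a vir_gen \<Rightarrow>\<^sub>0 'a"
  proof -
    show *: "vir_br (bvec Vir_c) y = 0" for y :: "'a vir_gen \<Rightarrow>\<^sub>0 'a"
      by (simp add: vir_br_def bilinear_ext_def linear_ext_def)
    show "vir_br y (bvec Vir_c) = 0"
      using vir_br_antisym[of y "bvec Vir_c"] * by simp
  qed
  have sum3: "(p1 + q1) + (p2 + q2) + (p3 + q3) = 0"
    if "p1 + p2 + p3 = 0" "q1 + q2 + q3 = 0" for p1 p2 p3 q1 q2 q3 :: "'a vir_gen \<Rightarrow>\<^sub>0 'a"
  proof -
    have "(p1 + q1) + (p2 + q2) + (p3 + q3) = (p1 + p2 + p3) + (q1 + q2 + q3)"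
      by (simp add: add_ac)
    then show ?thesis using that by simp
  qed
  have basis: "vir_br (bvec i) (vir_br (bvec j) (bvec k)) +
      vir_br (bvec j) (vir_br (bvec k) (bvec i)) +
      vir_br (bvec k) (vir_br (bvec i) (bvec j)) = 0" for i j k :: "'a vir_gen"
  proof (cases "i = Vir_c \<or> j = Vir_c \<or> k = Vir_c")
    case True
    then show ?thesis by (auto simp: c vir_br_simps(1,2))
  next
    case False
    then obtain \<mu> \<nu> \<rho> where ijk: "i = Vir_L \<mu>" "j = Vir_L \<nu>" "k = Vir_L \<rho>"
      by (metis vir_gen.exhaust)
    define s where "s \<mu> \<nu> = (if \<mu> + \<nu> = 0 then 1 / 12 * (\<mu> ^ 3 - \<mu>) else 0)" for \<mu> \<nu> :: 'a
    have L: "vir_br (bvec (Vir_L a)) (bvec (Vir_L b)) =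
        pm_scale (b - a) (bvec (Vir_L (a + b))) + pm_scale (s a b) (bvec Vir_c)" for a b
      by (simp add: vir_br_simps(7) s_def)
    have LL: "vir_br (bvec (Vir_L a)) (vir_br (bvec (Vir_L b)) (bvec (Vir_L d))) =
        Poly_Mapping.single (Vir_L (a + b + d)) ((d - b) * (b + d - a)) +
        Poly_Mapping.single Vir_c ((d - b) * s a (b + d))"
      for a b d
      unfolding L vir_br_simps(4,6) c by (simp add: pm.scale_right_distrib add.assoc)
    have cocycle: "(\<rho> - \<nu>) * s \<mu> (\<nu> + \<rho>) + (\<mu> - \<rho>) * s \<nu> (\<rho> + \<mu>) + (\<nu> - \<mu>) * s \<rho> (\<mu> + \<nu>) = 0"
    proof (cases "\<mu> + \<nu> + \<rho> = 0")
      case True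
      then have \<rho>: "\<rho> = - \<mu> - \<nu>"
        by (metis add.commute diff_conv_add_uminus eq_neg_iff_add_eq_0 minus_add_distrib)
      have s: "s \<mu> (\<nu> + \<rho>) = 1 / 12 * (\<mu> ^ 3 - \<mu>)" "s \<nu> (\<rho> + \<mu>) = 1 / 12 * (\<nu> ^ 3 - \<nu>)"
        "s \<rho> (\<mu> + \<nu>) = 1 / 12 * (\<rho> ^ 3 - \<rho>)"
        by (simp_all add: s_def \<rho>)
      have "(\<rho> - \<nu>) * (\<mu> ^ 3 - \<mu>) + (\<mu> - \<rho>) * (\<nu> ^ 3 - \<nu>) + (\<nu> - \<mu>) * (\<rho> ^ 3 - \<rho>) = 0"
        using True by algebra
      then have "1 / 12 * ((\<rho> - \<nu>) * (\<mu> ^ 3 - \<mu>) + (\<mu> - \<rho>) * (\<nu> ^ 3 - \<nu>) + (\<nu> - \<mu>) * (\<rho> ^ 3 - \<rho>)) = 0"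
        by simp
      then show ?thesis
        unfolding s by (simp only: distrib_left mult.left_commute)
    next
      case False
      then show ?thesis by (simp add: s_def add_ac)
    qed
    have perm: "\<nu> + \<rho> + \<mu> = \<mu> + \<nu> + \<rho>" "\<rho> + \<mu> + \<nu> = \<mu> + \<nu> + \<rho>" by (simp_all add: add_ac)
    have lin: "(\<rho> - \<nu>) * (\<nu> + \<rho> - \<mu>) + (\<mu> - \<rho>) * (\<rho> + \<mu> - \<nu>) + (\<nu> - \<mu>) * (\<mu> + \<nu> - \<rho>) = 0"
      by (simp add: algebra_simps)
    show ?thesis
      unfolding ijk LL perm
      by (rule sum3) (simp_all add: lin cocycle flip: single_add)
  qed
  have free: "w \<in> free_space UNIV" for w :: "'a vir_gen \<Rightarrow>\<^sub>0 'a"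
    by (simp add: free_space_def)
  show ?thesis using free[of x]
  proof (induction x rule: free_space_induct)
    case zero then show ?case by (simp add: vir_br_simps)
  next
    case (add x x')
    show ?case unfolding vir_br_simps(3,4) using add.IH by (rule sum3)
  next
    case (scale s x)
    then show ?case by (simp add: vir_br_simps flip: pm.scale_right_distrib)
  next
    case i: (single i)
    show ?case using free[of y]
    proof (induction y rule: free_space_induct)
      case zero then show ?case by (simp add: vir_br_simps)
    next
      case (add x x')
      show ?case unfolding vir_br_simps(3,4) using add.IH by (rule sum3)
    next
      case (scale s x)
      then show ?case by (simp add: vir_br_simps flip: pm.scale_right_distrib)
    next
      case j: (single j)
      show ?case using free[of z]
      proof (induction z rule: free_space_induct)
        case zero then show ?case by (simp add: vir_br_simps)
      next
        case (add x x')
        show ?case unfolding vir_br_simps(3,4) using add.IH by (rule sum3)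
      next
        case (scale s x)
        then show ?case by (simp add: vir_br_simps flip: pm.scale_right_distrib)
      next
        case (single k)
        show ?case by (rule basis)
      qed
    qed
  qed
qed

lemma lie_algebra_vir:
  fixes M :: "'a::field_char_0 set"
  assumes "\<And>\<mu> \<nu>. \<mu> \<in> M \<Longrightarrow> \<nu> \<in> M \<Longrightarrow> \<mu> + \<nu> \<in> M"
  shows "lie_algebra pm_scale (vir M) vir_br"
proof unfold_locales
  show "pm.subspace (vir M)"
    unfolding vir_def by (rule subspace_free_space)
next
  fix x y :: "'a vir_gen \<Rightarrow>\<^sub>0 'a"
  assume "x \<in> vir M" "y \<in> vir M"
  moreover have "vir_basis_br i j \<in> free_space (insert Vir_c (Vir_L ` M))"
    if "i \<in> insert Vir_c (Vir_L ` M)" "j \<in> insert Vir_c (Vir_L ` M)" for i j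
    using that assms
    by (auto simp: free_space_def dest!: subsetD[OF Poly_Mapping.keys_add] split: if_splits)
      (metis image_eqI)
  ultimately show "vir_br x y \<in> vir M"
    unfolding vir_br_def vir_def
    by (intro pm.bilinear_ext_in_subspace subspace_free_space)
next
  fix x :: "'a vir_gen \<Rightarrow>\<^sub>0 'a"
  have "Poly_Mapping.lookup (vir_br x x) i = - Poly_Mapping.lookup (vir_br x x) i" for i
    by (metis vir_br_antisym lookup_uminus)
  then show "vir_br x x = 0"
    by (intro poly_mapping_eqI) (metis eq_neg_iff_add_eq_0 mult_2 mult_eq_0_iff zero_neq_numeral lookup_zero)
qed (simp_all add: vir_br_simps vir_jacobi)


section \<open>Harish-Chandra modules and modules of the intermediate series\<close>

definition weight_space ::
  "('a::field_char_0 \<Rightarrow> 'v::ab_group_add \<Rightarrow> 'v) \<Rightarrow> (('a vir_gen \<Rightarrow>\<^sub>0 'a) \<Rightarrow> 'v \<Rightarrow> 'v) \<Rightarrow> 'v set \<Rightarrow> 'a \<Rightarrow> 'v set"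
  where "weight_space scale act V l = {v \<in> V. act (bvec (Vir_L 0)) v = scale l v}"

definition direct_sum_decomp ::
  "('k::field \<Rightarrow> 'v::ab_group_add \<Rightarrow> 'v) \<Rightarrow> 'v set \<Rightarrow> ('i \<Rightarrow> 'v set) \<Rightarrow> bool"
  where "direct_sum_decomp scale V U \<longleftrightarrow> (\<forall>i. module.subspace scale (U i) \<and> U i \<subseteq> V) \<and>
    (\<forall>v\<in>V. \<exists>!f. (\<forall>i. f i \<in> U i) \<and> finite {i. f i \<noteq> 0} \<and> v = (\<Sum>i | f i \<noteq> 0. f i))"

definition harish_chandra ::
  "'a::field_char_0 set \<Rightarrow> ('a \<Rightarrow> 'v::ab_group_add \<Rightarrow> 'v) \<Rightarrow> (('a vir_gen \<Rightarrow>\<^sub>0 'a) \<Rightarrow> 'v \<Rightarrow> 'v) \<Rightarrow> 'v set \<Rightarrow> bool"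
  where "harish_chandra M scale act V \<longleftrightarrow>
    lie_module pm_scale (vir M) vir_br scale V act \<and>
    direct_sum_decomp scale V (weight_space scale act V) \<and>
    (\<forall>l. \<exists>B. finite B \<and> module.span scale B = weight_space scale act V l)"

definition intermediate_series ::
  "'a::field_char_0 set \<Rightarrow> ('a \<Rightarrow> 'v::ab_group_add \<Rightarrow> 'v) \<Rightarrow> (('a vir_gen \<Rightarrow>\<^sub>0 'a) \<Rightarrow> 'v \<Rightarrow> 'v) \<Rightarrow> 'v set \<Rightarrow> bool"
  where "intermediate_series M scale act V \<longleftrightarrow>
    harish_chandra M scale act V \<and> indecomposable scale (vir M) act V \<and>
    (\<forall>l. vector_space.dim scale (weight_space scale act V l) \<le> 1)"


section \<open>The modules $A_{a,b}(M)$, $A_a(M)$ and $B_a(M)$\<close>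

text \<open>All three live on \<open>free_space M\<close>, with \<open>v\<^sub>\<nu> = bvec \<nu>\<close> for \<open>\<nu> \<in> M\<close>. The action
  determined by \<open>L\<^sub>\<mu> v\<^sub>\<nu> = k \<mu> \<nu> v\<^sub>\<mu>\<^sub>+\<^sub>\<nu>\<close> and \<open>c v\<^sub>\<nu> = 0\<close>:\<close>

fun basis_act :: "('a::field_char_0 \<Rightarrow> 'a \<Rightarrow> 'a) \<Rightarrow> 'a vir_gen \<Rightarrow> 'a \<Rightarrow> ('a \<Rightarrow>\<^sub>0 'a)"
  where
    "basis_act k (Vir_L \<mu>) \<nu> = Poly_Mapping.single (\<mu> + \<nu>) (k \<mu> \<nu>)"
  | "basis_act k Vir_c \<nu> = 0"

definition graded_act ::
  "('a::field_char_0 \<Rightarrow> 'a \<Rightarrow> 'a) \<Rightarrow> ('a vir_gen \<Rightarrow>\<^sub>0 'a) \<Rightarrow> ('a \<Rightarrow>\<^sub>0 'a) \<Rightarrow> ('a \<Rightarrow>\<^sub>0 'a)"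
  where "graded_act k = bilinear_ext pm_scale (basis_act k)"

definition act_Aab :: "'a::field_char_0 \<Rightarrow> 'a \<Rightarrow> ('a vir_gen \<Rightarrow>\<^sub>0 'a) \<Rightarrow> ('a \<Rightarrow>\<^sub>0 'a) \<Rightarrow> ('a \<Rightarrow>\<^sub>0 'a)"
  where "act_Aab a b = graded_act (\<lambda>\<mu> \<nu>. a + \<nu> + \<mu> * b)"

definition act_A :: "'a::field_char_0 \<Rightarrow> ('a vir_gen \<Rightarrow>\<^sub>0 'a) \<Rightarrow> ('a \<Rightarrow>\<^sub>0 'a) \<Rightarrow> ('a \<Rightarrow>\<^sub>0 'a)"
  where "act_A a = graded_act (\<lambda>\<mu> \<nu>. if \<nu> \<noteq> 0 then \<nu> + \<mu> else \<mu> * (\<mu> + a))"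

definition act_B :: "'a::field_char_0 \<Rightarrow> ('a vir_gen \<Rightarrow>\<^sub>0 'a) \<Rightarrow> ('a \<Rightarrow>\<^sub>0 'a) \<Rightarrow> ('a \<Rightarrow>\<^sub>0 'a)"
  where "act_B a = graded_act (\<lambda>\<mu> \<nu>. if \<nu> \<noteq> - \<mu> then \<nu> else - \<mu> * (\<mu> + a))"

lemma lie_module_graded_act:
  fixes M :: "'a::field_char_0 set"
  assumes M: "\<And>\<mu> \<nu>. \<mu> \<in> M \<Longrightarrow> \<nu> \<in> M \<Longrightarrow> \<mu> + \<nu> \<in> M"
    and k: "\<And>\<mu> \<nu> \<rho>. (\<nu> - \<mu>) * k (\<mu> + \<nu>) \<rho> = k \<nu> \<rho> * k \<mu> (\<nu> + \<rho>) - k \<mu> \<rho> * k \<nu> (\<mu> + \<rho>)"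
  shows "lie_module pm_scale (vir M) vir_br pm_scale (free_space M) (graded_act k)"
proof -
  note act_simps = pm.bilinear_ext_simps[where f = "basis_act k", folded graded_act_def]
  interpret lie_algebra pm_scale "vir M" vir_br using M by (rule lie_algebra_vir)
  have c: "graded_act k (Poly_Mapping.single Vir_c a) v = 0" for a v
    by (simp add: graded_act_def bilinear_ext_def linear_ext_def)
  have basis: "graded_act k (vir_br (bvec i) (bvec j)) (bvec \<rho>) =
      graded_act k (bvec i) (graded_act k (bvec j) (bvec \<rho>)) -
      graded_act k (bvec j) (graded_act k (bvec i) (bvec \<rho>))" for i j \<rho>
  proof (cases "\<exists>\<mu> \<nu>. i = Vir_L \<mu> \<and> j = Vir_L \<nu>")
    case True
    then obtain \<mu> \<nu> where ij: "i = Vir_L \<mu>" "j = Vir_L \<nu>" by blast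
    have perm: "\<nu> + (\<mu> + \<rho>) = \<mu> + (\<nu> + \<rho>)" by (simp add: add_ac)
    show ?thesis
      unfolding ij by (simp add: vir_br_simps act_simps c k add.assoc perm flip: single_diff)
  next
    case False
    then show ?thesis
      by (cases i; cases j) (auto simp: vir_br_simps act_simps c)
  qed
  have br: "graded_act k (vir_br x y) v =
      graded_act k x (graded_act k y v) - graded_act k y (graded_act k x v)" for x y v
  proof -
    have "x \<in> free_space UNIV" "y \<in> free_space UNIV" "v \<in> free_space UNIV"
      by (auto simp: free_space_def)
    then show ?thesis
    proof (induction x rule: free_space_induct)
      case i: (single i)
      from i(2,3) show ?case
      proof (induction y rule: free_space_induct)
        case j: (single j)
        from j(2) show ?case
          by (induction v rule: free_space_induct)
            (simp_all add: basis act_simps pm.scale_right_diff_distrib)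
      qed (simp_all add: vir_br_simps act_simps pm.scale_right_diff_distrib)
    qed (simp_all add: vir_br_simps act_simps pm.scale_right_diff_distrib)
  qed
  show ?thesis
  proof unfold_locales
    show "pm.subspace (free_space M)" by (rule subspace_free_space)
  next
    fix x :: "'a vir_gen \<Rightarrow>\<^sub>0 'a" and v :: "'a \<Rightarrow>\<^sub>0 'a"
    assume "x \<in> vir M" "v \<in> free_space M"
    moreover have "basis_act k i \<nu> \<in> free_space M"
      if "i \<in> insert Vir_c (Vir_L ` M)" "\<nu> \<in> M" for i \<nu>
      using that M by (auto simp: free_space_def split: if_splits)
    ultimately show "graded_act k x v \<in> free_space M"
      unfolding graded_act_def vir_def
      by (intro pm.bilinear_ext_in_subspace subspace_free_space)
  qed (simp_all add: act_simps br)
qed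

lemma lie_module_intermediate:
  fixes M :: "'a::field_char_0 set"
  assumes M: "\<And>\<mu> \<nu>. \<mu> \<in> M \<Longrightarrow> \<nu> \<in> M \<Longrightarrow> \<mu> + \<nu> \<in> M"
  shows "lie_module pm_scale (vir M) vir_br pm_scale (free_space M) (act_Aab a b)"
    and "lie_module pm_scale (vir M) vir_br pm_scale (free_space M) (act_A a)"
    and "lie_module pm_scale (vir M) vir_br pm_scale (free_space M) (act_B a)"
proof -
  show "lie_module pm_scale (vir M) vir_br pm_scale (free_space M) (act_Aab a b)"
    unfolding act_Aab_def by (rule lie_module_graded_act[OF M]) (simp_all add: algebra_simps)
  show "lie_module pm_scale (vir M) vir_br pm_scale (free_space M) (act_A a)"
    unfolding act_A_def
  proof (rule lie_module_graded_act[OF M])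
    fix \<mu> \<nu> \<rho> :: 'a
    consider "\<rho> = 0" "\<mu> = 0" | "\<rho> = 0" "\<nu> = 0" | "\<rho> = 0" "\<mu> \<noteq> 0" "\<nu> \<noteq> 0"
      | "\<rho> \<noteq> 0" "\<rho> = - \<mu>" | "\<rho> \<noteq> 0" "\<rho> = - \<nu>"
      | "\<rho> \<noteq> 0" "\<mu> + \<rho> \<noteq> 0" "\<nu> + \<rho> \<noteq> 0"
      by (metis eq_neg_iff_add_eq_0 add.commute)
    then show "(\<nu> - \<mu>) * (if \<rho> \<noteq> 0 then \<rho> + (\<mu> + \<nu>) else (\<mu> + \<nu>) * (\<mu> + \<nu> + a)) =
       (if \<rho> \<noteq> 0 then \<rho> + \<nu> else \<nu> * (\<nu> + a)) *
       (if \<nu> + \<rho> \<noteq> 0 then \<nu> + \<rho> + \<mu> else \<mu> * (\<mu> + a)) -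
       (if \<rho> \<noteq> 0 then \<rho> + \<mu> else \<mu> * (\<mu> + a)) *
       (if \<mu> + \<rho> \<noteq> 0 then \<mu> + \<rho> + \<nu> else \<nu> * (\<nu> + a))"
      by cases (simp_all add: algebra_simps)
  qed
  show "lie_module pm_scale (vir M) vir_br pm_scale (free_space M) (act_B a)"
    unfolding act_B_def
  proof (rule lie_module_graded_act[OF M])
    fix \<mu> \<nu> \<rho> :: 'a
    have iff: "\<nu> + \<rho> = - \<mu> \<longleftrightarrow> \<rho> = - (\<mu> + \<nu>)" "\<mu> + \<rho> = - \<nu> \<longleftrightarrow> \<rho> = - (\<mu> + \<nu>)"
      unfolding eq_neg_iff_add_eq_0 by (simp_all add: ac_simps)
    show "(\<nu> - \<mu>) * (if \<rho> \<noteq> - (\<mu> + \<nu>) then \<rho> else - (\<mu> + \<nu>) * (\<mu> + \<nu> + a)) =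
       (if \<rho> \<noteq> - \<nu> then \<rho> else - \<nu> * (\<nu> + a)) *
       (if \<nu> + \<rho> \<noteq> - \<mu> then \<nu> + \<rho> else - \<mu> * (\<mu> + a)) -
       (if \<rho> \<noteq> - \<mu> then \<rho> else - \<mu> * (\<mu> + a)) *
       (if \<mu> + \<rho> \<noteq> - \<nu> then \<mu> + \<rho> else - \<nu> * (\<nu> + a))"
    proof (cases "\<rho> = - (\<mu> + \<nu>)")
      case True
      have "- (\<mu> + \<nu>) = - \<nu> \<longleftrightarrow> \<mu> = 0" "- (\<mu> + \<nu>) = - \<mu> \<longleftrightarrow> \<nu> = 0"
        by auto
      then show ?thesis
        unfolding iff unfolding True by (auto simp: algebra_simps)
    next
      case False
      then show ?thesis
        unfolding iff by (auto simp: algebra_simps)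
    qed
  qed
qed

end

theory Submission
  imports Defs
begin

text \<open>Choose \<open>e\<^sub>p\<close> spanning the weight space \<open>V\<^sub>p\<close> and write
  \<open>L\<^sub>\<mu> e\<^sub>p = f p (p + \<mu>) e\<^bsub>p+\<mu>\<^esub>\<close>, so that the commutation relations become quadratic
  identities for \<open>f\<close>. The products \<open>P p q = f p q * f q p\<close> do not depend on the choice of the
  \<open>e\<^sub>p\<close>. Recursions for them along the lines \<open>p + \<int> x\<close> show that every nonzero weight of the
  coset occurs, that \<open>c\<close> acts by 0, and that \<open>P p q = p * q + \<beta> * (p - q)\<^sup>2\<close> on each line.

  The defect \<open>N p q r = f p q * f q r - q * f p r\<close> measures the symmetrised product of two
  \<open>L\<close>'s modulo products with \<open>L\<^sub>0\<close>, and commuting it with a further \<open>L\<close> gives identities that are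
  linear in \<open>N\<close>. They imply that \<open>y \<mapsto> N p (p + y) p\<close> is a quadratic form on \<open>M\<close>, which forces
  \<open>\<beta>\<close> to be the same for all lines, and then that \<open>N p q r = (q - p) * (r - q) * \<chi> p r\<close>. If
  \<open>\<beta> \<noteq> 0\<close>, then \<open>- \<chi> / \<beta>\<close> is a coboundary and rescaling the \<open>e\<^sub>p\<close> by it gives
  \<open>A\<^bsub>a,b\<^esub>\<close> with \<open>\<beta> = b (1 - b)\<close>; no root has to be extracted, since
  \<open>\<beta> b\<close> is the common slope of \<open>\<chi> p r * f r p\<close> in \<open>r - p\<close>. If \<open>\<beta> = 0\<close>, only the arrows into and out of weight 0 can
  deviate from \<open>A\<^bsub>a,1\<^esub>\<close>; they depend on at most two parameters and vanish in one direction.\<close>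

section \<open>Weights on a line\<close>

text \<open>Indecomposability concerns all of M and is not inherited by the restriction of V to a
  line, so the classification over \<int> cannot be applied line by line. It enters as connectedness
  of the support under nonzero arrows (\<open>S_split\<close>): for the coset, for the constancy of
  the central charge, and for the arrows at weight 0. On a line only the commutation relations and
  the bound 1 on dimensions are available. Since M may have infinite rank, no generators are chosen;
  lines are compared in pairs, through two directions at one base point. The degenerate value
  \<beta> = 0 means b = 0 or b = 1. If moreover 0 is a weight of the coset, \<open>P p 0\<close>
  vanishes for every p, so \<open>P\<close> no longer controls the arrows at 0; this is where A_a
  and B_a come from.\<close>

lemma parallelogram_identity:
  fixes f :: "'b \<Rightarrow> 'b \<Rightarrow> 'a::idom"
  assumes "b * f p r = f p s * f s r - f p q * f q r"
    and "b * f r p = f r s * f s p - f r q * f q p"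
    and "a * f q s = f q r * f r s - f q p * f p s"
    and "a * f s q = f s r * f r q - f s p * f p q"
  shows "f p r * f r p * b\<^sup>2 - f q s * f s q * a\<^sup>2 =
    (f p s * f s p - f q r * f r q) * (f s r * f r s - f p q * f q p)"
  \<comment> \<open>Multiply the first two assumptions, and the last two. Both products contain the
    same two oriented 4-cycles through p, q, r, s, which cancel in the difference.\<close>
  using assms by algebra

text \<open>Write \<open>f p s * f s r\<close> as \<open>f p q * f q r + b * f p r\<close>, do the
  same for the reversed path, and multiply. The fourth vertex s then occurs only in products of an
  arrow with its reverse, so two choices of s can be compared on one triangle.\<close>

lemma triangle_identity:
  fixes f :: "'b \<Rightarrow> 'b \<Rightarrow> 'a::idom"
  assumes "b * f p r = f p s * f s r - f p q * f q r"
    and "b * f r p = f r s * f s p - f r q * f q p"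
  shows "b * (f p q * f q r * f r p + f p r * f r q * f q p) =
    f p s * f s p * (f s r * f r s) - f p q * f q p * (f q r * f r q) - b\<^sup>2 * (f p r * f r p)"
  using assms by algebra

text \<open>A line \<open>p + \<int> x\<close> of weights, rescaled to step 1: index \<open>i\<close> stands for the weight
  \<open>p + i x\<close>, coefficients are divided by \<open>x\<close>, and \<open>w = p / x\<close>.\<close>

locale unit_line =
  fixes f :: "int \<Rightarrow> int \<Rightarrow> 'a::field_char_0" and w :: 'a
  assumes rel: "p \<noteq> r \<Longrightarrow> p + r = q + s \<Longrightarrow> of_int (s - q) * f p r = f p s * f s r - f p q * f q r"
begin

definition P where "P i j = f i j * f j i"

lemma P_sym: "P i j = P j i" by (simp add: P_def mult.commute)

lemma P_parallelogram:
  assumes "p + r = q + s" "p \<noteq> r" "q \<noteq> s"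
  shows "P p r * of_int (s - q) ^ 2 - P q s * of_int (r - p) ^ 2 = (P p s - P q r) * (P s r - P p q)"
  unfolding P_def
  by (rule parallelogram_identity; rule rel) (use assms in auto)

text \<open>The recursion moves a pair at distance m by m steps only; the parallelogram on four
  consecutive indices couples the distances 1, 2 and 3. Twelve base points leave room for a shift by
  6, a common multiple of 2 and 3.\<close>

lemma window:
  assumes rec: "\<And>i m. k \<le> i \<Longrightarrow> i \<le> k + 11 \<Longrightarrow> m\<in>{1,2,3} \<Longrightarrow>
     P i (i+m) - P (i-m) i = 2 * of_int m * (w + of_int i) - (\<kappa> * of_int m ^ 3 - \<kappa>' * of_int m)"
  shows "\<kappa> = 0" "P (k+1) (k+3) = P k (k+2) + 2 * (w + of_int k) + 3 + \<kappa>'"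
proof -
  define g where "g q = P (q-1) (q+1) - P (q-2) q" for q
  have r1: "P i (i+1) = P (i-1) i + 2 * (w + of_int i) - (\<kappa> - \<kappa>')" if "k \<le> i" "i \<le> k + 11" for i
    using rec[OF that, of 1] by (simp add: algebra_simps)
  have r2: "P i (i+2) = P (i-2) i + 4 * (w + of_int i) - (8 * \<kappa> - 2 * \<kappa>')" if "k \<le> i" "i \<le> k + 11" for i
    using rec[OF that, of 2] by (simp add: algebra_simps)
  have r3: "P i (i+3) = P (i-3) i + 6 * (w + of_int i) - (27 * \<kappa> - 3 * \<kappa>')" if "k \<le> i" "i \<le> k + 11" for i
    using rec[OF that, of 3] by (simp add: algebra_simps)
  have pr: "P (q-2) (q+1) - P (q-1) q * 9 = g q * (P (q-2) (q-1) - P q (q+1))" for q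
    using P_parallelogram[of "q+1" "q-2" q "q-1"]
    by (simp add: g_def P_sym[of "q+1"] P_sym[of q "q-1"] P_sym[of q "q-2"] P_sym[of "q-1" "q-2"])
  \<comment> \<open>Compare \<open>pr\<close> at q and q + 6. The changes of the values at distances
    1 and 3 are known and \<open>g\<close> grows by 12, so the unknown \<open>g q\<close> enters
    linearly, with coefficient 24.\<close>
  have G: "g q = 2 * (w + of_int q) - 1 + \<kappa> + \<kappa>'" if q: "q = k + 1 \<or> q = k + 2" for q
  proof -
    define x where "x = w + of_int q"
    have "P (q-1) q = P (q-2) (q-1) + 2 * (x - 1) - (\<kappa> - \<kappa>')"
      using r1[of "q-1"] q by (auto simp: algebra_simps x_def)
    moreover have "P q (q+1) = P (q-1) q + 2 * x - (\<kappa> - \<kappa>')" using r1[of q] q by (auto simp: x_def)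
    moreover have "P (q+1) (q+2) = P q (q+1) + 2 * (x+1) - (\<kappa> - \<kappa>')"
      using r1[of "q+1"] q by (auto simp: algebra_simps x_def)
    moreover have "P (q+2) (q+3) = P (q+1) (q+2) + 2 * (x+2) - (\<kappa> - \<kappa>')"
      using r1[of "q+2"] q by (auto simp: algebra_simps x_def)
    moreover have "P (q+3) (q+4) = P (q+2) (q+3) + 2 * (x+3) - (\<kappa> - \<kappa>')"
      using r1[of "q+3"] q by (auto simp: algebra_simps x_def)
    moreover have "P (q+4) (q+5) = P (q+3) (q+4) + 2 * (x+4) - (\<kappa> - \<kappa>')"
      using r1[of "q+4"] q by (auto simp: algebra_simps x_def)
    moreover have "P (q+5) (q+6) = P (q+4) (q+5) + 2 * (x+5) - (\<kappa> - \<kappa>')"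
      using r1[of "q+5"] q by (auto simp: algebra_simps x_def)
    moreover have "P (q+6) (q+7) = P (q+5) (q+6) + 2 * (x+6) - (\<kappa> - \<kappa>')"
      using r1[of "q+6"] q by (auto simp: algebra_simps x_def)
    moreover have "P (q+1) (q+4) = P (q-2) (q+1) + 6 * (x+1) - (27 * \<kappa> - 3 * \<kappa>')"
      using r3[of "q+1"] q by (auto simp: algebra_simps x_def)
    moreover have "P (q+4) (q+7) = P (q+1) (q+4) + 6 * (x+4) - (27 * \<kappa> - 3 * \<kappa>')"
      using r3[of "q+4"] q by (auto simp: algebra_simps x_def)
    moreover have "g (q+6) = g q + 12"
    proof -
      have s: "g (q+2) = g q + 4" if "k \<le> q" "q \<le> k + 8" for q
      proof -
        have "P (q+1) (q+3) = P (q-1) (q+1) + 4 * (w + of_int q + 1) - (8 * \<kappa> - 2 * \<kappa>')"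
          using r2[of "q+1"] that by (simp add: ac_simps)
        moreover have "P q (q+2) = P (q-2) q + 4 * (w + of_int q) - (8 * \<kappa> - 2 * \<kappa>')"
          using r2[of q] that by simp
        moreover have "g (q+2) = P (q+1) (q+3) - P q (q+2)" by (simp add: g_def add.commute)
        ultimately show ?thesis using g_def[of q] by algebra
      qed
      show ?thesis using s[of q] s[of "q+2"] s[of "q+4"] q by (auto simp: algebra_simps)
    qed
    moreover have "P (q-2) (q+1) - P (q-1) q * 9 = g q * (P (q-2) (q-1) - P q (q+1))" by (rule pr)
    moreover have "P (q+4) (q+7) - P (q+5) (q+6) * 9 = g (q+6) * (P (q+4) (q+5) - P (q+6) (q+7))"
      using pr[of "q+6"] by (simp add: algebra_simps)
    ultimately have "24 * g q = 24 * (2 * x - 1 + \<kappa> + \<kappa>')"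
      by algebra
    then show ?thesis by (simp only: mult_cancel_left) (simp_all add: x_def)
  qed
  \<comment> \<open>Two consecutive increments make up one step of the distance-2 recursion; its
    central term agrees with \<open>G\<close> only if 10 \<kappa> = 0.\<close>
  have "g (k+1) + g (k+2) = 4 * (w + of_int (k+1)) - (8 * \<kappa> - 2 * \<kappa>')"
    using r2[of "k+1"] by (simp add: g_def algebra_simps)
  then have "10 * \<kappa> = 10 * 0" using G[of "k+1"] G[of "k+2"] by simp
  then show k: "\<kappa> = 0" by simp
  show "P (k+1) (k+3) = P k (k+2) + 2 * (w + of_int k) + 3 + \<kappa>'"
    using G[of "k+2"] k by (simp add: g_def algebra_simps)
qed

end

locale unit_line_core = unit_line +
  assumes diag: "f p p = w + of_int p"
    and rel_diag: "p + p = q + s \<Longrightarrow> of_int (s - q) * f p p = f p s * f s p - f p q * f q p"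
begin

lemma P_step: "P i (i+m) - P (i-m) i = 2 * of_int m * (w + of_int i)"
  using rel_diag[of i "i-m" "i+m"] by (simp add: P_def diag mult.commute)

lemma P_1: "P k (k+1) = (w + of_int k) * (w + of_int k + 1) + (P 0 1 - w * (w + 1))"
proof -
  have s: "P (i+1) (i+2) = P i (i+1) + 2 * (w + of_int i + 1)" for i
    using P_step[of "i+1" 1] by (simp add: algebra_simps)
  show ?thesis
  proof (induction k rule: int_induct[where k = 0])
    case base then show ?case by simp
  next
    case (step1 i)
    then show ?case using s[of i] by (simp add: algebra_simps)
  next
    case (step2 i)
    then show ?case using s[of "i-1"] by (simp add: algebra_simps)
  qed
qed

text \<open>\<open>P_step\<close> moves a pair at distance 2 only by 2; the second part of
  \<open>window\<close> supplies steps of 1 and so ties even and odd indices together.\<close>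

lemma P_2: "P k (k+2) = (w + of_int k) * (w + of_int k + 2) + (P 0 2 - w * (w + 2))"
proof -
  have s: "P (i+1) (i+3) = P i (i+2) + 2 * (w + of_int i) + 3" for i
    using window(2)[of i 0 0] P_step by simp
  show ?thesis
  proof (induction k rule: int_induct[where k = 0])
    case base then show ?case by simp
  next
    case (step1 i)
    then show ?case using s[of i] by (simp add: algebra_simps)
  next
    case (step2 i)
    then show ?case using s[of "i-1"] by (simp add: algebra_simps)
  qed
qed

lemma line_P: "P i j = (w + of_int i) * (w + of_int j) + (P 0 1 - w * (w + 1)) * of_int (i - j) ^ 2"
proof -
  define \<beta> where "\<beta> = P 0 1 - w * (w + 1)"
  define \<gamma> where "\<gamma> = P 0 2 - w * (w + 2)"
  have p1: "P k (k+1) = (w + of_int k) * (w + of_int k + 1) + \<beta>" for k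
    unfolding \<beta>_def by (rule P_1)
  have p2: "P k (k+2) = (w + of_int k) * (w + of_int k + 2) + \<gamma>" for k
    unfolding \<gamma>_def by (rule P_2)
  have tri: "of_int (s - q) * (f p q * f q r * f r p + f p r * f r q * f q p) =
    P p s * P s r - P p q * P q r - of_int (s - q) ^ 2 * P p r" if "p + r = q + s" "p \<noteq> r" for p q r s
    unfolding P_def by (rule triangle_identity; rule rel) (use that in auto)
  \<comment> \<open>The sum over both orientations of the triangle 0, 1, 2 is computed once with
    fourth vertex 3 and once with fourth vertex -1.\<close>
  have "4 * \<beta> = \<gamma>"
  proof -
    have "3 * (f 1 0 * f 0 2 * f 2 1 + f 1 2 * f 2 0 * f 0 1) = P 1 3 * P 3 2 - P 1 0 * P 0 2 - 9 * P 1 2"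
      using tri[of 1 2 0 3] by simp
    moreover have "-3 * (f 0 2 * f 2 1 * f 1 0 + f 0 1 * f 1 2 * f 2 0) = P 0 (-1) * P (-1) 1 - P 0 2 * P 2 1 - 9 * P 0 1"
      using tri[of 0 1 2 "-1"] by simp
    moreover have "P 0 1 = w * (w+1) + \<beta>" "P 1 2 = (w+1)*(w+2) + \<beta>" "P 2 3 = (w+2)*(w+3) + \<beta>" "P (-1) 0 = (w-1)*w + \<beta>"
      using p1[of 0] p1[of 1] p1[of 2] p1[of "-1"] by (simp_all add: algebra_simps)
    moreover have "P 0 2 = w * (w+2) + \<gamma>" "P 1 3 = (w+1)*(w+3) + \<gamma>" "P (-1) 1 = (w-1)*(w+1) + \<gamma>"
      using p2[of 0] p2[of 1] p2[of "-1"] by (simp_all add: algebra_simps)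
    ultimately have "4 * (4 * \<beta>) = 4 * \<gamma>"
      unfolding P_sym[of 3 2] P_sym[of 1 0] P_sym[of 2 1] P_sym[of 0 "-1"] by algebra
    then show ?thesis by simp
  qed
  have main: "P k (k + int n) = (w + of_int k) * (w + of_int k + of_nat n) + \<beta> * of_nat n ^ 2" for k n
  proof (induction n arbitrary: k rule: less_induct)
    case (less n)
    consider "n = 0" | "n = 1" | "n = 2" | m where "n = m + 3"
      by (metis One_nat_def add.commute add_2_eq_Suc' less_2_cases not_less_iff_gr_or_eq
        nat_le_iff_add numeral_3_eq_3 Suc_leI Suc_1 numeral_2_eq_2)
    then show ?case
    proof cases
      case 1 then show ?thesis by (simp add: P_def diag)
    next
      case 2 then show ?thesis using p1[of k] by simp
    next
      case 3 then show ?thesis using p2[of k] \<open>4 * \<beta> = \<gamma>\<close> by (simp add: mult.commute)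
    next
      case (4 m)
      define x N where "x = w + of_int k" and "N = (of_nat m :: 'a)"
      \<comment> \<open>With outer points k, k + n and inner points k + 1, k + n - 1, the value at
        distance n is expressed by those at smaller distances; its factor (m + 1)^2 is not
        zero.\<close>
      have "P k (k + int (m + 3)) * (N + 1) ^ 2 - P (k+1) (k+1 + int (m+1)) * (N + 3) ^ 2 =
        (P k (k + int (m+2)) - P (k+1) (k+1 + int (m + 2))) * (P (k + int (m+2)) (k + int (m+2) + 1) - P k (k+1))"
        using P_parallelogram[of k "k + int (m+3)" "k+1" "k + int (m + 2)"] by (simp add: N_def add_ac)
      moreover have "P (k+1) (k+1 + int (m+1)) = (x+1) * (x + N + 2) + \<beta> * (N+1)^2"
        using less[of "m+1" "k+1"] 4 by (simp add: x_def N_def algebra_simps)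
      moreover have "P (k+1) (k+1 + int (m+2)) = (x+1) * (x + N + 3) + \<beta> * (N+2)^2"
        using less[of "m+2" "k+1"] 4 by (simp add: x_def N_def algebra_simps)
      moreover have "P k (k + int (m+2)) = x * (x + N + 2) + \<beta> * (N+2)^2"
        using less[of "m+2" "k"] 4 by (simp add: x_def N_def algebra_simps)
      moreover have "P k (k + 1) = x * (x + 1) + \<beta>" using p1[of k] by (simp add: x_def)
      moreover have "P (k + int (m+2)) (k + int (m+2) + 1) = (x + N + 2) * (x + N + 3) + \<beta>"
        using p1[of "k + int (m+2)"] by (simp add: x_def N_def algebra_simps)
      ultimately have "(N+1)^2 * P k (k + int (m + 3)) = (N+1)^2 * (x * (x + N + 3) + \<beta> * (N + 3)^2)"
        by algebra
      moreover have "(N+1)^2 \<noteq> 0"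
        unfolding N_def by (metis of_nat_1 of_nat_add of_nat_eq_0_iff power_not_zero add_is_0 zero_neq_one)
      ultimately show ?thesis unfolding 4 by (simp only: mult_cancel_left) (simp add: x_def N_def algebra_simps)
    qed
  qed
  have "P i j = (w + of_int i) * (w + of_int j) + \<beta> * of_int (i - j) ^ 2" if "i \<le> j" for i j
    using main[of i "nat (j - i)"] that by (simp add: algebra_simps power2_commute)
  from this[of i j] this[of j i] show ?thesis
    unfolding \<beta>_def[symmetric] P_sym[of j i] by (cases "i \<le> j") (simp_all add: mult.commute power2_commute)
qed

end

text \<open>\<open>S\<close> is the support on the line. The central term of \<open>[L\<^bsub>mx\<^esub>, L\<^bsub>-mx\<^esub>]\<close> becomes
  \<open>\<kappa> m\<^sup>3 - \<kappa>' m\<close> after rescaling, so \<open>\<kappa>\<close> and \<open>\<kappa>'\<close> are nonzero multiples of the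
  central charge.\<close>

locale unit_line_support = unit_line +
  fixes S :: "int set" and \<kappa> \<kappa>' :: 'a
  assumes off: "p \<notin> S \<Longrightarrow> f p q = 0" "p \<notin> S \<Longrightarrow> f q p = 0"
    and step: "p \<in> S \<Longrightarrow> P p (p+m) - P (p-m) p = 2 * of_int m * (w + of_int p) - (\<kappa> * of_int m ^ 3 - \<kappa>' * of_int m)"
begin

lemma in_S: "P i j \<noteq> 0 \<Longrightarrow> i \<in> S \<and> j \<in> S"
  using off by (fastforce simp: P_def)

lemma support_window: "{k..k+11} \<subseteq> S \<Longrightarrow> \<kappa> = 0"
  by (rule window(1)[of k \<kappa> \<kappa>']) (auto intro!: step)

text \<open>As the weight space at 1 vanishes, \<open>f 0 s * f s (s+1)\<close> is a multiple of \<open>f 0 (s+1)\<close>, which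
  yields a recursion in \<open>s\<close> for \<open>P 0 s\<close>. A nonzero value propagates along a half line, where
  \<open>support_window\<close> kills the central charge.\<close>

lemma missing_point:
  assumes "0 \<in> S" "1 \<notin> S" "w \<noteq> 0" "\<kappa> = 0 \<Longrightarrow> \<kappa>' = 0"
  shows "w + 1 = 0"
proof -
  define h where "h = P (-1) 0"
  have P1: "P 1 i = 0" "P i 1 = 0" for i using off assms(2) by (auto simp: P_def)
  have R: "of_int (s - 1) ^ 2 * P 0 (s+1) = P 0 s * P s (s+1)" if "s \<noteq> -1" for s
  proof -
    have "of_int (s - 1) * f 0 (s+1) = f 0 s * f s (s+1)" using rel[of 0 "s+1" 1 s] off(1)[OF assms(2)] that by simp
    moreover have "of_int (s - 1) * f (s+1) 0 = f (s+1) s * f s 0" using rel[of "s+1" 0 1 s] off[OF assms(2)] that by simp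
    ultimately show ?thesis unfolding P_def by algebra
  qed
  have h: "h = \<kappa> - \<kappa>' - 2 * w" using step[OF assms(1), of 1] P1 by (simp add: h_def algebra_simps)
  have neg: "P (- m) 0 = P 0 m + of_int m * h + \<kappa> * (of_int m ^ 3 - of_int m)" for m
    using step[OF assms(1), of m] by (simp add: h algebra_simps)
  show ?thesis
  proof (cases "h = 0")
    case False
    have N: "P (- int n) 0 \<noteq> 0 \<and> P (- int n) (1 - int n) = of_nat n * h + of_nat n * (of_nat n - 1)" if "n \<ge> 1" for n
      using that
    proof (induction n rule: dec_induct)
      case base then show ?case using False by (simp add: h_def)
    next
      case (step n)
      have "- int n \<in> S" using step in_S by blast
      then have "P (- int (Suc n)) (1 - int (Suc n)) = of_nat (Suc n) * h + of_nat (Suc n) * (of_nat (Suc n) - 1)"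
      proof -
        have e: "- int n + 1 = 1 - int n" "- int n - 1 = - int (Suc n)" "1 - int (Suc n) = - int n" by simp_all
        then have "P (- int n) (1 - int n) - P (- int (Suc n)) (1 - int (Suc n)) = 2 * (w - of_nat n) - (\<kappa> - \<kappa>')"
          using unit_line_support.step[OF unit_line_support_axioms \<open>- int n \<in> S\<close>, of 1] 
          by (simp del: of_nat_Suc add: e)
        moreover have "P (- int n) (1 - int n) = of_nat n * h + of_nat n * (of_nat n - 1)"
          using step by blast
        ultimately show ?thesis unfolding h of_nat_Suc by algebra
      qed
      moreover have "(of_nat n + 2)^2 * P (- int n) 0 = P (- int (Suc n)) 0 * P (- int (Suc n)) (1 - int (Suc n))"
        using R[of "- int (Suc n)"] step(1) by (simp add: P_sym[of 0] algebra_simps power2_eq_square)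
      moreover have "of_nat n + 2 \<noteq> (0::'a)" by (metis of_nat_add of_nat_numeral of_nat_eq_0_iff add_is_0 zero_neq_numeral)
      ultimately show ?case using step by auto
    qed
    \<comment> \<open>Any 12 consecutive negative indices would do.\<close>
    have "i \<in> S" if "i \<in> {-20..-20+11}" for i
      using N[of "nat (- i)"] that in_S[of i 0] by auto
    then have k: "\<kappa> = 0" using support_window[of "-20"] by blast
    then have k': "\<kappa>' = 0" by (rule assms)
    have h2: "h = - 2 * w" using h k k' by simp
    define a2 a3 a4 b2 b3 b4 where "a2 = P 0 2" "a3 = P 0 3" "a4 = P 0 4" "b2 = P (-2) 0" "b3 = P (-3) 0" "b4 = P (-4) 0"
    note ab = this
    have eqs: "b2 = a2 + 2 * h" "b3 = a3 + 3 * h" "b4 = a4 + 4 * h"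
      using neg[of 2] neg[of 3] neg[of 4] k by (simp_all add: ab)
    have "9 * h = b2 * (2 * h + 2)" "16 * b2 = b3 * (3 * h + 6)" "25 * b3 = b4 * (4 * h + 12)"
      using R[of "-2"] N[of 2] R[of "-3"] N[of 3] R[of "-4"] N[of 4] by (simp_all add: ab h_def P_sym[of 0])
    note beqs = this
    have s2: "P 2 3 = 4 - h" if "2 \<in> S" using step[OF that, of 1] P1 k k' h2 by (simp add: algebra_simps)
    have s3: "P 3 4 = 10 - 2 * h" if "2 \<in> S" "3 \<in> S"
      using step[OF that(2), of 1] s2[OF that(1)] P1 k k' h2 by (simp add: algebra_simps)
    have e3: "a3 = a2 * (4 - h)"
      using R[of 2] s2 in_S[of 0 2] by (cases "a2 = 0") (auto simp: ab)
    have e4: "4 * a4 = a3 * (10 - 2 * h)"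
      using R[of 3] s3 in_S[of 0 3] in_S[of 0 2] e3 by (cases "a3 = 0") (auto simp: ab)
    \<comment> \<open>\<open>R\<close> gives \<open>b2\<close> and \<open>b3\<close> in terms of h
      on the left and \<open>a3\<close> in terms of \<open>a2\<close> on the right;
      \<open>eqs\<close> joins the two sides. As h = -2w, the root h = 2 is the claim.\<close>
    have "h * ((h - 2) * (4 * h^2 + h - 2)) = 0"
      using eqs beqs e3 by algebra
    then consider "h = 2" | "4 * h^2 + h - 2 = 0" using False by auto
    then show ?thesis
    proof cases
      case 1
      have "2 * (w + 1) = 2 - h" using h2 by (simp add: algebra_simps)
      then show ?thesis using 1 by (metis diff_self mult_eq_0_iff zero_neq_numeral)
    next
      case 2
      \<comment> \<open>Index 4 yields a second equation for h. Reduced by the quadratic it becomes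
        linear, and eliminating h leaves a nonzero integer.\<close>
      have "h * (600 - (4-h)*(5-h)*(5-4*h)*(h+2)*(h+3) - 16*(h+1)*(h+2)*(h+3)) = 0"
        using eqs beqs e3 e4 by algebra
      then have "600 - (4-h)*(5-h)*(5-4*h)*(h+2)*(h+3) - 16*(h+1)*(h+2)*(h+3) = 0" using False by simp
      then have "169 * h + 62 = 0" using 2 by algebra
      then have "52224 = (0::'a)" using 2 by algebra
      then show ?thesis by simp
    qed
  next
    \<comment> \<open>If \<open>P 0 2\<close> is nonzero, the right half line is supported.
      Otherwise \<open>P 0 s\<close> vanishes for all s from 2 on, and \<open>neg\<close> leaves
      \<kappa> (m^3 - m) on the left half line. Either one contains a window, contrary to \<kappa>
      being nonzero.\<close>
    case True
    have w: "\<kappa> - \<kappa>' = 2 * w" using True h by simp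
    have k: "\<kappa> \<noteq> 0" using w assms by auto
    have R0: "(of_nat n + 1)^2 * P 0 (int n + 3) = P 0 (int n + 2) * P (int n + 2) (int n + 3)" for n
      using R[of "int n + 2"] by (simp add: algebra_simps)
    have nz: "of_nat n + 1 \<noteq> (0::'a)" for n by (metis of_nat_Suc of_nat_eq_0_iff add.commute nat.distinct(1))
    show ?thesis
    proof (cases "P 0 2 = 0")
      case False
      have "P 0 (int n + 2) \<noteq> 0 \<and> P (int n + 2) (int n + 3) = (of_nat n + 1) * (of_nat n + 4)" for n
      proof (induction n)
        case 0
        then show ?case using False step[of 2 1] in_S[of 0 2] P1 w by (auto simp: algebra_simps)
      next
        case (Suc n)
        have "P 0 (int n + 3) \<noteq> 0"
        proof -
          have "of_nat n + 4 \<noteq> (0::'a)" using nz[of "n+3"] by (simp add: add.assoc)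
          then show ?thesis using R0[of n] Suc nz[of n] by auto
        qed
        then show ?case using Suc step[of "int n + 3" 1] in_S[of 0 "int n + 3"] w by (auto simp: algebra_simps)
      qed
      then have "i \<in> S" if "i \<in> {2..2+11}" for i
        using in_S[of 0 i] spec[where x = "nat (i - 2)"] that by (metis atLeastAtMost_iff diff_ge_0_iff_ge int_nat_eq diff_add_cancel)
      then show ?thesis using support_window[of 2] k by blast
    next
      case True
      have z: "P 0 (int n + 2) = 0" for n
      proof (induction n)
        case 0 then show ?case using True by simp
      next
        case (Suc n) then show ?case using R0[of n] nz[of n] by (simp add: algebra_simps)
      qed
      have "i \<in> S" if "i \<in> {-20..-20+11}" for i
      proof -
        define n where "n = nat (- i - 2)"
        have i: "i = - (int n + 2)" using that by (auto simp: n_def)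
        have "P i 0 = \<kappa> * of_int ((int n + 2) ^ 3 - (int n + 2))"
          using neg[of "int n + 2"] z[of n] \<open>h = 0\<close> by (simp add: i)
        moreover have "(int n + 2) ^ 3 - (int n + 2) = (int n + 1) * (int n + 2) * (int n + 3)" by (simp add: algebra_simps power3_eq_cube)
        ultimately have "P i 0 \<noteq> 0" using k by (simp only: mult_eq_0_iff of_int_eq_0_iff) auto
        then show ?thesis using in_S by blast
      qed
      then show ?thesis using support_window[of "-20"] k by blast
    qed
  qed
qed

end

section \<open>Coefficient systems on a coset of weights\<close>

locale witt_graded =
  fixes M W :: "'a::field_char_0 set" and f :: "'a \<Rightarrow> 'a \<Rightarrow> 'a"
  assumes M_zero: "0 \<in> M" and M_add: "x \<in> M \<Longrightarrow> y \<in> M \<Longrightarrow> x + y \<in> M" and M_minus: "x \<in> M \<Longrightarrow> - x \<in> M"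
    and W_add: "p \<in> W \<Longrightarrow> x \<in> M \<Longrightarrow> p + x \<in> W"
    and W_diff: "p \<in> W \<Longrightarrow> q \<in> W \<Longrightarrow> q - p \<in> M"
    and rel: "p \<in> W \<Longrightarrow> q \<in> W \<Longrightarrow> r \<in> W \<Longrightarrow>
      (p + r - 2 * q) * f p r = f p (p + r - q) * f (p + r - q) r - f p q * f q r"
    and diag: "p \<in> W \<Longrightarrow> f p p = p"
begin

lemma M_diff: "x \<in> M \<Longrightarrow> y \<in> M \<Longrightarrow> x - y \<in> M"
  using M_add[of x "- y"] M_minus[of y] by simp

lemma M_int: "x \<in> M \<Longrightarrow> of_int k * x \<in> M"
proof (induction k rule: int_induct[where k = 0])
  case base then show ?case by (simp add: M_zero)
next
  case (step1 i) then show ?case using M_add[of "of_int i * x" x] by (simp add: algebra_simps)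
next
  case (step2 i) then show ?case using M_diff[of "of_int i * x" x] by (simp add: algebra_simps)
qed

lemma W_minus: "p \<in> W \<Longrightarrow> x \<in> M \<Longrightarrow> p - x \<in> W"
  using W_add[of p "- x"] M_minus[of x] by simp

lemma W_reflect: "p \<in> W \<Longrightarrow> q \<in> W \<Longrightarrow> r \<in> W \<Longrightarrow> p + r - q \<in> W"
  using W_add[of p "r - q"] W_diff[of q r] by (simp add: algebra_simps)

lemmas closed = M_zero M_add M_minus M_diff M_int W_add W_minus

lemma rel_sum:
  assumes "p \<in> W" "q \<in> W" "r \<in> W" "p + r = q + s"
  shows "(s - q) * f p r = f p s * f s r - f p q * f q r"
proof -
  have s: "s = p + r - q" using assms(4) by (simp add: algebra_simps)
  show ?thesis unfolding s using rel[OF assms(1-3)] by (simp add: algebra_simps)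
qed

definition P where "P p q = f p q * f q p"

definition N where "N p q r = f p q * f q r - q * f p r"

lemma P_sym: "P p q = P q p" by (simp add: P_def mult.commute)

lemma P_parallelogram:
  assumes "p \<in> W" "q \<in> W" "r \<in> W" "s = p + r - q"
  shows "P p r * (s - q)\<^sup>2 - P q s * (r - p)\<^sup>2 = (P p s - P q r) * (P s r - P p q)"
proof -
  have s: "s \<in> W" using assms W_reflect by simp
  have "(s - q) * f p r = f p s * f s r - f p q * f q r"
    using rel_sum[of p q r s] assms by simp
  moreover have "(s - q) * f r p = f r s * f s p - f r q * f q p"
    using rel_sum[of r q p s] assms by simp
  moreover have "(r - p) * f q s = f q r * f r s - f q p * f p s"
    using rel_sum[of q p s r] assms s by simp
  moreover have "(r - p) * f s q = f s r * f r q - f s p * f p q"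
    using rel_sum[of s p q r] assms s by simp
  ultimately show ?thesis unfolding P_def by (rule parallelogram_identity)
qed

lemma N_sym: "p \<in> W \<Longrightarrow> q \<in> W \<Longrightarrow> r \<in> W \<Longrightarrow> s = p + r - q \<Longrightarrow> N p s r = N p q r"
  using rel_sum[of p q r s] unfolding N_def by (simp add: algebra_simps)

lemma N_left: "p \<in> W \<Longrightarrow> N p p r = 0" and N_right: "r \<in> W \<Longrightarrow> N p r r = 0"
  by (simp_all add: N_def diag)

lemma N_loop: "p \<in> W \<Longrightarrow> N p q p = P p q - p * q"
  by (simp add: N_def P_def diag)

text \<open>Let \<Omega>(m,n) = L_m L_n - L_(m+n) L_0 - n L_(m+n), which is symmetric in m and n.
  Its coefficient on e_p is \<open>N p (p + n) (p + m + n)\<close>. The identity is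
  [L_l, \<Omega>(m,n)] = (m - l) \<Omega>(l+m,n) + (n - l) \<Omega>(m,l+n) + l \<Omega>(m+n,l), read
  off at e_p.\<close>

lemma N_commutator:
  assumes "p \<in> W" "l \<in> M" "m \<in> M" "n \<in> M" "q = p + n" "r = p + m + n" "t = p + l + m + n"
  shows "f r t * N p q r - f p (p + l) * N (p + l) (q + l) t =
    (m - l) * N p q t + (n - l) * N p (p + m) t + l * N p (p + l) t"
proof -
  have W: "q \<in> W" "r \<in> W" "t \<in> W" "p + m \<in> W" "q + l \<in> W" using assms by (auto intro!: closed)
  have 0: "N p (q + l) t = N p (p + m) t" using N_sym[of p "p+m" t "q + l"] assms W by simp
  have "(l - m) * f q t = f q (q + l) * f (q + l) t - f q r * f r t"
    using rel_sum[of q r t "q + l"] W assms by (simp add: algebra_simps)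
  moreover have "(l - n) * f p (q + l) = f p (p + l) * f (p + l) (q + l) - f p q * f q (q + l)"
    using rel_sum[of p q "q + l" "p + l"] W assms(1,5) by (simp add: algebra_simps)
  moreover have "(l - m - n) * f p t = f p (p + l) * f (p + l) t - f p r * f r t"
    using rel_sum[of p r t "p + l"] W assms by (simp add: algebra_simps)
  ultimately show ?thesis unfolding 0[symmetric] unfolding N_def using assms(5-7) by algebra
qed

end

section \<open>Factorisation of the defect when one constant governs \<open>P\<close>\<close>

locale witt_graded_const = witt_graded +
  fixes \<beta> :: 'a
  assumes P_const: "p \<in> W \<Longrightarrow> q \<in> W \<Longrightarrow> P p q = p * q + \<beta> * (p - q)\<^sup>2"
begin

text \<open>Commute L_D with a loop -y, y: the defect of the loop is \<beta> y^2 at both p and p +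
  D, so the left side of \<open>N_commutator\<close> cancels.\<close>

lemma N_shift:
  assumes "p \<in> W" "y \<in> M" "D \<in> M" 
  shows "(y + D) * N p (p + y) (p + D) = (y - D) * N p (p + (y + D)) (p + D)"
proof -
  have "N p (p + (y + D)) (p + D) = N p (p + - y) (p + D)"
    using assms by (intro N_sym closed) auto
  moreover have "N p (p + y) p = \<beta> * y\<^sup>2" "N (p + D) (p + y + D) (p + D) = \<beta> * y\<^sup>2"
    using assms by (simp_all add: N_loop P_const closed)
  moreover have "N p (p + D) (p + D) = 0" using assms by (intro N_right closed)
  ultimately show ?thesis
    using N_commutator[OF assms(1) assms(3) M_minus[OF assms(2)] assms(2), of "p + y" p "p + D"]
    by (simp add: algebra_simps)
qed

text \<open>Put \<open>\<phi> y = N p (p + y) (p + D)\<close>. By \<open>N_shift\<close>, \<open>\<phi> y / (y (D - y))\<close> has period \<open>D\<close>. It is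
  constant: commuting \<open>L\<^bsub>-D\<^esub>\<close> past two operators of total degree \<open>2D\<close> relates it to
  functions of period \<open>2D\<close> of the same kind.\<close>

lemma N_quadratic:
  assumes p: "p \<in> W" and M: "v \<in> M" "D \<in> M" 
  shows "2 * D\<^sup>2 * N p (p + v) (p + D) = v * (v - D) * N p (p - D) (p + D)"
proof (cases "D = 0")
  case True then show ?thesis using p by (simp add: N_loop P_const)
next
  case False
  define \<phi> where "\<phi> y = N p (p + y) (p + D)" for y
  define \<Lambda> where "\<Lambda> v = f (p + 2 * D) (p + D) * N p (p + v) (p + 2 * D)
     - f p (p - D) * N (p - D) (p - D + v) (p + D)" for v
  have M2: "2 * D \<in> M" using M_int[of D 2] M by simp
  have shift: "(y + D) * \<phi> y = (y - D) * \<phi> (y + D)" if "y \<in> M" for y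
    unfolding \<phi>_def using p that M(2) by (rule N_shift)
  have main: "2 * D\<^sup>2 * \<phi> v = v * (v - D) * \<phi> (- D)" if "v + 2 * D \<noteq> 0" "v \<in> M" for v
  proof -
    note M = M that(2)
    have \<Lambda>: "\<Lambda> v = (3 * D - v) * \<phi> v + (v + D) * \<phi> (v - D) - D * \<phi> (- D)" if "v \<in> M" for v
    proof -
      have "N p (p + (2 * D - v)) (p + D) = N p (p + (v - D)) (p + D)"
        using p that M M2 by (intro N_sym closed) auto
      then show ?thesis
        using N_commutator[OF p M_minus[OF M(2)] M_diff[OF M2 that] that, of "p + v" "p + 2 * D" "p + D"]
        unfolding \<Lambda>_def \<phi>_def by (simp add: algebra_simps)
    qed
    have "(v + 2 * D) * \<Lambda> v = (v - 2 * D) * \<Lambda> (v + 2 * D)"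
    proof -
      have "(v + 2 * D) * N p (p + v) (p + 2 * D) = (v - 2 * D) * N p (p + (v + 2 * D)) (p + 2 * D)"
        using p M(3) M2 by (rule N_shift)
      moreover have "(v + 2 * D) * N (p - D) (p - D + v) (p + D) = (v - 2 * D) * N (p - D) (p - D + (v + 2 * D)) (p + D)"
        using N_shift[of "p - D" v "2 * D"] p M(3) M(2) M2 closed by (simp add: algebra_simps)
      ultimately show ?thesis unfolding \<Lambda>_def by algebra
    qed
    moreover have "\<Lambda> (v + 2 * D) = (D - v) * \<phi> (v + 2 * D) + (v + 3 * D) * \<phi> (v + D) - D * \<phi> (- D)"
    proof -
      have "v + 2 * D - D = v + D" "3 * D - (v + 2 * D) = D - v" "v + 2 * D + D = v + 3 * D" by (simp_all add: algebra_simps)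
      moreover have "v + 2 * D \<in> M" using M M2 by (intro closed)
      ultimately show ?thesis using \<Lambda>[of "v + 2 * D"] by (simp only:)
    qed
    moreover note \<Lambda>[OF M(3)]
    moreover have "v * \<phi> (v - D) = (v - 2 * D) * \<phi> v"
      using shift[of "v - D"] M closed by (simp add: algebra_simps)
    moreover have "(v + D) * \<phi> v = (v - D) * \<phi> (v + D)" using shift[of v] M by simp
    moreover have "(v + 2 * D) * \<phi> (v + D) = v * \<phi> (v + 2 * D)"
      using shift[of "v + D"] M closed by (simp add: algebra_simps)
    ultimately have "(v + 2 * D) * D^2 * 4 * (2 * D\<^sup>2 * \<phi> v) = (v + 2 * D) * D^2 * 4 * (v * (v - D) * \<phi> (- D))"
      by algebra
    then show ?thesis using False that(1) by (simp only: mult_cancel_left) simp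
  qed
  have "2 * D\<^sup>2 * \<phi> v = v * (v - D) * \<phi> (- D)"
  proof (cases "v + 2 * D = 0")
    \<comment> \<open>Cancelling the factor v + 2D has lost this point; the reflection v \<mapsto> D
      - v of \<open>N_sym\<close> moves it to 3D, where \<open>main\<close> applies.\<close>
    case True
    then have v: "v = - 2 * D" by (simp add: eq_neg_iff_add_eq_0)
    have "\<phi> v = \<phi> (D - v)" unfolding \<phi>_def using p M by (intro N_sym closed) auto
    moreover have "D - v + 2 * D = 5 * D" by (simp add: v)
    moreover have "D - v \<in> M" using M closed by blast
    ultimately show ?thesis using main[of "D - v"] False by (simp add: v algebra_simps)
  next
    case False then show ?thesis using main M by blast
  qed
  then show ?thesis by (simp add: \<phi>_def)
qed

lemma N_factor: "\<exists>\<chi>. \<forall>p\<in>W. \<forall>q\<in>W. \<forall>r\<in>W. N p q r = (q - p) * (r - q) * \<chi> p r"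
proof -
  \<comment> \<open>The values are forced: for q = 2p - r the product (q - p)(r - q) is -2 (r -
    p)^2, and on a loop N is \<beta> (q - p)^2.\<close>
  define \<chi> where "\<chi> p r = (if p = r then - \<beta> else - N p (2 * p - r) r / (2 * (r - p)\<^sup>2))" for p r
  have "N p q r = (q - p) * (r - q) * \<chi> p r" if "p \<in> W" "q \<in> W" "r \<in> W" for p q r
  proof (cases "p = r")
    case True
    then show ?thesis using that by (simp add: \<chi>_def N_loop P_const power2_eq_square algebra_simps)
  next
    case False
    have "2 * (r - p)\<^sup>2 * N p q r = (q - p) * (q - r) * N p (2 * p - r) r"
      using N_quadratic[of p "q - p" "r - p"] that W_diff by simp
    then show ?thesis using False by (simp add: \<chi>_def field_simps)
  qed
  then show ?thesis by blast
qed

end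

text \<open>Both \<open>i\<close> and \<open>i\<^sup>2\<close> solve the relation; a solution vanishing at 1 and 2 is zero because the
  indices 3 to 6 give \<open>8 * g 3 = 0\<close>.\<close>

lemma quadratic_of_relation:
  fixes h X :: "int \<Rightarrow> 'a::field_char_0"
  assumes D: "\<And>k. D \<noteq> of_int k"
    and eq: "\<And>i j. of_int (i * j) * X (i + j) = (of_int (2 * i + j) - D) * h j
      + (of_int (i + 2 * j) - D) * h i + (D - of_int (i + j)) * h (i + j)"
  shows "\<exists>\<alpha> \<gamma>. \<forall>i. h i = \<alpha> * of_int i + \<gamma> * of_int i ^ 2"
proof -
  define \<gamma> where "\<gamma> = (h 2 - 2 * h 1) / 2"
  define \<alpha> where "\<alpha> = h 1 - \<gamma>"
  define g where "g i = h i - \<alpha> * of_int i - \<gamma> * of_int i ^ 2" for i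
  define Y where "Y n = X n - 2 * \<alpha> - \<gamma> * (2 * D - of_int n)" for n
  have g1: "g 1 = 0" by (simp add: g_def \<alpha>_def)
  have g2: "g 2 = 0" by (simp add: g_def \<alpha>_def \<gamma>_def field_simps)
  have e: "of_int (i * j) * Y (i + j) = (of_int (2 * i + j) - D) * g j
      + (of_int (i + 2 * j) - D) * g i + (D - of_int (i + j)) * g (i + j)" for i j
    using eq[of i j] unfolding Y_def g_def of_int_mult of_int_add of_int_numeral by algebra
  have Dn: "D - of_int k \<noteq> 0" for k using D[of k] by simp
  have nat: "g (int n + 1) = 0 \<and> g (int n + 2) = 0" for n
  proof (induction n)
    case 0 then show ?case by (simp add: g1 g2)
  next
    case (Suc n)
    show ?case
    proof (cases "n = 0")
      case True
      have "2 * Y 3 = (D - 3) * g 3" using e[of 1 2] g1 g2 by simp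
      moreover have "3 * Y 4 = (5 - D) * g 3 + (D - 4) * g 4" "4 * Y 4 = (D - 4) * g 4"
        using e[of 1 3] e[of 2 2] g1 g2 by simp_all
      moreover have "4 * Y 5 = (6 - D) * g 4 + (D - 5) * g 5" "6 * Y 5 = (7 - D) * g 3 + (D - 5) * g 5"
        using e[of 1 4] e[of 2 3] g1 g2 by simp_all
      moreover have "5 * Y 6 = (7 - D) * g 5 + (D - 6) * g 6" "8 * Y 6 = (8 - D) * g 4 + (D - 6) * g 6"
        "9 * Y 6 = (9 - D) * g 3 + (9 - D) * g 3 + (D - 6) * g 6"
        using e[of 1 5] e[of 2 4] e[of 3 3] g1 g2 by simp_all
      ultimately have "8 * g 3 = 0" by algebra
      then show ?thesis using True g2 by simp
    next
      case False
      then obtain m where m: "n = Suc m" by (cases n) auto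
      \<comment> \<open>The splittings 1 + (m + 3) and 2 + (m + 2) of the index m + 4 give different
        coefficients of \<open>Y\<close>. For index 3 they coincide, hence the separate case
        above.\<close>
      have "(of_nat m + 3) * Y (int m + 4) = (D - of_int (int m + 4)) * g (int m + 4)"
        using e[of 1 "int m + 3"] g1 Suc m by (simp add: algebra_simps)
      moreover have "2 * (of_nat m + 2) * Y (int m + 4) = (D - of_int (int m + 4)) * g (int m + 4)"
        using e[of 2 "int m + 2"] g2 Suc m by (simp add: algebra_simps)
      ultimately have "(of_nat m + 1) * ((D - of_int (int m + 4)) * g (int m + 4)) = 0" by algebra
      moreover have "of_nat m + 1 \<noteq> (0::'a)" by (metis of_nat_Suc of_nat_eq_0_iff add.commute nat.distinct(1))
      ultimately have "g (int m + 4) = 0" using Dn[of "int m + 4"] by (simp del: of_int_add)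
      then show ?thesis using Suc m by (simp add: algebra_simps)
    qed
  qed
  have pos: "g k = 0" if "k \<ge> 1" for k using nat[of "nat (k - 1)"] that by simp
  have Y: "Y k = 0" if "k \<ge> 2" for k using e[of 1 "k - 1"] pos[of 1] pos[of "k - 1"] pos[of k] that
    by (cases "k = 1") auto
  have "g k = 0" for k
  proof (cases "k \<ge> 1")
    case False
    have "(of_int (2 * (2 - k) + k) - D) * g k = 0"
      using e[of "2 - k" k] False pos[of "2 - k"] pos[of 2] Y[of 2] by simp
    then show ?thesis using D[of "2 * (2 - k) + k"] by simp
  qed (rule pos)
  then have "h i = \<alpha> * of_int i + \<gamma> * of_int i ^ 2" for i
    using g_def[of i] by (simp add: algebra_simps)
  then show ?thesis by blast
qed

section \<open>The form \<open>quad\<close> on lines and its parallelogram law\<close>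

context witt_graded
begin

definition quad where "quad p y = N p (p + y) p"

lemma quad_eq: "p \<in> W \<Longrightarrow> quad p y = P p (p + y) - p * (p + y)"
  by (simp add: quad_def N_loop)

lemma quad_zero: "p \<in> W \<Longrightarrow> quad p 0 = 0"
  by (simp add: quad_def N_left)

lemma quad_minus: "p \<in> W \<Longrightarrow> y \<in> M \<Longrightarrow> quad p (- y) = quad p y"
  unfolding quad_def using N_sym[of p "p + y" p "p + - y"] W_add by simp

lemma line_P:
  assumes "p0 \<in> W" "\<mu> \<in> M" "\<mu> \<noteq> 0"
  shows "\<exists>\<beta>. \<forall>i j. P (p0 + of_int i * \<mu>) (p0 + of_int j * \<mu>) =
     (p0 + of_int i * \<mu>) * (p0 + of_int j * \<mu>) + \<beta> * (of_int (i - j) * \<mu>)\<^sup>2"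
proof -
  define F where "F i j = f (p0 + of_int i * \<mu>) (p0 + of_int j * \<mu>) / \<mu>" for i j
  have W: "p0 + of_int i * \<mu> \<in> W" for i using assms by (intro closed)
  have r: "of_int (s - q) * F p r = F p s * F s r - F p q * F q r" if "p + r = q + s" for p q r s
  proof -
    define x where "x i = p0 + of_int i * \<mu>" for i
    have F: "f (x i) (x j) = F i j * \<mu>" for i j using assms(3) by (simp add: F_def x_def)
    have "(of_int p + of_int r :: 'a) = of_int q + of_int s" using that by (metis of_int_add)
    then have "x p + x r = x q + x s" unfolding x_def by algebra
    from rel_sum[OF _ _ _ this] have "(x s - x q) * (F p r * \<mu>) = (F p s * \<mu>) * (F s r * \<mu>) - (F p q * \<mu>) * (F q r * \<mu>)"
      unfolding F by (simp add: x_def W)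
    moreover have "x s - x q = of_int (s - q) * \<mu>" by (simp add: x_def algebra_simps)
    ultimately have "(of_int (s - q) * \<mu>) * (F p r * \<mu>) = (F p s * \<mu>) * (F s r * \<mu>) - (F p q * \<mu>) * (F q r * \<mu>)"
      by simp
    then have "(of_int (s - q) * F p r) * \<mu>^2 = (F p s * F s r - F p q * F q r) * \<mu>^2"
      by (simp add: algebra_simps power2_eq_square)
    then show ?thesis using assms(3) by simp
  qed
  interpret L: unit_line_core F "p0 / \<mu>"
  proof
    show "F i i = p0 / \<mu> + of_int i" for i
      using diag[OF W[of i]] assms(3) by (simp add: F_def field_simps)
  qed (use r in auto)
  define \<beta> where "\<beta> = F 0 1 * F 1 0 - p0 / \<mu> * (p0 / \<mu> + 1)"
  have "P (p0 + of_int i * \<mu>) (p0 + of_int j * \<mu>) =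
     (p0 + of_int i * \<mu>) * (p0 + of_int j * \<mu>) + \<beta> * (of_int (i - j) * \<mu>)\<^sup>2" for i j
  proof -
    have "P (p0 + of_int i * \<mu>) (p0 + of_int j * \<mu>) = \<mu>^2 * (F i j * F j i)"
      using assms(3) by (simp add: F_def P_def power2_eq_square)
    also have "F i j * F j i = (p0 / \<mu> + of_int i) * (p0 / \<mu> + of_int j) + \<beta> * of_int (i - j) ^ 2"
      using L.line_P[of i j] unfolding L.P_def \<beta>_def .
    finally have *: "P (p0 + of_int i * \<mu>) (p0 + of_int j * \<mu>) =
      \<mu>^2 * ((p0 / \<mu> + of_int i) * (p0 / \<mu> + of_int j) + \<beta> * of_int (i - j) ^ 2)" .
    define c where "c = p0 / \<mu>"
    have "p0 = c * \<mu>" using assms(3) by (simp add: c_def)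
    then show ?thesis using * unfolding c_def[symmetric] by algebra
  qed
  then show ?thesis by blast
qed

lemma quad_line:
  assumes "p \<in> W" "\<mu> \<in> M"
  shows "quad (p + of_int i * \<mu>) (of_int j * \<mu>) = of_int j ^ 2 * quad p \<mu>"
proof (cases "\<mu> = 0")
  case False
  obtain \<beta> where b: "\<And>i j. P (p + of_int i * \<mu>) (p + of_int j * \<mu>) =
     (p + of_int i * \<mu>) * (p + of_int j * \<mu>) + \<beta> * (of_int (i - j) * \<mu>)\<^sup>2"
    using line_P[OF assms False] by blast
  have "p + of_int i * \<mu> \<in> W" using assms by (intro closed)
  then have "quad (p + of_int i * \<mu>) (of_int j * \<mu>) = \<beta> * (of_int j * \<mu>)\<^sup>2"
    using b[of i "i + j"] by (simp add: quad_eq algebra_simps)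
  moreover have "quad p \<mu> = \<beta> * \<mu>\<^sup>2" using b[of 0 1] assms by (simp add: quad_eq)
  ultimately show ?thesis by (simp add: power_mult_distrib)
qed (use assms quad_zero in simp)

text \<open>On the cyclic group generated by \<mu>, constancy of \<beta> is already
  \<open>line_P\<close>. So \<open>N_factor\<close> applies to the line as a coefficient system of
  its own, before \<beta> is known to be constant on \<open>W\<close>.\<close>

lemma line_N:
  assumes "p \<in> W" "\<mu> \<in> M" "\<mu> \<noteq> 0"
  shows "\<exists>\<chi>. \<forall>i j k. N (p + of_int i * \<mu>) (p + of_int j * \<mu>) (p + of_int k * \<mu>) =
    of_int ((j - i) * (k - j)) * \<chi> i k"
proof -
  obtain \<beta> where b: "\<And>i j. P (p + of_int i * \<mu>) (p + of_int j * \<mu>) =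
     (p + of_int i * \<mu>) * (p + of_int j * \<mu>) + \<beta> * (of_int (i - j) * \<mu>)\<^sup>2"
    using line_P[OF assms] by blast
  let ?M = "range (\<lambda>k. of_int k * \<mu>)" and ?W = "range (\<lambda>k. p + of_int k * \<mu>)"
  have sub: "x \<in> ?W \<Longrightarrow> x \<in> W" for x using assms by (auto intro!: closed)
  interpret L: witt_graded_const ?M ?W f \<beta>
  proof -
    have *: "witt_graded ?M ?W f"
    proof
      show "0 \<in> ?M" by (auto intro: range_eqI[of _ _ 0])
    next
      fix x y assume "x \<in> ?M" "y \<in> ?M"
      then obtain i j where "x = of_int i * \<mu>" "y = of_int j * \<mu>" by auto
      then show "x + y \<in> ?M" by (intro range_eqI[of _ _ "i + j"]) (simp add: algebra_simps)
    next
      fix x assume "x \<in> ?M"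
      then obtain i where "x = of_int i * \<mu>" by auto
      then show "- x \<in> ?M" by (intro range_eqI[of _ _ "- i"]) simp
    next
      fix q x assume "q \<in> ?W" "x \<in> ?M"
      then obtain i j where "q = p + of_int i * \<mu>" "x = of_int j * \<mu>" by auto
      then show "q + x \<in> ?W" by (intro range_eqI[of _ _ "i + j"]) (simp add: algebra_simps)
    next
      fix q x assume "q \<in> ?W" "x \<in> ?W"
      then obtain i j where "q = p + of_int i * \<mu>" "x = p + of_int j * \<mu>" by auto
      then show "x - q \<in> ?M" by (intro range_eqI[of _ _ "j - i"]) (simp add: algebra_simps)
    next
      fix p q r assume "p \<in> ?W" "q \<in> ?W" "r \<in> ?W"
      then show "(p + r - 2 * q) * f p r = f p (p + r - q) * f (p + r - q) r - f p q * f q r"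
        by (intro rel sub)
    qed (intro diag sub)
    show "witt_graded_const ?M ?W f \<beta>"
    proof (intro witt_graded_const.intro * witt_graded_const_axioms.intro)
      fix x y assume "x \<in> ?W" "y \<in> ?W"
      then obtain i j where "x = p + of_int i * \<mu>" "y = p + of_int j * \<mu>" by auto
      then show "witt_graded.P f x y = x * y + \<beta> * (x - y)\<^sup>2"
        using b[of i j] by (simp add: left_diff_distrib)
    qed
  qed
  obtain \<chi> where c: "\<And>p q r. p \<in> ?W \<Longrightarrow> q \<in> ?W \<Longrightarrow> r \<in> ?W \<Longrightarrow> N p q r = (q - p) * (r - q) * \<chi> p r"
    using L.N_factor by blast
  have "N (p + of_int i * \<mu>) (p + of_int j * \<mu>) (p + of_int k * \<mu>) =
    of_int ((j - i) * (k - j)) * (\<mu>^2 * \<chi> (p + of_int i * \<mu>) (p + of_int k * \<mu>))" for i j k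
    unfolding c[OF rangeI rangeI rangeI] of_int_mult of_int_diff by algebra
  then show ?thesis
    by (intro exI[of _ "\<lambda>i k. \<mu>^2 * \<chi> (p + of_int i * \<mu>) (p + of_int k * \<mu>)"]) blast
qed

text \<open>Take l = D - (i + j) \<mu>, which leads from the line through p to the parallel line
  through p + D. The left side of \<open>N_commutator\<close> then contains only defects inside one
  of the two lines, and \<open>line_N\<close> turns it into i j times a function of i + j. In units
  of \<mu> this is the hypothesis of \<open>quadratic_of_relation\<close>.\<close>

lemma N_poly:
  assumes "p \<in> W" "\<mu> \<in> M" "\<mu> \<noteq> 0" "D \<in> M" and D: "\<And>k. D \<noteq> of_int k * \<mu>"
  shows "\<exists>\<alpha> \<gamma>. \<forall>i. N p (p + of_int i * \<mu>) (p + D) = \<alpha> * of_int i + \<gamma> * of_int i ^ 2"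
proof -
  obtain \<chi> where \<chi>: "\<And>i j k. N (p + of_int i * \<mu>) (p + of_int j * \<mu>) (p + of_int k * \<mu>) =
    of_int ((j - i) * (k - j)) * \<chi> i k" using line_N[OF assms(1-3)] by blast
  obtain \<chi>' where \<chi>': "\<And>i j k. N (p + D + of_int i * \<mu>) (p + D + of_int j * \<mu>) (p + D + of_int k * \<mu>) =
    of_int ((j - i) * (k - j)) * \<chi>' i k" using line_N[OF W_add[OF assms(1,4)] assms(2,3)] by blast
  define h where "h i = N p (p + of_int i * \<mu>) (p + D)" for i
  define X where "X n = (f (p + of_int n * \<mu>) (p + D) * \<chi> 0 n - f p (p + D - of_int n * \<mu>) * \<chi>' (- n) 0) / \<mu>" for n
  show ?thesis unfolding h_def[symmetric]
  proof (rule quadratic_of_relation)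
    show "D / \<mu> \<noteq> of_int k" for k using D[of k] assms(3) by (simp add: field_simps)
    fix i j
    define l where "l = D - of_int (i + j) * \<mu>"
    have l: "l \<in> M" unfolding l_def using assms by (intro closed)
    have e: "p + of_int (i + j) * \<mu> = p + of_int i * \<mu> + of_int j * \<mu>" "p + D = p + l + of_int i * \<mu> + of_int j * \<mu>"
      by (simp_all add: l_def algebra_simps)
    define a b where "a = f (p + of_int (i + j) * \<mu>) (p + D)" and "b = f p (p + l)"
    define c c' where "c = \<chi> 0 (i + j)" and "c' = \<chi>' (- (i + j)) 0"
    have "a * N p (p + of_int j * \<mu>) (p + of_int (i + j) * \<mu>) - b * N (p + l) (p + of_int j * \<mu> + l) (p + D) =
       (of_int i * \<mu> - l) * h j + (of_int j * \<mu> - l) * h i + l * N p (p + l) (p + D)"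
      unfolding h_def a_def b_def
      using N_commutator[OF assms(1) l M_int[OF assms(2)] M_int[OF assms(2)] refl e] .
    moreover have "N p (p + l) (p + D) = h (i + j)"
      unfolding h_def
      by (rule N_sym) (use W_add[OF assms(1) M_int[OF assms(2), of "i + j"]] W_add[OF assms(1,4)] assms(1) in \<open>auto simp: l_def\<close>)
    moreover have "N p (p + of_int j * \<mu>) (p + of_int (i + j) * \<mu>) = of_int (i * j) * c"
      using \<chi>[of 0 j "i + j"] by (simp add: c_def mult.commute)
    moreover have "N (p + l) (p + of_int j * \<mu> + l) (p + D) = of_int (i * j) * c'"
    proof -
      have "p + D + of_int (- (i + j)) * \<mu> = p + l" "p + D + of_int (- i) * \<mu> = p + of_int j * \<mu> + l"
        by (simp_all add: l_def algebra_simps)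
      moreover have "(- i - - (i + j)) * (0 - - i) = i * j" "p + D + of_int 0 * \<mu> = p + D" by (simp_all add: algebra_simps)
      ultimately show ?thesis using \<chi>'[of "- (i + j)" "- i" 0] by (simp only: c'_def)
    qed
    ultimately have "of_int (i * j) * (a * c - b * c') =
      (of_int i * \<mu> - l) * h j + (of_int j * \<mu> - l) * h i + l * h (i + j)"
      by (simp add: algebra_simps)
    moreover have "a * c - b * c' = X (i + j) * \<mu>"
      using assms(3) by (simp add: X_def l_def a_def b_def c_def c'_def add_diff_eq)
    moreover define d where "d = D / \<mu>"
    moreover have "of_int i * \<mu> - l = (of_int (2 * i + j) - d) * \<mu>" "of_int j * \<mu> - l = (of_int (i + 2 * j) - d) * \<mu>"
      "l = (d - of_int (i + j)) * \<mu>"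
      using assms(3) by (simp_all add: l_def d_def algebra_simps)
    ultimately have "(of_int (i * j) * X (i + j)) * \<mu> = ((of_int (2 * i + j) - d) * h j
      + (of_int (i + 2 * j) - d) * h i + (d - of_int (i + j)) * h (i + j)) * \<mu>"
      by (simp only: distrib_right mult.assoc mult.commute[of \<mu>])
    then show "of_int (i * j) * X (i + j) = (of_int (2 * i + j) - D / \<mu>) * h j
      + (of_int (i + 2 * j) - D / \<mu>) * h i + (D / \<mu> - of_int (i + j)) * h (i + j)"
      unfolding d_def using assms(3) by (simp only: mult_cancel_right) simp
  qed
qed

text \<open>Commute L_(-F) with two operators of degrees F - i \<mu> and i \<mu>. By
  \<open>N_poly\<close> the left side is at most quadratic in i, so (F + i \<mu>)
  \<open>quad p (F - i \<mu>)\<close> is a cubic polynomial in i with known leading coefficient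
  \<mu> \<open>quad p \<mu>\<close>. Using F = E and F = E + \<mu> eliminates the unknown lower
  coefficients.\<close>

lemma quad_parallelogram:
  assumes "p \<in> W" "E \<in> M" "\<mu> \<in> M"
  shows "quad p (E + \<mu>) + quad p (E - \<mu>) = 2 * quad p E + 2 * quad p \<mu>"
proof (cases "\<exists>k. E = of_int k * \<mu>")
  case True
  then obtain k where k: "E = of_int k * \<mu>" by blast
  have "quad p (of_int j * \<mu>) = of_int j ^ 2 * quad p \<mu>" for j
    using quad_line[OF assms(1,3), of 0 j] by simp
  from this[of k] this[of "k + 1"] this[of "k - 1"] show ?thesis
    by (simp add: k algebra_simps power2_eq_square)
next
  case False
  then have E: "\<And>k. E \<noteq> of_int k * \<mu>" by blast
  show ?thesis
  proof (cases "\<mu> = 0")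
    case True then show ?thesis using assms quad_zero by simp
  next
    case \<mu>: False
    have cubic: "\<exists>\<alpha> \<gamma>. \<forall>i. (of_int i * \<mu> + F) * quad p (F - of_int i * \<mu>) =
        of_int i ^ 3 * \<mu> * quad p \<mu> + \<gamma> * of_int i ^ 2 + \<alpha> * of_int i + F * quad p F"
      if F: "F \<in> M" "\<And>k. F \<noteq> of_int k * \<mu>" for F
    proof -
      obtain \<alpha> \<gamma> where 1: "\<And>i. N p (p + of_int i * \<mu>) (p + F) = \<alpha> * of_int i + \<gamma> * of_int i ^ 2"
        using N_poly[OF assms(1,3) \<mu> F] by blast
      obtain \<alpha>' \<gamma>' where 2: "\<And>i. N (p - F) (p - F + of_int i * \<mu>) (p - F + F) = \<alpha>' * of_int i + \<gamma>' * of_int i ^ 2"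
        using N_poly[OF W_minus[OF assms(1) F(1)] assms(3) \<mu> F] by blast
      have "(of_int i * \<mu> + F) * quad p (F - of_int i * \<mu>) =
         of_int i ^ 3 * \<mu> * quad p \<mu> + (f (p + F) p * \<gamma> - f p (p - F) * \<gamma>' - 2 * F * quad p \<mu>) * of_int i ^ 2
         + (f (p + F) p * \<alpha> - f p (p - F) * \<alpha>') * of_int i + F * quad p F" for i
      proof -
        have "f (p + F) p * N p (p + of_int i * \<mu>) (p + F) - f p (p + - F) * N (p + - F) (p + of_int i * \<mu> + - F) p =
          (F - of_int i * \<mu> - - F) * N p (p + of_int i * \<mu>) p + (of_int i * \<mu> - - F) * N p (p + (F - of_int i * \<mu>)) p
            + - F * N p (p + - F) p"
          by (rule N_commutator) (use assms F M_int[OF assms(3), of i] in \<open>auto intro: M_minus M_diff\<close>)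
        moreover have "N p (p + of_int i * \<mu>) p = of_int i ^ 2 * quad p \<mu>"
          using quad_line[OF assms(1,3), of 0 i] by (simp add: quad_def)
        moreover have "N p (p + - F) p = quad p F" "N p (p + (F - of_int i * \<mu>)) p = quad p (F - of_int i * \<mu>)"
          using quad_minus[OF assms(1) F(1)] by (simp_all add: quad_def)
        moreover have "N (p + - F) (p + of_int i * \<mu> + - F) p = \<alpha>' * of_int i + \<gamma>' * of_int i ^ 2"
          using 2[of i] by (simp add: algebra_simps)
        moreover have "p + - F = p - F" by simp
        ultimately show ?thesis using 1[of i] by algebra
      qed
      then show ?thesis by blast
    qed
    have "E + \<mu> \<noteq> of_int k * \<mu>" for k using E[of "k - 1"] by (auto simp: algebra_simps)
    then obtain \<alpha> \<gamma> where 1: "\<And>i. (of_int i * \<mu> + (E + \<mu>)) * quad p (E + \<mu> - of_int i * \<mu>) =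
        of_int i ^ 3 * \<mu> * quad p \<mu> + \<gamma> * of_int i ^ 2 + \<alpha> * of_int i + (E + \<mu>) * quad p (E + \<mu>)"
      using cubic[OF M_add[OF assms(2,3)]] by blast
    obtain \<alpha>' \<gamma>' where 0: "\<And>i. (of_int i * \<mu> + E) * quad p (E - of_int i * \<mu>) =
        of_int i ^ 3 * \<mu> * quad p \<mu> + \<gamma>' * of_int i ^ 2 + \<alpha>' * of_int i + E * quad p E"
      using cubic[OF assms(2) E] by blast
    \<comment> \<open>Third differences over the same four points, seen from \<open>E\<close> and from \<open>E + \<mu>\<close>.\<close>
    let ?w = "\<lambda>s. quad p (E + of_int s * \<mu>)"
    have "(E + \<mu>) * ?w (-1) = \<mu> * quad p \<mu> + \<gamma>' + \<alpha>' + E * ?w 0"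
         "(E - \<mu>) * ?w 1 = - \<mu> * quad p \<mu> + \<gamma>' - \<alpha>' + E * ?w 0"
         "(E - 2 * \<mu>) * ?w 2 = - 8 * \<mu> * quad p \<mu> + 4 * \<gamma>' - 2 * \<alpha>' + E * ?w 0"
      using 0[of 1] 0[of "-1"] 0[of "-2"] by (simp_all add: algebra_simps)
    moreover have
      "(E + 3 * \<mu>) * ?w (-1) = 8 * \<mu> * quad p \<mu> + 4 * \<gamma> + 2 * \<alpha> + (E + \<mu>) * ?w 1"
      "(E + 2 * \<mu>) * ?w 0 = \<mu> * quad p \<mu> + \<gamma> + \<alpha> + (E + \<mu>) * ?w 1"
      "E * ?w 2 = - \<mu> * quad p \<mu> + \<gamma> - \<alpha> + (E + \<mu>) * ?w 1"
      using 1[of 2] 1[of 1] 1[of "-1"] by (simp_all add: algebra_simps)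
    ultimately have "6 * \<mu>^2 * (?w (-1) + ?w 1) = 6 * \<mu>^2 * (2 * ?w 0 + 2 * quad p \<mu>)"
      by algebra
    then have "?w (-1) + ?w 1 = 2 * ?w 0 + 2 * quad p \<mu>" using \<mu> by (simp only: mult_cancel_left) simp
    then show ?thesis by (simp add: add.commute)
  qed
qed

end

lemma constant_second_difference:
  fixes g :: "int \<Rightarrow> 'a::field_char_0"
  assumes "\<And>i. g (i + 2) - 2 * g (i + 1) + g i = 2 * k"
  shows "g i = g 0 + (g 1 - g 0 - k) * of_int i + k * of_int i ^ 2"
proof -
  have "g i = g 0 + (g 1 - g 0 - k) * of_int i + k * of_int i ^ 2
     \<and> g (i + 1) = g 0 + (g 1 - g 0 - k) * (of_int i + 1) + k * (of_int i + 1) ^ 2"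
  proof (induction i rule: int_induct[where k = 0])
    case base then show ?case by (simp add: algebra_simps)
  next
    case (step1 i)
    have e: "i + 1 + 1 = i + 2" by simp
    have "g (i + 2) = g 0 + (g 1 - g 0 - k) * (of_int i + 1 + 1) + k * (of_int i + 1 + 1) ^ 2"
      using assms[of i] conjunct1[OF step1(2)] conjunct2[OF step1(2)] by algebra
    then show ?case using step1(2) unfolding e by simp
  next
    case (step2 i)
    have e: "i - 1 + 2 = i + 1" "i - 1 + 1 = i" by simp_all
    have "g (i - 1) = g 0 + (g 1 - g 0 - k) * (of_int i - 1) + k * (of_int i - 1) ^ 2"
      using assms[of "i - 1"] conjunct1[OF step2(2)] conjunct2[OF step2(2)] unfolding e by algebra
    then show ?case using step2(2) unfolding e by simp
  qed
  then show ?thesis by blast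
qed

section \<open>One constant for all lines of the coset\<close>

context witt_graded
begin

text \<open>Invariance of \<open>quad\<close> along lines makes it polynomial in the base point on
  \<open>z + \<int> x + \<int> y\<close>; comparing coefficients in the parallelogram identity for the squares with
  sides \<open>c x\<close>, \<open>c y\<close> kills the dependence on the base point.\<close>

lemma quad_pair:
  assumes z: "z \<in> W" and xy: "x \<in> M" "y \<in> M" "x \<noteq> 0" "y \<noteq> 0" "x \<noteq> y" "x \<noteq> - y"
  shows "2 * x * y * (quad z x + quad z y) = (quad z (x + y) - quad z x - quad z y) * (x\<^sup>2 + y\<^sup>2)"
proof -
  define pt where "pt i j = z + of_int i * x + of_int j * y" for i j
  have pt: "pt i j \<in> W" for i j unfolding pt_def using z xy by (intro closed)
  define A where "A j = quad (pt 0 j) x" for j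
  define C where "C i = quad (pt i 0) y" for i
  define S where "S i j = quad (pt i j) (x + y)" for i j
  have A: "quad (pt i j) x = A j" for i j
    using quad_line[OF pt[of 0 j] xy(1), of i 1] by (simp add: A_def pt_def add_ac)
  have C: "quad (pt i j) y = C i" for i j
    using quad_line[OF pt[of i 0] xy(2), of j 1] by (simp add: C_def pt_def add_ac)
  have S: "S (i + 1) (j + 1) = S i j" for i j
    using quad_line[OF pt[of i j] M_add[OF xy(1,2)], of 1 1] by (simp add: S_def pt_def algebra_simps)
  have d: "quad (pt i j) (x - y) = 2 * A j + 2 * C i - S i j" for i j
    using quad_parallelogram[OF pt[of i j] xy(1,2)] A[of i j] C[of i j] by (simp add: S_def algebra_simps)
  have S': "S (i + 1) (j - 1) = S i j + 2 * (A (j - 1) - A j) + 2 * (C (i + 1) - C i)" for i j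
  proof -
    have "pt (i + 1) (j - 1) = pt i j + of_int 1 * (x - y)" by (simp add: pt_def algebra_simps)
    then have "quad (pt (i + 1) (j - 1)) (x - y) = quad (pt i j) (x - y)"
      using quad_line[OF pt[of i j] M_diff[OF xy(1,2)], of 1 1] by simp
    then show ?thesis unfolding d by algebra
  qed
  \<comment> \<open>Separation of variables: the left side depends on i only and the right side on j
    only, so both second differences are one constant.\<close>
  have AC: "C (i + 2) - 2 * C (i + 1) + C i = A (j + 2) - 2 * A (j + 1) + A j" for i j
  proof -
    have "S (i + 2) (j + 1) = S i (j + 1) + 2 * (A (j + 1) - A (j + 2)) + 2 * (C (i + 2) - C (i + 1))"
      using S'[of "i + 1" "j + 2"] S[of i "j + 1"] by (simp add: algebra_simps)
    moreover have "S (i + 2) (j + 1) = S (i + 1) j" using S[of "i + 1" j] by (simp add: algebra_simps)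
    moreover have "S (i + 1) j = S i (j + 1) + 2 * (A j - A (j + 1)) + 2 * (C (i + 1) - C i)"
      using S'[of i "j + 1"] by simp
    ultimately have "2 * (C (i + 2) - 2 * C (i + 1) + C i) = 2 * (A (j + 2) - 2 * A (j + 1) + A j)"
      by algebra
    then show ?thesis by (simp only: mult_cancel_left) simp
  qed
  define \<kappa> where "\<kappa> = (C 2 - 2 * C 1 + C 0) / 2"
  define a0 a1 c0 c1 where "a0 = A 0" and "a1 = A 1 - A 0 - \<kappa>" and "c0 = C 0" and "c1 = C 1 - C 0 - \<kappa>"
  note ac = this
  have Aj: "A j = a0 + a1 * of_int j + \<kappa> * of_int j ^ 2" for j
    unfolding ac by (rule constant_second_difference) (use AC[of 0] in \<open>simp add: \<kappa>_def\<close>)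
  have Ci: "C i = c0 + c1 * of_int i + \<kappa> * of_int i ^ 2" for i
    unfolding ac by (rule constant_second_difference) (use AC[of _ 0] AC[of 0 0] in \<open>simp add: \<kappa>_def\<close>)
  define s0 where "s0 = S 0 0"
  \<comment> \<open>The moves (1,1) and (1,-1) preserve the parity of i + j, so from (0,0) only even
    multiples of x are reached; this is why c = 2n below.\<close>
  have Sn: "S (2 * int n) 0 = s0 + 2 * of_nat n * (c1 - a1) + 4 * \<kappa> * of_nat n ^ 2" for n
  proof (induction n)
    case 0 then show ?case by (simp add: s0_def)
  next
    case (Suc n)
    have "S (2 * int (Suc n)) 0 = S (2 * int n) 0 + 2 * (A 0 - A 1) + 2 * (C (2 * int n + 2) - C (2 * int n + 1))"
      using S[of "2 * int n" 0] S'[of "2 * int n + 1" 1] by (simp add: algebra_simps)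
    then show ?case unfolding Aj Ci Suc by (simp add: algebra_simps power2_eq_square)
  qed
  have eq: "((2 * a0 + 2 * c0 - s0) + c * (c1 + a1) + \<kappa> * c\<^sup>2) * (x + y)\<^sup>2 - s0 * (x - y)\<^sup>2 =
     (2 * z + c * (x + y)) * (y * c1 + x * a1 + \<kappa> * (x + y) * c) + c\<^sup>2 * (a1 + \<kappa> * c) * (c1 + \<kappa> * c)"
    if n: "n > 0" "c = 2 * of_nat n" for n c
  proof -
    define K where "K = 2 * int n"
    have K: "of_int K = c" using n by (simp add: K_def)
    have c: "c \<noteq> 0" using n by simp
    define p r s where "p = z + c * x" and "r = z + c * y" and "s = p + r - z"
    note prs = this
    have pts: "p = pt K 0" "r = pt 0 K" "s = pt K K" "z = pt 0 0"
      by (simp_all add: prs pt_def K algebra_simps)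
    have W: "p \<in> W" "r \<in> W" "s \<in> W" by (simp_all only: pts pt)
    have q: "P u v = u * v + quad u (v - u)" if "u \<in> W" for u v using quad_eq[OF that, of "v - u"] by simp
    have k: "quad (pt i j) (c * v) = c\<^sup>2 * quad (pt i j) v" if "v \<in> M" for i j v
      using quad_line[OF pt[of i j] that, of 0 K] K by simp
    have "quad (pt K 0) (r - p) = c\<^sup>2 * quad (pt K 0) (x - y)"
    proof -
      have "r - p = c * (- (x - y))" by (simp add: prs algebra_simps)
      then show ?thesis using k[OF M_minus[OF M_diff[OF xy(1,2)]]] quad_minus[OF pt M_diff[OF xy(1,2)]] by (simp only:)
    qed
    then have pr: "P p r = p * r + c\<^sup>2 * (2 * a0 + 2 * c0 - s0 + c * (c1 + a1) + \<kappa> * c\<^sup>2)"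
    proof -
      have "S K 0 = s0 + c * (c1 - a1) + \<kappa> * c\<^sup>2" using Sn[of n] by (simp add: n K_def power2_eq_square)
      moreover have "A 0 = a0" "C K = c0 + c1 * c + \<kappa> * c\<^sup>2" using Aj[of 0] Ci[of K] K by simp_all
      ultimately have "quad (pt K 0) (x - y) = 2 * a0 + 2 * c0 - s0 + c * (c1 + a1) + \<kappa> * c\<^sup>2"
        using d[of K 0] by algebra
      then show ?thesis
        using q[OF W(1), of r] \<open>quad (pt K 0) (r - p) = c\<^sup>2 * quad (pt K 0) (x - y)\<close> pts(1) by simp
    qed
    have qs: "P z s = z * s + c\<^sup>2 * s0"
    proof -
      have "s - z = c * (x + y)" by (simp add: prs algebra_simps)
      then have "quad z (s - z) = c\<^sup>2 * s0" using k[OF M_add[OF xy(1,2)], of 0 0] pts(4) by (simp add: s0_def S_def)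
      then show ?thesis using q[OF z] by simp
    qed
    have ps: "P p s = p * s + c\<^sup>2 * (c0 + c1 * c + \<kappa> * c\<^sup>2)"
    proof -
      have "s - p = c * y" by (simp add: prs algebra_simps)
      then have "quad p (s - p) = c\<^sup>2 * C K" using k[OF xy(2), of K 0] C[of K 0] pts(1) by simp
      then show ?thesis using q[OF W(1)] Ci[of K] K by simp
    qed
    have qr: "P z r = z * r + c\<^sup>2 * c0"
    proof -
      have "r - z = c * y" by (simp add: prs algebra_simps)
      then have "quad z (r - z) = c\<^sup>2 * C 0" using k[OF xy(2), of 0 0] C[of 0 0] pts(4) by simp
      then show ?thesis using q[OF z] Ci[of 0] by simp
    qed
    have sr: "P s r = s * r + c\<^sup>2 * (a0 + a1 * c + \<kappa> * c\<^sup>2)"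
    proof -
      have "s - r = c * x" by (simp add: prs algebra_simps)
      then have "quad r (s - r) = c\<^sup>2 * A K" using k[OF xy(1), of 0 K] A[of 0 K] pts(2) by simp
      then show ?thesis using q[OF W(2), of s] P_sym[of s r] Aj[of K] K by (simp add: mult.commute)
    qed
    have pq: "P p z = p * z + c\<^sup>2 * a0"
    proof -
      have "p - z = c * x" by (simp add: prs algebra_simps)
      then have "quad z (p - z) = c\<^sup>2 * A 0" using k[OF xy(1), of 0 0] A[of 0 0] pts(4) by simp
      then show ?thesis using q[OF z, of p] P_sym[of p z] Aj[of 0] by (simp add: mult.commute)
    qed
    have "P p r * (s - z)\<^sup>2 - P z s * (r - p)\<^sup>2 = (P p s - P z r) * (P s r - P p z)"
      using P_parallelogram[OF W(1) z W(2), of s] by (simp add: prs)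
    moreover have "(p * r + c\<^sup>2 * T) * (s - z)\<^sup>2 - (z * s + c\<^sup>2 * s0) * (r - p)\<^sup>2
        - (p * s + c\<^sup>2 * (c0 + U) - (z * r + c\<^sup>2 * c0)) * (s * r + c\<^sup>2 * (a0 + V) - (p * z + c\<^sup>2 * a0)) =
        c^4 * (T * (x + y)\<^sup>2 - s0 * (x - y)\<^sup>2) - c^3 * (2 * z + c * (x + y)) * (y * U + x * V) - c^4 * U * V"
      for T U V unfolding prs by algebra
    from this[of "2 * a0 + 2 * c0 - s0 + c * (c1 + a1) + \<kappa> * c\<^sup>2" "c1 * c + \<kappa> * c\<^sup>2" "a1 * c + \<kappa> * c\<^sup>2"]
    have "(p * r + c\<^sup>2 * (2 * a0 + 2 * c0 - s0 + c * (c1 + a1) + \<kappa> * c\<^sup>2)) * (s - z)\<^sup>2 - (z * s + c\<^sup>2 * s0) * (r - p)\<^sup>2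
        - (p * s + c\<^sup>2 * (c0 + c1 * c + \<kappa> * c\<^sup>2) - (z * r + c\<^sup>2 * c0)) * (s * r + c\<^sup>2 * (a0 + a1 * c + \<kappa> * c\<^sup>2) - (p * z + c\<^sup>2 * a0)) =
        c^4 * ((2 * a0 + 2 * c0 - s0 + c * (c1 + a1) + \<kappa> * c\<^sup>2) * (x + y)\<^sup>2 - s0 * (x - y)\<^sup>2)
        - c^3 * (2 * z + c * (x + y)) * (y * (c1 * c + \<kappa> * c\<^sup>2) + x * (a1 * c + \<kappa> * c\<^sup>2)) - c^4 * (c1 * c + \<kappa> * c\<^sup>2) * (a1 * c + \<kappa> * c\<^sup>2)"
      by (simp only: add.assoc)
    ultimately have "0 = c^4 * ((2 * a0 + 2 * c0 - s0 + c * (c1 + a1) + \<kappa> * c\<^sup>2) * (x + y)\<^sup>2 - s0 * (x - y)\<^sup>2)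
        - c^3 * (2 * z + c * (x + y)) * (y * (c1 * c + \<kappa> * c\<^sup>2) + x * (a1 * c + \<kappa> * c\<^sup>2)) - c^4 * (c1 * c + \<kappa> * c\<^sup>2) * (a1 * c + \<kappa> * c\<^sup>2)"
      unfolding pr qs ps qr sr pq by simp
    then have "c^4 * (((2 * a0 + 2 * c0 - s0) + c * (c1 + a1) + \<kappa> * c\<^sup>2) * (x + y)\<^sup>2 - s0 * (x - y)\<^sup>2) =
     c^4 * ((2 * z + c * (x + y)) * (y * c1 + x * a1 + \<kappa> * (x + y) * c) + c\<^sup>2 * (a1 + \<kappa> * c) * (c1 + \<kappa> * c))"
      by (simp add: algebra_simps power2_eq_square power3_eq_cube power4_eq_xxxx)
    then show ?thesis using c by (simp only: mult_cancel_left) simp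
  qed
  define E4 E3 E2 E1 E0 where "E4 = - \<kappa>\<^sup>2" and "E3 = - \<kappa> * (a1 + c1)"
    and "E2 = \<kappa> * (x + y)\<^sup>2 - (x + y) * \<kappa> * (x + y) - a1 * c1"
    and "E1 = (c1 + a1) * (x + y)\<^sup>2 - (x + y) * (y * c1 + x * a1) - 2 * z * \<kappa> * (x + y)"
    and "E0 = (2 * a0 + 2 * c0 - s0) * (x + y)\<^sup>2 - s0 * (x - y)\<^sup>2 - 2 * z * (y * c1 + x * a1)"
  note E = this
  have pol: "E4 * c^4 + E3 * c^3 + E2 * c^2 + E1 * c + E0 = 0" if "n > 0" "c = 2 * of_nat n" for n c
  proof -
    have "E4 * c^4 + E3 * c^3 + E2 * c^2 + E1 * c + E0 =
      ((2 * a0 + 2 * c0 - s0) + c * (c1 + a1) + \<kappa> * c\<^sup>2) * (x + y)\<^sup>2 - s0 * (x - y)\<^sup>2 -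
      ((2 * z + c * (x + y)) * (y * c1 + x * a1 + \<kappa> * (x + y) * c) + c\<^sup>2 * (a1 + \<kappa> * c) * (c1 + \<kappa> * c))"
      unfolding E by (simp add: algebra_simps power2_eq_square power3_eq_cube power4_eq_xxxx)
    also have "\<dots> = 0" using eq[OF that] by simp
    finally show ?thesis .
  qed
  from pol[of 1 2] pol[of 2 4] pol[of 3 6] pol[of 4 8] pol[of 5 10]
  have "16 * E4 + 8 * E3 + 4 * E2 + 2 * E1 + E0 = 0" "256 * E4 + 64 * E3 + 16 * E2 + 4 * E1 + E0 = 0"
    "1296 * E4 + 216 * E3 + 36 * E2 + 6 * E1 + E0 = 0" "4096 * E4 + 512 * E3 + 64 * E2 + 8 * E1 + E0 = 0"
    "10000 * E4 + 1000 * E3 + 100 * E2 + 10 * E1 + E0 = 0"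
    by (simp_all add: mult.commute)
  note five = this
  \<comment> \<open>A polynomial of degree 4 with the five zeros 2, 4, 6, 8, 10 is zero; 384 = 4! *
    2^4 is the fourth difference of c^4 with step 2.\<close>
  have "384 * E4 = 0" using five by algebra
  moreover have "384 * E2 = 0" using five by algebra
  moreover have "384 * E1 = 0" using five by algebra
  moreover have "384 * E0 = 0" using five by algebra
  ultimately
  have E0: "E4 = 0" "E2 = 0" "E1 = 0" "E0 = 0" by simp_all
  have \<kappa>: "\<kappa> = 0" using E0(1) by (simp add: E)
  have "x + y \<noteq> 0" using xy by (simp add: eq_neg_iff_add_eq_0)
  moreover have "(x + y) * (y * a1 + x * c1) = 0"
    using E0(3) unfolding E \<kappa> by (simp add: algebra_simps power2_eq_square)
  ultimately have "y * a1 + x * c1 = 0" by simp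
  moreover have "a1 * c1 = 0" using E0(2) \<kappa> by (simp add: E)
  ultimately have "a1 = 0" "c1 = 0" using xy by auto
  then have "(2 * a0 + 2 * c0 - s0) * (x + y)\<^sup>2 = s0 * (x - y)\<^sup>2" using E0(4) by (simp add: E)
  moreover have "a0 = quad z x" "c0 = quad z y" "s0 = quad z (x + y)" by (simp_all add: a0_def c0_def s0_def A_def C_def S_def pt_def)
  ultimately have "2 * (2 * x * y * (quad z x + quad z y)) = 2 * ((quad z (x + y) - quad z x - quad z y) * (x\<^sup>2 + y\<^sup>2))"
    by algebra
  then show ?thesis by (simp only: mult_cancel_left) simp
qed

lemma quad_int: "p \<in> W \<Longrightarrow> x \<in> M \<Longrightarrow> quad p (of_int k * x) = of_int k ^ 2 * quad p x"
  using quad_line[of p x 0 k] by simp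

text \<open>Eliminate the values at x + y and x + 2y from \<open>quad_pair\<close> for (x, y) and
  (x, 2y) and the parallelogram law. Where \<open>quad_pair\<close> does not apply, y = 0 or x is
  one of 0, y, -y, 2y, -2y, and \<open>quad_int\<close> suffices.\<close>

lemma quad_proportional:
  assumes z: "z \<in> W" and xy: "x \<in> M" "y \<in> M"
  shows "quad z x * y\<^sup>2 = quad z y * x\<^sup>2"
proof (cases "x = 0 \<or> y = 0 \<or> x = y \<or> x = - y \<or> x = 2 * y \<or> x = - 2 * y")
  case True
  then show ?thesis
    using quad_zero[OF z] quad_int[OF z xy(2), of "-1"] quad_int[OF z xy(2), of "2"] quad_int[OF z xy(2), of "-2"]
    by (auto simp: power_mult_distrib)
next
  case False
  have q2: "quad z (2 * y) = 4 * quad z y" using quad_int[OF z xy(2), of 2] by simp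
  have "quad z (x + y + y) + quad z x = 2 * quad z (x + y) + 2 * quad z y"
    using quad_parallelogram[OF z M_add[OF xy] xy(2)] by simp
  moreover have "x + y + y = x + 2 * y" by simp
  ultimately have "quad z (x + 2 * y) + quad z x = 2 * quad z (x + y) + 2 * quad z y" by simp
  moreover have "2 * x * (2 * y) * (quad z x + 4 * quad z y) = (quad z (x + 2 * y) - quad z x - 4 * quad z y) * (x\<^sup>2 + (2 * y)\<^sup>2)"
    using quad_pair[OF z xy(1) M_int[OF xy(2), of 2]] False q2 by simp
  moreover have "2 * x * y * (quad z x + quad z y) = (quad z (x + y) - quad z x - quad z y) * (x\<^sup>2 + y\<^sup>2)"
    using quad_pair[OF z xy] False by simp
  ultimately have "12 * (x * y) * (quad z x * y\<^sup>2) = 12 * (x * y) * (quad z y * x\<^sup>2)" by algebra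
  then show ?thesis using False by simp
qed

text \<open>The ratio \<open>quad p y\<close> to y^2 is independent of y by
  \<open>quad_proportional\<close>. It is independent of p because \<open>quad_line\<close> carries
  the value in direction p - z from z to p.\<close>

lemma P_constant: "\<exists>\<beta>. \<forall>p\<in>W. \<forall>q\<in>W. P p q = p * q + \<beta> * (p - q)\<^sup>2"
proof (cases "\<exists>z\<in>W. \<exists>x\<in>M. x \<noteq> 0")
  case True
  then obtain z x where z: "z \<in> W" and x: "x \<in> M" "x \<noteq> 0" by blast
  define \<beta> where "\<beta> = quad z x / x\<^sup>2"
  have ob: "quad z y = \<beta> * y\<^sup>2" if "y \<in> M" for y
    using quad_proportional[OF z x(1) that] x(2) by (simp add: \<beta>_def field_simps)
  have "P p q = p * q + \<beta> * (p - q)\<^sup>2" if "p \<in> W" "q \<in> W" for p q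
  proof -
    have qp: "q - p \<in> M" and po: "p - z \<in> M" using that z W_diff by auto
    have "quad p (q - p) = \<beta> * (q - p)\<^sup>2"
    proof (cases "p = z")
      case True then show ?thesis using ob[OF qp] by simp
    next
      case False
      have "quad p (p - z) = quad z (p - z)"
        using quad_line[OF z po, of 1 1] by simp
      moreover have "quad p (q - p) * (p - z)\<^sup>2 = quad p (p - z) * (q - p)\<^sup>2"
        by (rule quad_proportional[OF that(1) qp po])
      ultimately show ?thesis using False ob[OF po] by simp
    qed
    then show ?thesis using quad_eq[OF that(1), of "q - p"] by (simp add: power2_commute algebra_simps)
  qed
  then show ?thesis by blast
next
  case False
  then have "p = q" if "p \<in> W" "q \<in> W" for p q using W_diff[OF that] that by force
  then have "P p q = p * q + 0 * (p - q)\<^sup>2" if "p \<in> W" "q \<in> W" for p q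
    using that diag[of p] by (metis P_def mult_zero_left add_0_right)
  then show ?thesis by blast
qed

end

section \<open>Change of basis\<close>

locale witt_graded_gauge = witt_graded_const +
  assumes M_nontrivial: "\<exists>x\<in>M. x \<noteq> 0"
begin

lemma avoid: "p \<in> W \<Longrightarrow> finite X \<Longrightarrow> \<exists>q\<in>W. q \<notin> X"
proof -
  assume p: "p \<in> W" and X: "finite X"
  obtain x where x: "x \<in> M" "x \<noteq> 0" using M_nontrivial by blast
  have "inj (\<lambda>k::int. p + of_int k * x)" using x by (auto simp: inj_on_def)
  then have "infinite (range (\<lambda>k::int. p + of_int k * x))" using finite_imageD infinite_UNIV_int by blast
  moreover have "range (\<lambda>k::int. p + of_int k * x) \<subseteq> W" using p x by (auto intro!: closed)
  ultimately have "\<not> W \<subseteq> X" using X by (meson finite_subset subset_trans)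
  then show ?thesis by blast
qed

definition \<chi> where "\<chi> = (SOME \<chi>. \<forall>p\<in>W. \<forall>q\<in>W. \<forall>r\<in>W. N p q r = (q - p) * (r - q) * \<chi> p r)"

lemma f_f: "p \<in> W \<Longrightarrow> q \<in> W \<Longrightarrow> r \<in> W \<Longrightarrow> f p q * f q r = q * f p r + (q - p) * (r - q) * \<chi> p r"
proof -
  assume "p \<in> W" "q \<in> W" "r \<in> W"
  then have "N p q r = (q - p) * (r - q) * \<chi> p r"
    using someI_ex[OF N_factor] unfolding \<chi>_def[symmetric] by blast
  then show ?thesis unfolding N_def by algebra
qed

lemma \<chi>_refl: assumes "p \<in> W" shows "\<chi> p p = - \<beta>"
proof -
  obtain q where q: "q \<in> W" "q \<noteq> p" using avoid[OF assms, of "{p}"] by auto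
  have "(q - p) * (q - p) * \<chi> p p = (q - p) * (q - p) * (- \<beta>)"
    using f_f[OF assms q(1) assms] P_const[OF assms q(1)] diag[OF assms] unfolding P_def by simp algebra
  then show ?thesis using q by (simp only: mult_cancel_left) simp
qed

definition slope where "slope p r = (\<chi> p r * f r p + \<beta> * r) / (r - p)"

lemma \<chi>_f: "p \<noteq> r \<Longrightarrow> \<chi> p r * f r p = - \<beta> * r + (r - p) * slope p r"
  by (simp add: slope_def)

text \<open>Evaluate the cyclic product \<open>f p q * f q r * f r p\<close> by contracting it with
  \<open>f_f\<close> at q and at r.\<close>

lemma slope_next:
  assumes "p \<in> W" "q \<in> W" "r \<in> W" "p \<noteq> q" "q \<noteq> r" "p \<noteq> r"
  shows "slope q p = slope p r"
proof -
  have "f p q * f q r * f r p = q * (f p r * f r p) + (q - p) * (r - q) * (\<chi> p r * f r p)"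
    using f_f[OF assms(1-3)] by algebra
  moreover have "f p q * f q r * f r p = r * (f q p * f p q) + (r - q) * (p - r) * (\<chi> q p * f p q)"
    using f_f[OF assms(2,3,1)] by algebra
  moreover have "f p r * f r p = p * r + \<beta> * (p - r)\<^sup>2" "f q p * f p q = q * p + \<beta> * (q - p)\<^sup>2"
    using P_const assms unfolding P_def by auto
  moreover note \<chi>_f[OF assms(6)] \<chi>_f[OF assms(4)[symmetric]]
  ultimately have "(r - q) * (p - r) * (p - q) * slope q p = (r - q) * (p - r) * (p - q) * slope p r"
    by algebra
  then show ?thesis using assms by simp
qed

text \<open>Each use of \<open>slope_next\<close> needs three distinct weights; two auxiliary
  weights provide them even if the given pairs overlap.\<close>

lemma slope_const:
  assumes "a \<in> W" "b \<in> W" "c \<in> W" "d \<in> W" "a \<noteq> b" "c \<noteq> d"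
  shows "slope a b = slope c d"
proof -
  obtain x where x: "x \<in> W" "x \<notin> {a, b, c, d}" using avoid[OF assms(1), of "{a,b,c,d}"] by auto
  obtain y where y: "y \<in> W" "y \<notin> {a, b, c, d, x}" using avoid[OF assms(1), of "{a,b,c,d,x}"] by auto
  have "slope a b = slope b x" by (rule slope_next) (use assms x y in auto)
  also have "\<dots> = slope x y" by (rule slope_next) (use assms x y in auto)
  also have "\<dots> = slope y c" by (rule slope_next) (use assms x y in auto)
  also have "\<dots> = slope c d" by (rule slope_next) (use assms x y in auto)
  finally show ?thesis .
qed

text \<open>Multiply \<open>f_f\<close> for p, q, r by its reverse. All products of arrows become
  values of \<open>P\<close>, and both mixed terms are given by the same slope.\<close>

lemma \<chi>_\<chi>:
  assumes "p \<in> W" "r \<in> W" shows "\<chi> p r * \<chi> r p = \<beta>\<^sup>2"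
proof (cases "p = r")
  case True then show ?thesis using \<chi>_refl assms by (simp add: power2_eq_square)
next
  case False
  obtain q where q: "q \<in> W" "q \<noteq> p" "q \<noteq> r" using avoid[OF assms(1), of "{p,r}"] by auto
  have s: "slope p r = slope r p" using slope_const[OF assms assms(2,1)] False by auto
  have "((q - p) * (r - q))\<^sup>2 * (\<chi> p r * \<chi> r p) = ((q - p) * (r - q))\<^sup>2 * \<beta>\<^sup>2"
    using f_f[OF assms(1) q(1) assms(2)] f_f[OF assms(2) q(1) assms(1)] \<chi>_f[OF False] \<chi>_f[OF False[symmetric]]
      P_const[OF assms] P_const[OF assms(1) q(1)] P_const[OF q(1) assms(2)] s unfolding P_def by algebra
  then show ?thesis using q by simp
qed

text \<open>Compute the product of \<open>\<chi> p r * f r p\<close> and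
  \<open>\<chi> r p * f p r\<close> by \<open>\<chi>_f\<close> and by \<open>\<chi>_\<chi>\<close>.
  For \<beta> = 0 this forces slope 0; otherwise, divided by \<beta>^2, it reads \<beta> = b (1 - b)
  with b = slope / \<beta>.\<close>

lemma slope_equation:
  assumes "p \<in> W" "r \<in> W" "p \<noteq> r"
  shows "\<beta> ^ 3 = \<beta> * slope p r - (slope p r)\<^sup>2"
proof -
  have s: "slope r p = slope p r" using slope_const[OF assms(2,1) assms(1,2)] assms by auto
  have "(p - r)\<^sup>2 * \<beta> ^ 3 = (p - r)\<^sup>2 * (\<beta> * slope p r - (slope p r)\<^sup>2)"
    using \<chi>_f[OF assms(3)] \<chi>_f[OF assms(3)[symmetric]] P_const[OF assms(1,2)] \<chi>_\<chi>[OF assms(1,2)]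
    unfolding s P_def by algebra
  then show ?thesis using assms by simp
qed

lemma gauge_generic:
  assumes "z \<in> W" "\<beta> \<noteq> 0"
  shows "\<exists>b g. (\<forall>p\<in>W. g p \<noteq> 0) \<and> (\<forall>p\<in>W. \<forall>q\<in>W. g p * f p q = ((1 - b) * p + b * q) * g q)"
proof -
  obtain z' where z': "z' \<in> W" "z' \<noteq> z" using avoid[OF assms(1), of "{z}"] by auto
  define b where "b = slope z z' / \<beta>"
  have sl: "slope p r = \<beta> * b" if "p \<in> W" "r \<in> W" "p \<noteq> r" for p r
    using slope_const[OF that(1,2) assms(1) z'(1) that(3)] z'(2) assms(2) by (simp add: b_def)
  have "\<beta>\<^sup>2 * \<beta> = \<beta>\<^sup>2 * (b * (1 - b))"
    using slope_equation[OF assms(1) z'(1)] z'(2) sl[OF assms(1) z'(1)] by simp algebra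
  then have b: "\<beta> = b * (1 - b)" using assms(2) by simp
  have b01: "b \<noteq> 0" "1 - b \<noteq> 0" using b assms(2) by auto
  define F where "F p q = (1 - b) * p + b * q" for p q
  define \<theta> where "\<theta> p q = - \<chi> p q / \<beta>" for p q
  have \<theta>\<chi>: "\<chi> p q = - \<beta> * \<theta> p q" for p q using assms(2) by (simp add: \<theta>_def)
  have \<theta>\<theta>: "\<theta> p q * \<theta> q p = 1" if "p \<in> W" "q \<in> W" for p q
    using \<chi>_\<chi>[OF that] assms(2) by (simp add: \<theta>_def field_simps power2_eq_square)
  have \<chi>f: "\<theta> p r * f r p = F r p" if "p \<in> W" "r \<in> W" for p r
  proof (cases "p = r")
    case True then show ?thesis using that \<chi>_refl diag assms(2) by (simp add: \<theta>_def F_def algebra_simps)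
  next
    case False
    have "\<beta> * (\<theta> p r * f r p) = \<beta> * F r p"
      using \<chi>_f[OF False] sl[OF that False] unfolding F_def \<theta>\<chi> by algebra
    then show ?thesis using assms(2) by simp
  qed
  have f: "f p q = F p q * \<theta> p q" if "p \<in> W" "q \<in> W" for p q
  proof -
    have "f p q = (\<theta> p q * \<theta> q p) * f p q" using \<theta>\<theta>[OF that] by simp
    also have "\<dots> = \<theta> p q * (\<theta> q p * f p q)" by (simp only: mult.assoc)
    finally show ?thesis unfolding \<chi>f[OF that(2,1)] by (simp only: mult.commute)
  qed
  have cocycle: "\<theta> p q * \<theta> q r = \<theta> p r" if "p \<in> W" "q \<in> W" "r \<in> W" "F p q \<noteq> 0" "F q r \<noteq> 0" for p q r
  proof -
    have "F p q * F q r * (\<theta> p q * \<theta> q r) = F p q * F q r * \<theta> p r"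
      using f_f[OF that(1-3)] f[OF that(1,2)] f[OF that(2,3)] f[OF that(1,3)] b
      unfolding \<theta>\<chi> unfolding F_def by algebra
    then show ?thesis using that by simp
  qed
  have cocycle: "\<theta> p q * \<theta> q r = \<theta> p r" if W: "p \<in> W" "q \<in> W" "r \<in> W" for p q r
  proof -
    \<comment> \<open>\<open>?X\<close> contains all zeros s of \<open>F s x\<close> and
      \<open>F x s\<close> for x among p, q, r. Any other s satisfies the restricted cocycle law
      with each of them, and passing through s removes the restriction.\<close>
    let ?X = "(\<lambda>x. - b * x / (1 - b)) ` {p,q,r} \<union> (\<lambda>x. - (1 - b) * x / b) ` {p,q,r}"
    obtain s where s: "s \<in> W" "s \<notin> ?X" using avoid[OF W(1), of ?X] by auto
    have "F s x \<noteq> 0 \<and> F x s \<noteq> 0" if "x \<in> {p,q,r}" for x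
    proof -
      have "s \<noteq> - b * x / (1 - b)" "s \<noteq> - (1 - b) * x / b" using s(2) that by blast+
      then have "s * (1 - b) \<noteq> - b * x" "s * b \<noteq> - (1 - b) * x" 
        using nonzero_eq_divide_eq[OF b01(2)] nonzero_eq_divide_eq[OF b01(1)] by blast+
      then show ?thesis unfolding F_def by (metis add.commute eq_neg_iff_add_eq_0 mult.commute mult_minus_left)
    qed
    then have "\<theta> x s * \<theta> s y = \<theta> x y" if "x \<in> {p,q,r}" "y \<in> {p,q,r}" for x y
      using that W s(1) by (intro cocycle) auto
    then have "\<theta> p q * \<theta> q r = (\<theta> p s * \<theta> s q) * (\<theta> q s * \<theta> s r)" "\<theta> p s * \<theta> s r = \<theta> p r" by simp_all
    moreover have "(\<theta> p s * \<theta> s q) * (\<theta> q s * \<theta> s r) = (\<theta> s q * \<theta> q s) * (\<theta> p s * \<theta> s r)" by (simp only: ac_simps)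
    ultimately show ?thesis using \<theta>\<theta>[OF s(1) W(2)] by simp
  qed
  have "\<theta> z p * f p q = ((1 - b) * p + b * q) * \<theta> z q" if "p \<in> W" "q \<in> W" for p q
    using f[OF that] cocycle[OF assms(1) that] unfolding F_def by algebra
  moreover have "\<theta> z p \<noteq> 0" if "p \<in> W" for p using \<theta>\<theta>[OF assms(1) that] by auto
  ultimately show ?thesis by blast
qed

text \<open>Slope 0 gives \<open>\<chi> p r * f r p = 0\<close>, and away from weight 0 the arrow is
  nonzero because \<open>P p r\<close> is p r. So \<chi> vanishes there for p \<noteq> r and f p q /
  q is multiplicative along paths.\<close>

lemma gauge_special:
  assumes "z \<in> W" "\<beta> = 0"
  shows "\<exists>g. (\<forall>p. g p \<noteq> 0) \<and> (\<forall>p\<in>W - {0}. \<forall>q\<in>W - {0}. g p * f p q = q * g q)"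
proof -
  obtain z where z: "z \<in> W" "z \<noteq> 0" using avoid[OF assms(1), of "{0}"] by auto
  have nz: "f p q \<noteq> 0" if "p \<in> W - {0}" "q \<in> W - {0}" for p q
    using P_const[of p q] that assms(2) by (auto simp: P_def)
  have ff: "f p q * f q r = q * f p r" if "p \<in> W - {0}" "q \<in> W" "r \<in> W - {0}" for p q r
  proof (cases "p = r")
    case True then show ?thesis using P_const[of p q] that assms(2) diag by (auto simp: P_def)
  next
    case False
    have "slope p r = 0" using slope_equation[of p r] that False assms(2) by auto
    then have "\<chi> p r * f r p = 0" using \<chi>_f[OF False] assms(2) by simp
    then have "\<chi> p r = 0" using nz that by auto
    then show ?thesis using f_f that by auto
  qed
  define g where "g q = (if q \<in> W - {0} then f z q / q else 1)" for q
  have "g p \<noteq> 0" for p using nz z by (auto simp: g_def)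
  moreover have "g p * f p q = q * g q" if "p \<in> W - {0}" "q \<in> W - {0}" for p q
    using ff[of z p q] that z by (simp add: g_def field_simps)
  ultimately show ?thesis by blast
qed

text \<open>\<chi> need not vanish when one of its arguments is 0. \<open>f_f\<close> on the paths
  0, q, z and z, p, 0 shows that, after rescaling, it adds one linear term to each family of arrows
  at 0. Every \<open>f p 0 * f 0 q\<close> is 0, and a nonzero affine function is nonzero somewhere
  off 0, so one family vanishes.\<close>

lemma gauge_zero_weight:
  assumes "0 \<in> W" "\<beta> = 0"
  shows "\<exists>g c0 c1 d0 d1. (\<forall>p. g p \<noteq> 0) \<and> (\<forall>p\<in>W - {0}. \<forall>q\<in>W - {0}. g p * f p q = q * g q) \<and>
    (\<forall>q\<in>W - {0}. f 0 q = q * (c0 + c1 * q) * g q) \<and> (\<forall>p\<in>W - {0}. g p * f p 0 = d0 + d1 * p) \<and>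
    (c0 = 0 \<and> c1 = 0 \<or> d0 = 0 \<and> d1 = 0)"
proof -
  obtain g where g: "\<And>p. g p \<noteq> 0" and gf: "\<And>p q. p \<in> W - {0} \<Longrightarrow> q \<in> W - {0} \<Longrightarrow> g p * f p q = q * g q"
    using gauge_special[OF assms] by blast
  obtain z where z: "z \<in> W" "z \<noteq> 0" using avoid[OF assms(1), of "{0}"] by auto
  define c0 c1 where "c0 = f 0 z / (z * g z) + \<chi> 0 z / g z" and "c1 = - \<chi> 0 z / (z * g z)"
  define d0 d1 where "d0 = g z * f z 0 + z * (g z * \<chi> z 0)" and "d1 = - (g z * \<chi> z 0)"
  have f0: "f 0 q = q * (c0 + c1 * q) * g q" if "q \<in> W - {0}" for q
  proof -
    have "f 0 q * f q z = q * f 0 z + q * (z - q) * \<chi> 0 z" using f_f[of 0 q z] assms z that by simp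
    moreover have "g q * f q z = z * g z" using gf that z by simp
    ultimately have "f 0 q * (z * g z) = g q * (q * f 0 z + q * (z - q) * \<chi> 0 z)" by algebra
    then have "f 0 q = q * ((f 0 z + (z - q) * \<chi> 0 z) / (z * g z)) * g q"
      using z g[of z] by (simp add: field_simps)
    moreover have "(f 0 z + (z - q) * \<chi> 0 z) / (z * g z) = c0 + c1 * q"
      using z g[of z] by (simp add: c0_def c1_def field_simps)
    ultimately show ?thesis by simp
  qed
  have f0': "g p * f p 0 = d0 + d1 * p" if "p \<in> W - {0}" for p
  proof -
    have "f z p * f p 0 = p * f z 0 + (p - z) * (0 - p) * \<chi> z 0" using f_f[of z p 0] assms z that by simp
    moreover have "g z * f z p = p * g p" using gf that z by simp
    ultimately have "p * (g p * f p 0) = p * (d0 + d1 * p)" unfolding d0_def d1_def by algebra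
    then show ?thesis using that by simp
  qed
  have "c0 = 0 \<and> c1 = 0 \<or> d0 = 0 \<and> d1 = 0"
  proof -
    have lin: "\<exists>q\<in>W - {0}. u + v * q \<noteq> 0" if "u \<noteq> 0 \<or> v \<noteq> 0" for u v
    proof -
      obtain q where q: "q \<in> W" "q \<notin> {0, - u / v}" using avoid[OF assms(1), of "{0, - u / v}"] by auto
      have "u + v * q \<noteq> 0"
      proof
        assume *: "u + v * q = 0"
        then have "v \<noteq> 0" using that by auto
        then show False using * q by (simp add: field_simps eq_neg_iff_add_eq_0)
      qed
      then show ?thesis using q by auto
    qed
    show ?thesis
    proof (rule ccontr)
      assume "\<not> ?thesis"
      then obtain p q where pq: "p \<in> W - {0}" "q \<in> W - {0}" "d0 + d1 * p \<noteq> 0" "c0 + c1 * q \<noteq> 0"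
        using lin[of c0 c1] lin[of d0 d1] by blast
      have "f p 0 * f 0 q = 0"
      proof (cases "p = q")
        case True then show ?thesis using P_const[of p 0] pq assms by (simp add: P_def)
      next
        case False
        have "slope p q = 0" using slope_equation[of p q] pq False assms(2) by auto
        then have "\<chi> p q * f q p = 0" using \<chi>_f[OF False] assms(2) by simp
        moreover have "f q p \<noteq> 0" using P_const[of p q] pq assms by (auto simp: P_def)
        ultimately show ?thesis using f_f[of p 0 q] pq assms(1) by auto
      qed
      moreover have "f 0 q \<noteq> 0" "f p 0 \<noteq> 0" using f0[OF pq(2)] f0'[OF pq(1)] pq g by auto
      ultimately show False by simp
    qed
  qed
  then show ?thesis using g gf f0 f0' by blast
qed

end

section \<open>Coefficients of an intermediate series module\<close>

context vector_space begin

lemma linear_ext_sum: "finite A \<Longrightarrow> linear_ext scale f (\<Sum>i\<in>A. g i) = (\<Sum>i\<in>A. linear_ext scale f (g i))"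
  by (induction A rule: finite_induct) (simp_all add: linear_ext_add)

end

abbreviation "vir_L \<mu> \<equiv> (bvec (Vir_L \<mu>) :: 'a::field_char_0 vir_gen \<Rightarrow>\<^sub>0 'a)"
abbreviation "vir_c \<equiv> (bvec Vir_c :: 'a::field_char_0 vir_gen \<Rightarrow>\<^sub>0 'a)"

lemma vir_L_in: "\<mu> \<in> M \<Longrightarrow> vir_L \<mu> \<in> vir M" and vir_c_in: "vir_c \<in> vir M"
  by (auto simp: vir_def free_space_def)

lemma br_L_L: "vir_br (vir_L \<mu>) (vir_L \<nu>) = pm_scale (\<nu> - \<mu>) (vir_L (\<mu> + \<nu>)) +
    pm_scale (if \<mu> + \<nu> = 0 then (\<mu> ^ 3 - \<mu>) / 12 else 0) vir_c"
  by (simp add: vir_br_simps(7))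

lemma br_c_L: "vir_br vir_c (vir_L \<nu>) = 0"
  by (simp add: vir_br_simps(7))

locale intermediate_module =
  fixes M :: "'a::field_char_0 set"
    and scale :: "'a \<Rightarrow> 'v::ab_group_add \<Rightarrow> 'v"
    and act :: "('a vir_gen \<Rightarrow>\<^sub>0 'a) \<Rightarrow> 'v \<Rightarrow> 'v"
    and V :: "'v set"
  assumes M_zero: "0 \<in> M"
    and M_add: "\<And>\<mu> \<nu>. \<mu> \<in> M \<Longrightarrow> \<nu> \<in> M \<Longrightarrow> \<mu> + \<nu> \<in> M"
    and M_minus: "\<And>\<mu>. \<mu> \<in> M \<Longrightarrow> - \<mu> \<in> M"
    and M_nontrivial: "M \<noteq> {0}"
    and intermediate: "intermediate_series M scale act V"
begin

lemma lie_module: "lie_module pm_scale (vir M) vir_br scale V act"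
  using intermediate by (simp add: intermediate_series_def harish_chandra_def)

sublocale A: lie_module pm_scale "vir M" vir_br scale V act
  by (rule lie_module)

lemmas L_in = vir_L_in[of _ M] and c_in = vir_c_in[of M]

lemma M_diff: "x \<in> M \<Longrightarrow> y \<in> M \<Longrightarrow> x - y \<in> M"
  using M_add[of x "- y"] M_minus[of y] by simp

abbreviation "U \<equiv> weight_space scale act V"

lemma U_iff: "v \<in> U l \<longleftrightarrow> v \<in> V \<and> act (vir_L 0) v = scale l v"
  by (auto simp: weight_space_def)

lemma U_subspace: "A.V.subspace (U l)"
  using intermediate by (simp add: intermediate_series_def harish_chandra_def direct_sum_decomp_def)

lemma decomp: "v \<in> V \<Longrightarrow> \<exists>!f. (\<forall>i. f i \<in> U i) \<and> finite {i. f i \<noteq> 0} \<and> v = (\<Sum>i | f i \<noteq> 0. f i)"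
  using intermediate by (simp add: intermediate_series_def harish_chandra_def direct_sum_decomp_def)

lemma act_zero_right: "x \<in> vir M \<Longrightarrow> act x 0 = 0"
  using A.act_scale_right[of x 0 0] A.V.subspace_0[OF A.subspace_V] by simp

lemma act_zero_left: "v \<in> V \<Longrightarrow> act 0 v = 0"
  using A.act_scale_left[OF c_in, of v 0] by simp

lemma U_line: "\<exists>e\<in>U l. \<forall>v\<in>U l. \<exists>s. v = scale s e"
proof -
  obtain B where B: "finite B" "A.V.span B = U l"
    using intermediate unfolding intermediate_series_def harish_chandra_def by blast
  obtain B' where B': "B' \<subseteq> U l" "A.V.independent B'" "U l \<subseteq> A.V.span B'" "card B' = A.V.dim (U l)"
    using A.V.basis_exists by blast
  have "finite B'" using A.V.independent_span_bound[OF B(1) B'(2)] B' B by blast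
  moreover have "card B' \<le> 1" using B'(4) intermediate by (simp add: intermediate_series_def)
  ultimately have "B' = {} \<or> (\<exists>e. B' = {e})" by (metis card_0_eq card_1_singletonE le_neq_implies_less less_one)
  then show ?thesis
  proof
    assume "B' = {}"
    then have "U l \<subseteq> {0}" using B'(3) by simp
    then show ?thesis using A.V.subspace_0[OF U_subspace[of l]] by (intro bexI[of _ 0]) auto
  next
    assume "\<exists>e. B' = {e}"
    then obtain e where "B' = {e}" by blast
    then show ?thesis using B' by (intro bexI[of _ e]) (auto simp: A.V.span_singleton)
  qed
qed

text \<open>Defined for every scalar l; it is 0 exactly when the weight space is 0, so formulas need
  no case distinction on the support.\<close>

definition e where "e l = (SOME e. e \<in> U l \<and> (\<forall>v\<in>U l. \<exists>s. v = scale s e))"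

lemma e_U: "e l \<in> U l" and e_gen: "v \<in> U l \<Longrightarrow> \<exists>s. v = scale s (e l)"
  using someI_ex[of "\<lambda>e. e \<in> U l \<and> (\<forall>v\<in>U l. \<exists>s. v = scale s e)"] U_line[of l]
  unfolding e_def by blast+

lemma e_V: "e l \<in> V" using e_U U_iff by blast

definition S where "S = {l. e l \<noteq> 0}"

text \<open>The index set and the labelling w are kept general because this serves twice: for the
  chosen generators indexed by weights, and for rescaled ones indexed by elements of M.\<close>

lemma bij_linear_ext:
  assumes w: "inj_on w T" "S \<subseteq> w ` T"
    and b: "\<And>\<nu>. \<nu> \<in> T \<Longrightarrow> b \<nu> \<in> U (w \<nu>) \<and> b \<nu> \<noteq> 0"
  shows "bij_betw (linear_ext scale b) (free_space T) V"
proof -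
  have bV: "b \<nu> \<in> V" if "\<nu> \<in> T" for \<nu> using b[OF that] U_iff by simp
  have into: "linear_ext scale b x \<in> V" if "x \<in> free_space T" for x
    using A.subspace_V that bV by (rule A.V.linear_ext_in_subspace)
  define D where "D x l = (if l \<in> w ` T then scale (Poly_Mapping.lookup x (the_inv_into T w l)) (b (the_inv_into T w l)) else 0)" for x l
  have Dw: "D x (w \<nu>) = scale (Poly_Mapping.lookup x \<nu>) (b \<nu>)" if "\<nu> \<in> T" for x \<nu>
    using that w(1) by (simp add: D_def the_inv_into_f_f)
  have dec: "(\<forall>i. D x i \<in> U i) \<and> finite {i. D x i \<noteq> 0} \<and> linear_ext scale b x = (\<Sum>i | D x i \<noteq> 0. D x i)"
    if x: "x \<in> free_space T" for x
  proof (intro conjI allI)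
    fix i
    show "D x i \<in> U i"
    proof (cases "i \<in> w ` T")
      case True
      then obtain \<nu> where "\<nu> \<in> T" "i = w \<nu>" by blast
      then show ?thesis using A.V.subspace_scale[OF U_subspace conjunct1[OF b]] by (simp add: Dw)
    qed (simp add: D_def A.V.subspace_0[OF U_subspace])
  next
    have k: "Poly_Mapping.keys x \<subseteq> T" using x by (simp add: free_space_def)
    have sub: "{i. D x i \<noteq> 0} \<subseteq> w ` Poly_Mapping.keys x"
    proof
      fix i assume i: "i \<in> {i. D x i \<noteq> 0}"
      then obtain \<nu> where "\<nu> \<in> T" "i = w \<nu>" by (auto simp: D_def split: if_splits)
      then have "\<nu> \<in> Poly_Mapping.keys x" using i Dw[of \<nu> x] by (intro in_keys_iff[THEN iffD2]) force
      then show "i \<in> w ` Poly_Mapping.keys x" using \<open>i = w \<nu>\<close> by blast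
    qed
    then show "finite {i. D x i \<noteq> 0}" by (rule finite_subset) simp
    have "(\<Sum>i | D x i \<noteq> 0. D x i) = (\<Sum>i\<in>w ` Poly_Mapping.keys x. D x i)"
      by (intro sum.mono_neutral_left sub finite_imageI finite_keys) simp
    also have "\<dots> = (\<Sum>\<nu>\<in>Poly_Mapping.keys x. D x (w \<nu>))"
      using sum.reindex[OF inj_on_subset[OF w(1) k]] by simp
    also have "\<dots> = linear_ext scale b x" unfolding linear_ext_def
      by (intro sum.cong refl Dw subsetD[OF k])
    finally show "linear_ext scale b x = (\<Sum>i | D x i \<noteq> 0. D x i)" by simp
  qed
  have "inj_on (linear_ext scale b) (free_space T)"
  proof (rule inj_onI)
    fix x y assume xy: "x \<in> free_space T" "y \<in> free_space T" "linear_ext scale b x = linear_ext scale b y"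
    have unique: "g = h" if "\<exists>!f. Q f" "Q g" "Q h" for Q and g h :: "'a \<Rightarrow> 'v" using that by blast
    have "D x = D y"
      using decomp[OF into[OF xy(1)]] dec[OF xy(1)] dec[OF xy(2)] unfolding xy(3)[symmetric] by (rule unique)
    then have "scale (Poly_Mapping.lookup x \<nu>) (b \<nu>) = scale (Poly_Mapping.lookup y \<nu>) (b \<nu>)" if "\<nu> \<in> T" for \<nu>
      using Dw[OF that] by metis
    then have "Poly_Mapping.lookup x \<nu> = Poly_Mapping.lookup y \<nu>" if "\<nu> \<in> T" for \<nu>
      using that b A.V.scale_right_imp_eq by blast
    moreover have "Poly_Mapping.lookup x \<nu> = 0 \<and> Poly_Mapping.lookup y \<nu> = 0" if "\<nu> \<notin> T" for \<nu>
      using that xy by (auto simp: free_space_def in_keys_iff subset_iff)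
    ultimately show "x = y" by (intro poly_mapping_eqI) metis
  qed
  moreover have "v \<in> linear_ext scale b ` free_space T" if v: "v \<in> V" for v
  proof -
    obtain f where f: "\<And>i. f i \<in> U i" "finite {i. f i \<noteq> 0}" "v = (\<Sum>i | f i \<noteq> 0. f i)"
      using decomp[OF v] by blast
    have "\<exists>\<nu> s. \<nu> \<in> T \<and> f i = scale s (b \<nu>)" if "f i \<noteq> 0" for i
    proof -
      obtain s where s: "f i = scale s (e i)" using e_gen[OF f(1)] by blast
      then have "i \<in> S" using that by (auto simp: S_def)
      then obtain \<nu> where \<nu>: "\<nu> \<in> T" "i = w \<nu>" using w(2) by blast
      obtain t where t: "b \<nu> = scale t (e i)" using e_gen b \<nu> by blast
      then have "t \<noteq> 0" using b \<nu> by auto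
      then have "f i = scale (s / t) (b \<nu>)" by (simp add: s t)
      then show ?thesis using \<nu> by blast
    qed
    then have "\<forall>i. \<exists>h. f i \<noteq> 0 \<longrightarrow> fst h \<in> T \<and> f i = scale (snd h) (b (fst h))" by auto
    from choice[OF this] obtain h where h: "\<And>i. f i \<noteq> 0 \<Longrightarrow> fst (h i) \<in> T \<and> f i = scale (snd (h i)) (b (fst (h i)))"
      by blast
    define \<nu> s where "\<nu> i = fst (h i)" and "s i = snd (h i)" for i
    have \<nu>: "\<And>i. f i \<noteq> 0 \<Longrightarrow> \<nu> i \<in> T \<and> f i = scale (s i) (b (\<nu> i))"
      using h by (simp add: \<nu>_def s_def)
    have "(\<Sum>i | f i \<noteq> 0. Poly_Mapping.single (\<nu> i) (s i)) \<in> free_space T"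
      using \<nu> by (intro pm.subspace_sum subspace_free_space) (auto simp: free_space_def)
    moreover have "linear_ext scale b (\<Sum>i | f i \<noteq> 0. Poly_Mapping.single (\<nu> i) (s i)) = v"
      using \<nu> f(3) by (simp add: A.V.linear_ext_sum[OF f(2)])
    ultimately show ?thesis by blast
  qed
  ultimately show ?thesis using into by (auto simp: bij_betw_def)
qed

lemma submodule_generators:
  assumes N: "A.V.subspace N" "N \<subseteq> V"
    and L: "\<And>\<mu> v. \<mu> \<in> M \<Longrightarrow> v \<in> N \<Longrightarrow> act (vir_L \<mu>) v \<in> N" and c: "\<And>v. v \<in> N \<Longrightarrow> act vir_c v \<in> N"
  shows "lie_submodule scale (vir M) act V N"
proof -
  have sub: "pm.subspace (vir M)" unfolding vir_def by (rule subspace_free_space)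
  have "x \<in> vir M \<and> (\<forall>v\<in>N. act x v \<in> N)" if "x \<in> vir M" for x
    using that[unfolded vir_def]
  proof (induction x rule: free_space_induct)
    case zero
    then show ?case using pm.subspace_0[OF sub] act_zero_left N A.V.subspace_0 by auto
  next
    case (add x y)
    then show ?case using pm.subspace_add[OF sub] A.V.subspace_add[OF N(1)] A.act_add_left N(2) by auto
  next
    case (scale s x)
    then show ?case using pm.subspace_scale[OF sub] A.V.subspace_scale[OF N(1)] A.act_scale_left N(2) by auto
  next
    case (single i)
    then show ?case using L c L_in c_in by auto
  qed
  then show ?thesis using N by (auto simp: lie_submodule_def)
qed

lemma act_L_U: 
  assumes "\<mu> \<in> M" "v \<in> U l" shows "act (vir_L \<mu>) v \<in> U (l + \<mu>)"
proof -
  have v: "v \<in> V" "act (vir_L 0) v = scale l v" using assms U_iff by auto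
  have Lv: "act (vir_L \<mu>) v \<in> V" using A.act_closed[OF L_in[OF assms(1)] v(1)] .
  have "act (vir_br (vir_L 0) (vir_L \<mu>)) v = scale \<mu> (act (vir_L \<mu>) v)"
    unfolding br_L_L using A.act_scale_left[OF L_in[OF assms(1)] v(1), of \<mu>] by (auto simp: act_zero_left v(1))
  then have "act (vir_L 0) (act (vir_L \<mu>) v) = scale \<mu> (act (vir_L \<mu>) v) + scale l (act (vir_L \<mu>) v)"
    using A.act_br[OF L_in[OF M_zero] L_in[OF assms(1)] v(1)] A.act_scale_right[OF L_in[OF assms(1)] v(1), of l] v
    by (simp add: algebra_simps)
  then show ?thesis using Lv by (simp add: U_iff A.V.scale_left_distrib add.commute)
qed

lemma act_c_L:
  assumes "\<mu> \<in> M" "v \<in> V" shows "act vir_c (act (vir_L \<mu>) v) = act (vir_L \<mu>) (act vir_c v)"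
  using A.act_br[OF c_in L_in[OF assms(1)] assms(2)] by (simp add: br_c_L act_zero_left assms)

lemma act_c_U: "v \<in> U l \<Longrightarrow> act vir_c v \<in> U l"
  using act_c_L[OF M_zero, of v] A.act_closed[OF c_in] A.act_scale_right[OF c_in, of v l] by (simp add: U_iff)

text \<open>If \<open>e q\<close> is 0 every scalar fits; the value 0 makes the commutation
  relations for different end points hold at missing weights too.\<close>

definition f where "f p q = (if p \<in> S \<and> q \<in> S then SOME s. act (vir_L (q - p)) (e p) = scale s (e q) else 0)"

lemma act_L_e: "\<mu> \<in> M \<Longrightarrow> act (vir_L \<mu>) (e p) = scale (f p (p + \<mu>)) (e (p + \<mu>))"
proof -
  assume \<mu>: "\<mu> \<in> M"
  have ex: "\<exists>s. act (vir_L \<mu>) (e p) = scale s (e (p + \<mu>))"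
    using e_gen[OF act_L_U[OF \<mu> e_U]] .
  show ?thesis
  proof (cases "p \<in> S \<and> p + \<mu> \<in> S")
    case True then show ?thesis using someI_ex[OF ex] by (simp add: f_def)
  next
    case False then show ?thesis using ex act_zero_right[OF L_in[OF \<mu>]] by (auto simp: S_def f_def)
  qed
qed

text \<open>One scalar per weight: that c acts by the same scalar on all of V is only obtained from
  connectedness, in \<open>\<gamma>_const\<close>.\<close>

definition \<gamma> where "\<gamma> p = (SOME s. act vir_c (e p) = scale s (e p))"

lemma act_c_e: "act vir_c (e p) = scale (\<gamma> p) (e p)"
  unfolding \<gamma>_def using someI_ex[OF e_gen[OF act_c_U[OF e_U[of p]]]] .

lemma f_off: "p \<notin> S \<Longrightarrow> f p q = 0" "q \<notin> S \<Longrightarrow> f p q = 0"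
  by (simp_all add: f_def)

lemma e_cancel: "p \<in> S \<Longrightarrow> scale a (e p) = scale b (e p) \<longleftrightarrow> a = b"
  by (auto simp: S_def)

lemma \<gamma>_eq: "\<mu> \<in> M \<Longrightarrow> f p (p + \<mu>) \<noteq> 0 \<Longrightarrow> \<gamma> p = \<gamma> (p + \<mu>)"
proof -
  assume \<mu>: "\<mu> \<in> M" and f: "f p (p + \<mu>) \<noteq> 0"
  then have S: "p + \<mu> \<in> S" using f_off by blast
  have "scale (f p (p + \<mu>) * \<gamma> (p + \<mu>)) (e (p + \<mu>)) = scale (\<gamma> p * f p (p + \<mu>)) (e (p + \<mu>))"
    using act_c_L[OF \<mu> e_V[of p]] A.act_scale_right[OF c_in e_V[of "p + \<mu>"]]
      A.act_scale_right[OF L_in[OF \<mu>] e_V[of "p"]] by (simp add: act_L_e[OF \<mu>] act_c_e)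
  then show ?thesis using f S by (auto simp: S_def)
qed

lemma f_commutator:
  assumes "\<mu> \<in> M" "\<nu> \<in> M" "p + \<mu> + \<nu> \<in> S"
  shows "(\<nu> - \<mu>) * f p (p + \<mu> + \<nu>) + (if \<mu> + \<nu> = 0 then (\<mu> ^ 3 - \<mu>) / 12 * \<gamma> p else 0) =
    f p (p + \<nu>) * f (p + \<nu>) (p + \<mu> + \<nu>) - f p (p + \<mu>) * f (p + \<mu>) (p + \<mu> + \<nu>)"
proof -
  have sub: "pm.subspace (vir M)" unfolding vir_def by (rule subspace_free_space)
  define r where "r = p + \<mu> + \<nu>"
  have r: "p + (\<mu> + \<nu>) = r" "p + \<nu> + \<mu> = r" "p + \<mu> + \<nu> = r" by (simp_all add: r_def add_ac)
  note L = L_in[OF assms(1)] L_in[OF assms(2)] L_in[OF M_add[OF assms(1,2)]]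
  have "act (vir_br (vir_L \<mu>) (vir_L \<nu>)) (e p) = scale (\<nu> - \<mu>) (scale (f p r) (e r)) +
      scale (if \<mu> + \<nu> = 0 then (\<mu> ^ 3 - \<mu>) / 12 else 0) (scale (\<gamma> p) (e p))"
    unfolding br_L_L
    using A.act_add_left[OF pm.subspace_scale[OF sub L(3)] pm.subspace_scale[OF sub c_in] e_V]
      A.act_scale_left[OF L(3) e_V] A.act_scale_left[OF c_in e_V] act_L_e[OF M_add[OF assms(1,2)], of p]
    by (simp only: act_c_e r)
  moreover have "scale (if \<mu> + \<nu> = 0 then (\<mu> ^ 3 - \<mu>) / 12 else 0) (scale (\<gamma> p) (e p)) =
     scale (if \<mu> + \<nu> = 0 then (\<mu> ^ 3 - \<mu>) / 12 * \<gamma> p else 0) (e r)"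
    using r(1) by auto
  moreover have "act (vir_br (vir_L \<mu>) (vir_L \<nu>)) (e p) =
     scale (f p (p + \<nu>)) (scale (f (p + \<nu>) r) (e r)) - scale (f p (p + \<mu>)) (scale (f (p + \<mu>) r) (e r))"
    using A.act_br[OF L(1,2) e_V] A.act_scale_right[OF L(1) e_V] A.act_scale_right[OF L(2) e_V]
      act_L_e[OF assms(1)] act_L_e[OF assms(2)] by (simp add: r)
  ultimately have "scale ((\<nu> - \<mu>) * f p r + (if \<mu> + \<nu> = 0 then (\<mu> ^ 3 - \<mu>) / 12 * \<gamma> p else 0)) (e r) =
     scale (f p (p + \<nu>) * f (p + \<nu>) r - f p (p + \<mu>) * f (p + \<mu>) r) (e r)"
    by (simp only: A.V.scale_scale A.V.scale_left_distrib A.V.scale_left_diff_distrib)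
  then show ?thesis using assms(3) unfolding r_def[symmetric] by (simp only: e_cancel)
qed

abbreviation "\<Phi> \<equiv> linear_ext scale e"

lemma bij_\<Phi>: "bij_betw \<Phi> (free_space S) V"
  by (rule bij_linear_ext[of "\<lambda>x. x"]) (use e_U in \<open>auto simp: S_def\<close>)

lemma \<Phi>_V: "X \<subseteq> S \<Longrightarrow> x \<in> free_space X \<Longrightarrow> \<Phi> x \<in> V"
  using A.V.linear_ext_in_subspace[OF A.subspace_V, of x X e] e_V by simp

lemma submodule_\<Phi>:
  assumes X: "X \<subseteq> S" and cl: "\<And>p \<mu>. \<mu> \<in> M \<Longrightarrow> p \<in> X \<Longrightarrow> p + \<mu> \<in> S - X \<Longrightarrow> f p (p + \<mu>) = 0"
  shows "lie_submodule scale (vir M) act V (\<Phi> ` free_space X)"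
proof (rule submodule_generators)
  show sub: "A.V.subspace (\<Phi> ` free_space X)"
  proof (rule A.V.subspaceI)
    show "0 \<in> \<Phi> ` free_space X"
      using pm.subspace_0[OF subspace_free_space] by (intro image_eqI[of _ _ 0]) simp_all
  next
    fix u v assume "u \<in> \<Phi> ` free_space X" "v \<in> \<Phi> ` free_space X"
    then obtain x y where xy: "u = \<Phi> x" "v = \<Phi> y" "x \<in> free_space X" "y \<in> free_space X" by blast
    show "u + v \<in> \<Phi> ` free_space X"
      using pm.subspace_add[OF subspace_free_space xy(3,4)] by (intro image_eqI[of _ _ "x + y"]) (simp_all add: xy A.V.linear_ext_add)
  next
    fix c u assume "u \<in> \<Phi> ` free_space X"
    then obtain x where x: "u = \<Phi> x" "x \<in> free_space X" by blast
    show "scale c u \<in> \<Phi> ` free_space X"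
      using pm.subspace_scale[OF subspace_free_space x(2)] by (intro image_eqI[of _ _ "pm_scale c x"]) (simp_all add: x A.V.linear_ext_scale)
  qed
  have e_in: "e p \<in> \<Phi> ` free_space X" if "p \<in> X" for p
    using that by (intro image_eqI[of _ _ "bvec p"]) (simp_all add: free_space_def)
  show "\<Phi> ` free_space X \<subseteq> V" using \<Phi>_V[OF X] by blast
  have main: "act g (\<Phi> x) \<in> \<Phi> ` free_space X" if g: "g \<in> vir M" "\<And>p. p \<in> X \<Longrightarrow> act g (e p) \<in> \<Phi> ` free_space X" and x: "x \<in> free_space X" for g x
  proof -
    have "\<Phi> x \<in> V \<and> act g (\<Phi> x) \<in> \<Phi> ` free_space X"
      using x
    proof (induction x rule: free_space_induct)
      case zero
      then show ?case using act_zero_right[OF g(1)] A.V.subspace_0[OF sub] A.V.subspace_0[OF A.subspace_V] by simp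
    next
      case (add x y)
      then show ?case
        using A.V.subspace_add[OF sub] A.V.subspace_add[OF A.subspace_V] A.act_add_right[OF g(1)]
        by (simp add: A.V.linear_ext_add)
    next
      case (scale s x)
      then show ?case
        using A.V.subspace_scale[OF sub] A.V.subspace_scale[OF A.subspace_V] A.act_scale_right[OF g(1)]
        by (simp add: A.V.linear_ext_scale)
    next
      case (single i)
      then show ?case using g(2) e_V by simp
    qed
    then show ?thesis by blast
  qed
  show "act (vir_L \<mu>) v \<in> \<Phi> ` free_space X" if \<mu>: "\<mu> \<in> M" and v: "v \<in> \<Phi> ` free_space X" for \<mu> v
  proof -
    obtain x where x: "v = \<Phi> x" "x \<in> free_space X" using v by blast
    have "act (vir_L \<mu>) (e p) \<in> \<Phi> ` free_space X" if p: "p \<in> X" for p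
    proof (cases "p + \<mu> \<in> X")
      case True
      then show ?thesis using A.V.subspace_scale[OF sub e_in] by (simp add: act_L_e[OF \<mu>])
    next
      case False
      then have "scale (f p (p + \<mu>)) (e (p + \<mu>)) = 0" using cl[OF \<mu> p] by (cases "p + \<mu> \<in> S") (auto simp: S_def)
      then show ?thesis using A.V.subspace_0[OF sub] by (simp only: act_L_e[OF \<mu>])
    qed
    then show ?thesis unfolding x(1) by (intro main L_in \<mu> x(2))
  qed
  show "act vir_c v \<in> \<Phi> ` free_space X" if v: "v \<in> \<Phi> ` free_space X" for v
  proof -
    obtain x where x: "v = \<Phi> x" "x \<in> free_space X" using v by blast
    have "act vir_c (e p) \<in> \<Phi> ` free_space X" if p: "p \<in> X" for p
      using A.V.subspace_scale[OF sub e_in[OF p]] by (simp add: act_c_e)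
    then show ?thesis unfolding x(1) by (intro main c_in x(2))
  qed
qed

section \<open>Connectedness, support and central charge\<close>

lemma V_nontrivial: "V \<noteq> {0}"
  using intermediate by (simp add: intermediate_series_def indecomposable_def)

text \<open>If no nonzero arrow crosses the boundary of T, the weight vectors inside and outside T
  span complementary submodules.\<close>

lemma S_split:
  assumes T: "\<And>p \<mu>. \<mu> \<in> M \<Longrightarrow> (p \<in> T) \<noteq> (p + \<mu> \<in> T) \<Longrightarrow> f p (p + \<mu>) = 0"
  shows "S \<subseteq> T \<or> S \<inter> T = {}"
proof (rule ccontr)
  assume "\<not> ?thesis"
  then obtain p q where p: "p \<in> S \<inter> T" and q: "q \<in> S - T" by blast
  let ?N1 = "\<Phi> ` free_space (S \<inter> T)" and ?N2 = "\<Phi> ` free_space (S - T)"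
  have N1: "lie_submodule scale (vir M) act V ?N1" by (rule submodule_\<Phi>) (blast, rule T, auto)
  have N2: "lie_submodule scale (vir M) act V ?N2" by (rule submodule_\<Phi>) (blast, rule T, auto)
  have sub: "A.V.subspace ?N1" "A.V.subspace ?N2" and NV: "?N1 \<subseteq> V" "?N2 \<subseteq> V"
    using N1 N2 by (simp_all add: lie_submodule_def)
  have e_in: "e r \<in> \<Phi> ` free_space X" if "r \<in> X" for r X
    using that by (intro image_eqI[of _ _ "bvec r"]) (simp_all add: free_space_def)
  have "?N1 \<noteq> {0}" "?N2 \<noteq> {0}" using e_in[OF p] e_in[OF q] p q by (auto simp: S_def)
  moreover have "?N1 \<inter> ?N2 = {0}"
  proof
    show "?N1 \<inter> ?N2 \<subseteq> {0}"
    proof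
      fix v assume "v \<in> ?N1 \<inter> ?N2"
      then obtain x y where xy: "x \<in> free_space (S \<inter> T)" "y \<in> free_space (S - T)" "v = \<Phi> x" "v = \<Phi> y"
        by (elim IntE imageE)
      have "x \<in> free_space S" "y \<in> free_space S" using xy by (auto simp: free_space_def)
      moreover have "\<Phi> x = \<Phi> y" using xy(3,4) by simp
      ultimately have "x = y" using inj_onD[OF bij_betw_imp_inj_on[OF bij_\<Phi>]] by simp
      then have "Poly_Mapping.keys x = {}" using xy(1,2) unfolding free_space_def by blast
      then show "v \<in> {0}" using xy by simp
    qed
    show "{0} \<subseteq> ?N1 \<inter> ?N2" using A.V.subspace_0[OF sub(1)] A.V.subspace_0[OF sub(2)] by simp
  qed
  moreover have "?N1 + ?N2 = V"
  proof
    show "?N1 + ?N2 \<subseteq> V"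
    proof
      fix v assume "v \<in> ?N1 + ?N2"
      then obtain a b where ab: "v = a + b" "a \<in> ?N1" "b \<in> ?N2" by (rule set_plus_elim)
      then have "a \<in> V" "b \<in> V" using NV by auto
      then show "v \<in> V" unfolding ab(1) by (rule A.V.subspace_add[OF A.subspace_V])
    qed
    have "\<Phi> z \<in> ?N1 + ?N2" if "z \<in> free_space S" for z
      using that
    proof (induction z rule: free_space_induct)
      case zero
      show ?case using set_plus_intro[OF A.V.subspace_0[OF sub(1)] A.V.subspace_0[OF sub(2)]] by simp
    next
      case (add x y)
      obtain a b where ab: "\<Phi> x = a + b" "a \<in> ?N1" "b \<in> ?N2" using add(1) by (rule set_plus_elim)
      obtain c d where cd: "\<Phi> y = c + d" "c \<in> ?N1" "d \<in> ?N2" using add(2) by (rule set_plus_elim)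
      have "\<Phi> (x + y) = (a + c) + (b + d)" by (simp add: A.V.linear_ext_add ab cd)
      then show ?case
        using set_plus_intro[OF A.V.subspace_add[OF sub(1) ab(2) cd(2)] A.V.subspace_add[OF sub(2) ab(3) cd(3)]] by simp
    next
      case (scale s x)
      obtain a b where ab: "\<Phi> x = a + b" "a \<in> ?N1" "b \<in> ?N2" using scale by (rule set_plus_elim)
      have "\<Phi> (pm_scale s x) = scale s a + scale s b" by (simp add: A.V.linear_ext_scale ab A.V.scale_right_distrib)
      then show ?case
        using set_plus_intro[OF A.V.subspace_scale[OF sub(1) ab(2)] A.V.subspace_scale[OF sub(2) ab(3)]] by simp
    next
      case (single i)
      show ?case
      proof (cases "i \<in> T")
        case True
        then show ?thesis using set_plus_intro[OF e_in A.V.subspace_0[OF sub(2)], of i] single by simp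
      next
        case False
        then show ?thesis using set_plus_intro[OF A.V.subspace_0[OF sub(1)] e_in, of i] single by simp
      qed
    qed
    then have "\<Phi> ` free_space S \<subseteq> ?N1 + ?N2" by (rule image_subsetI)
    then show "V \<subseteq> ?N1 + ?N2" by (simp only: bij_betw_imp_surj_on[OF bij_\<Phi>])
  qed
  ultimately have "\<exists>N1 N2. lie_submodule scale (vir M) act V N1 \<and> lie_submodule scale (vir M) act V N2 \<and>
      N1 \<noteq> {0} \<and> N2 \<noteq> {0} \<and> N1 \<inter> N2 = {0} \<and> N1 + N2 = V"
    using N1 N2 by (intro exI[of _ ?N1] exI[of _ ?N2] conjI)
  then show False using intermediate by (simp only: intermediate_series_def indecomposable_def simp_thms)
qed

lemma S_nonempty: "S \<noteq> {}"
proof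
  assume "S = {}"
  then have "free_space S = {0}" by (auto simp: free_space_def)
  then have "V = \<Phi> ` {0}" using bij_betw_imp_surj_on[OF bij_\<Phi>] by metis
  then show False using V_nontrivial by simp
qed

lemma S_coset: assumes "p \<in> S" "q \<in> S" shows "q - p \<in> M"
proof -
  have "S \<subseteq> {r. r - p \<in> M} \<or> S \<inter> {r. r - p \<in> M} = {}"
  proof (rule S_split)
    fix r \<mu> assume \<mu>: "\<mu> \<in> M" and "(r \<in> {r. r - p \<in> M}) \<noteq> (r + \<mu> \<in> {r. r - p \<in> M})"
    moreover have "r - p \<in> M \<longleftrightarrow> r + \<mu> - p \<in> M"
      using M_add[OF _ \<mu>, of "r - p"] M_diff[OF _ \<mu>, of "r + \<mu> - p"] by (auto simp: algebra_simps)
    ultimately show "f r (r + \<mu>) = 0" by simp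
  qed
  moreover have "p \<in> S \<inter> {r. r - p \<in> M}" using assms M_zero by simp
  ultimately show ?thesis using assms by blast
qed

lemma \<gamma>_const: assumes "p \<in> S" "q \<in> S" shows "\<gamma> q = \<gamma> p"
proof -
  have "S \<subseteq> {r. \<gamma> r = \<gamma> p} \<or> S \<inter> {r. \<gamma> r = \<gamma> p} = {}"
    by (rule S_split) (use \<gamma>_eq in fastforce)
  then show ?thesis using assms by blast
qed

lemma f_diag: "p \<in> S \<Longrightarrow> f p p = p"
  using act_L_e[OF M_zero, of p] e_U[of p] by (auto simp: U_iff S_def)

lemma f_rel:
  assumes "q - p \<in> M" "r - p \<in> M" "p \<noteq> r" "p + r = q + s"
  shows "(s - q) * f p r = f p s * f s r - f p q * f q r"
proof (cases "r \<in> S")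
  case True
  have s: "s - p = (r - p) - (q - p)" using assms(4) by (simp add: algebra_simps)
  have sM: "s - p \<in> M" unfolding s by (rule M_diff[OF assms(2,1)])
  have r: "p + (q - p) + (s - p) = r" using assms(4) by (simp add: algebra_simps)
  then have "(q - p) + (s - p) \<noteq> 0" using assms(3) by auto
  then show ?thesis using f_commutator[OF assms(1) sM, of p] True unfolding r by simp
next
  case False then show ?thesis using f_off by simp
qed

lemma f_loop:
  assumes "p \<in> S" "\<mu> \<in> M"
  shows "f p (p + \<mu>) * f (p + \<mu>) p - f p (p - \<mu>) * f (p - \<mu>) p = 2 * \<mu> * p - (\<mu> ^ 3 - \<mu>) / 12 * \<gamma> p"
  using f_commutator[OF M_minus[OF assms(2)] assms(2), of p] assms(1)
  by (simp add: f_diag power3_eq_cube algebra_simps diff_divide_distrib)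

lemma M_int: "x \<in> M \<Longrightarrow> of_int k * x \<in> M"
proof (induction k rule: int_induct[where k = 0])
  case base then show ?case by (simp add: M_zero)
next
  case (step1 i) then show ?case using M_add[of "of_int i * x" x] by (simp add: algebra_simps)
next
  case (step2 i) then show ?case using M_diff[of "of_int i * x" x] by (simp add: algebra_simps)
qed

lemma line:
  assumes "x \<in> M" "x \<noteq> 0" "z \<in> S"
  shows "unit_line_support (\<lambda>i j. f (p + of_int i * x) (p + of_int j * x) / x) (p / x)
    {i. p + of_int i * x \<in> S} (x * \<gamma> z / 12) (\<gamma> z / (12 * x))"
proof -
  define F where "F i j = f (p + of_int i * x) (p + of_int j * x) / x" for i j
  have f: "f (p + of_int i * x) (p + of_int j * x) = F i j * x" for i j using assms(2) by (simp add: F_def)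
  have d: "(p + of_int i * x) - (p + of_int j * x) = of_int (i - j) * x" for i j by (simp add: algebra_simps)
  have dM: "(p + of_int i * x) - (p + of_int j * x) \<in> M" for i j unfolding d by (rule M_int[OF assms(1)])
  interpret L: unit_line F "p / x"
  proof
    fix i k j l :: int assume "i \<noteq> k" "i + k = j + l"
    then have "(of_int i + of_int k :: 'a) = of_int j + of_int l" by (metis of_int_add)
    then have "(p + of_int i * x) + (p + of_int k * x) = (p + of_int j * x) + (p + of_int l * x)" by algebra
    moreover have "p + of_int i * x \<noteq> p + of_int k * x" using \<open>i \<noteq> k\<close> assms(2) by simp
    ultimately have "(of_int (l - j) * F i k) * (x * x) = (F i l * F l k - F i j * F j k) * (x * x)"
      using f_rel[OF dM[of j i] dM[of k i], of "p + of_int l * x"] unfolding f d by (simp add: algebra_simps)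
    then show "of_int (l - j) * F i k = F i l * F l k - F i j * F j k" using assms(2) by simp
  qed
  show ?thesis unfolding F_def[symmetric]
  proof
    fix i m assume "i \<in> {i. p + of_int i * x \<in> S}"
    then have i: "p + of_int i * x \<in> S" by simp
    have "p + of_int i * x + of_int m * x = p + of_int (i + m) * x" "p + of_int i * x - of_int m * x = p + of_int (i - m) * x"
      by (simp_all add: algebra_simps)
    then have "(L.P i (i + m) - L.P (i - m) i) * (x * x) = 2 * (of_int m * x) * (p + of_int i * x) - ((of_int m * x) ^ 3 - of_int m * x) / 12 * \<gamma> z"
      using f_loop[OF i M_int[OF assms(1), of m]] \<gamma>_const[OF assms(3) i] by (simp only: f L.P_def) (simp add: algebra_simps)
    also have "\<dots> = (2 * of_int m * (p / x + of_int i) - (x * \<gamma> z / 12 * of_int m ^ 3 - \<gamma> z / (12 * x) * of_int m)) * (x * x)"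
      using assms(2) by (simp add: field_simps power3_eq_cube)
    finally show "L.P i (i + m) - L.P (i - m) i = 2 * of_int m * (p / x + of_int i) - (x * \<gamma> z / 12 * of_int m ^ 3 - \<gamma> z / (12 * x) * of_int m)"
      using assms(2) by simp
  qed (auto simp: F_def f_off)
qed

lemma S_nonzero:
  assumes "p \<in> S" "p \<noteq> 0" "q - p \<in> M" "q \<noteq> 0"
  shows "q \<in> S"
proof (rule ccontr)
  assume q: "q \<notin> S"
  define x where "x = q - p"
  have x: "x \<in> M" "x \<noteq> 0" using assms q by (auto simp: x_def)
  interpret L: unit_line_support "\<lambda>i j. f (p + of_int i * x) (p + of_int j * x) / x" "p / x"
    "{i. p + of_int i * x \<in> S}" "x * \<gamma> p / 12" "\<gamma> p / (12 * x)"
    by (rule line[OF x assms(1)])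
  have "p / x + 1 = 0" by (rule L.missing_point) (use assms x q in \<open>auto simp: x_def\<close>)
  then have "q = 0" using x(2) by (simp add: field_simps x_def)
  then show False using assms by simp
qed

lemma \<gamma>_zero: assumes "z \<in> S" shows "\<gamma> z = 0"
proof -
  obtain x where x: "x \<in> M" "x \<noteq> 0" using M_nontrivial M_zero by blast
  show ?thesis
  proof (cases "\<exists>p\<in>S. p \<noteq> 0")
    case True
    then obtain p where p: "p \<in> S" "p \<noteq> 0" by blast
    interpret L: unit_line_support "\<lambda>i j. f (p + of_int i * x) (p + of_int j * x) / x" "p / x"
      "{i. p + of_int i * x \<in> S}" "x * \<gamma> z / 12" "\<gamma> z / (12 * x)"
      by (rule line[OF x assms])
    \<comment> \<open>Only weight 0 can be missing and a line meets it at most once, so a tail of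
      the line is supported.\<close>
    have "\<exists>k::int. \<forall>i\<ge>k. p + of_int i * x \<noteq> 0"
    proof (cases "\<exists>k::int. p + of_int k * x = 0")
      case True
      then obtain k where k: "p + of_int k * x = 0" by blast
      have "p + of_int i * x \<noteq> 0" if "i \<ge> k + 1" for i
      proof
        assume "p + of_int i * x = 0"
        then have "of_int i * x = of_int k * x" using k by (metis add_left_cancel)
        then show False using that x by simp
      qed
      then show ?thesis by blast
    qed blast
    then obtain k where k: "\<And>i. i \<ge> k \<Longrightarrow> p + of_int i * x \<noteq> 0" by blast
    have "p + of_int i * x \<in> S" if "i \<ge> k" for i
      by (rule S_nonzero[OF p _ k[OF that]]) (simp add: M_int[OF x(1)])
    then have "x * \<gamma> z / 12 = 0" by (intro L.support_window[of k]) auto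
    then show ?thesis using x by simp
  next
    case False
    then have S: "S = {0}" using assms by auto
    \<comment> \<open>With 0 as the only weight all loops vanish and only the central term remains.
      The factor \<mu>^3 - \<mu> cannot vanish for both x and 2x.\<close>
    have "(\<mu> ^ 3 - \<mu>) / 12 * \<gamma> z = 0" if "\<mu> \<in> M" "\<mu> \<noteq> 0" for \<mu>
      using f_loop[of 0 \<mu>] that S assms f_off(2)[of \<mu> 0] f_off(2)[of "- \<mu>" 0] by simp
    from this[OF x] this[OF M_add[OF x(1) x(1)]] x(2)
    have "\<gamma> z = 0 \<or> x ^ 3 = x" "\<gamma> z = 0 \<or> (x + x) ^ 3 = x + x" by auto
    moreover have False if "x ^ 3 = x" "(x + x) ^ 3 = x + x"
    proof -
      have "(x + x) ^ 3 = 8 * x ^ 3" by (simp add: power3_eq_cube algebra_simps)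
      then have "8 * x = 2 * x" using that by simp
      then show False using x(2) by simp
    qed
    ultimately show ?thesis by blast
  qed
qed

text \<open>Loops satisfy the relation because the centre acts by 0. By \<open>S_nonzero\<close> a
  missing weight of the coset is 0, where \<open>diag\<close> holds with both sides 0.\<close>

lemma witt_graded_f:
  assumes "p \<in> S" "p \<noteq> 0"
  shows "witt_graded M {q. q - p \<in> M} f"
proof -
  have rel: "(x + z - 2 * y) * f x z = f x (x + z - y) * f (x + z - y) z - f x y * f y z"
    if "x - p \<in> M" "y - p \<in> M" "z - p \<in> M" for x y z
  proof (cases "x = z")
    case False
    have "y - x \<in> M" "z - x \<in> M" using M_diff[OF that(2,1)] M_diff[OF that(3,1)] by simp_all
    from f_rel[OF this False, of "x + z - y"] show ?thesis by (simp add: algebra_simps)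
  next
    case True
    show ?thesis
    proof (cases "x \<in> S")
      case x: True
      have "y - x \<in> M" using M_diff[OF that(2,1)] by simp
      from f_loop[OF x M_minus[OF this]] show ?thesis using \<gamma>_zero[OF x] f_diag[OF x] True by (simp add: algebra_simps)
    next
      case False
      then show ?thesis using True by (simp add: f_off)
    qed
  qed
  show ?thesis
  proof
    show "q + x \<in> {q. q - p \<in> M}" if "q \<in> {q. q - p \<in> M}" "x \<in> M" for q x
      using M_add[of "q - p" x] that by (simp add: algebra_simps)
    show "q - r \<in> M" if "r \<in> {q. q - p \<in> M}" "q \<in> {q. q - p \<in> M}" for q r
      using M_diff[of "q - p" "r - p"] that by simp
    show "f q q = q" if "q \<in> {q. q - p \<in> M}" for q
    proof (cases "q \<in> S")
      case False
      then have "q = 0" using S_nonzero[OF assms, of q] that by blast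
      then show ?thesis using False f_off by simp
    qed (rule f_diag)
  qed (use M_zero M_add M_minus rel in auto)
qed

section \<open>Isomorphism with a listed module\<close>

text \<open>V is realised as the submodule on the supported indices, modulo {0}; \<open>k0\<close>
  says that no arrow leaves them. The cosets of {0} are singletons, hence the map
  \<open>v \<mapsto> {J v}\<close>.\<close>

lemma iso_subquotient:
  assumes \<alpha>: "\<And>p. p \<in> S \<Longrightarrow> p - \<alpha> \<in> M" and g: "\<And>p. g p \<noteq> 0"
    and k: "\<And>\<mu> \<nu>. \<mu> \<in> M \<Longrightarrow> \<nu> \<in> M \<Longrightarrow> \<alpha> + \<nu> \<in> S \<Longrightarrow> \<alpha> + (\<mu> + \<nu>) \<in> S \<Longrightarrow>
      g (\<alpha> + \<nu>) * f (\<alpha> + \<nu>) (\<alpha> + (\<mu> + \<nu>)) = k \<mu> \<nu> * g (\<alpha> + (\<mu> + \<nu>))"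
    and k0: "\<And>\<mu> \<nu>. \<mu> \<in> M \<Longrightarrow> \<nu> \<in> M \<Longrightarrow> \<alpha> + \<nu> \<in> S \<Longrightarrow> \<alpha> + (\<mu> + \<nu>) \<notin> S \<Longrightarrow> k \<mu> \<nu> = 0"
  shows "\<exists>N1 N2. lie_submodule pm_scale (vir M) (graded_act k) (free_space M) N1 \<and>
        lie_submodule pm_scale (vir M) (graded_act k) (free_space M) N2 \<and> N1 \<subset> N2 \<and>
        rep_isomorphic (vir M) (rep_of scale act V) (quotient_rep pm_scale (graded_act k) N2 N1)"
proof -
  note gr = pm.bilinear_ext_simps[where f = "basis_act k", folded graded_act_def]
  define T where "T = {\<nu> \<in> M. \<alpha> + \<nu> \<in> S}"
  define b where "b \<nu> = scale (g (\<alpha> + \<nu>)) (e (\<alpha> + \<nu>))" for \<nu>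
  let ?\<Psi> = "linear_ext scale b"
  have bU: "b \<nu> \<in> U (\<alpha> + \<nu>)" for \<nu>
    unfolding b_def by (rule A.V.subspace_scale[OF U_subspace e_U])
  have bV: "b \<nu> \<in> V" for \<nu> using bU[of \<nu>] by (simp add: U_iff)
  have bij: "bij_betw ?\<Psi> (free_space T) V"
  proof (rule bij_linear_ext[of "\<lambda>\<nu>. \<alpha> + \<nu>"])
    show "S \<subseteq> (\<lambda>\<nu>. \<alpha> + \<nu>) ` T"
    proof
      fix p assume "p \<in> S"
      then show "p \<in> (\<lambda>\<nu>. \<alpha> + \<nu>) ` T" using \<alpha> by (intro image_eqI[of _ _ "p - \<alpha>"]) (auto simp: T_def)
    qed
    show "b \<nu> \<in> U (\<alpha> + \<nu>) \<and> b \<nu> \<noteq> 0" if "\<nu> \<in> T" for \<nu>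
      using that bU[of \<nu>] g by (simp add: T_def b_def S_def)
  qed simp
  have \<Psi>V: "?\<Psi> x \<in> V" for x
    unfolding linear_ext_def by (intro A.V.subspace_sum[OF A.subspace_V] A.V.subspace_scale[OF A.subspace_V] bV)
  have gT: "graded_act k x y \<in> free_space T" if "x \<in> vir M" "y \<in> free_space T" for x y
    unfolding graded_act_def
  proof (rule pm.bilinear_ext_in_subspace[OF subspace_free_space that(1)[unfolded vir_def] that(2)])
    fix i \<nu> assume i: "i \<in> insert Vir_c (Vir_L ` M)" and \<nu>: "\<nu> \<in> T"
    show "basis_act k i \<nu> \<in> free_space T"
    proof (cases i)
      case (Vir_L \<mu>)
      then have \<mu>: "\<mu> \<in> M" using i by auto
      then have "k \<mu> \<nu> = 0 \<or> \<mu> + \<nu> \<in> T" using k0[of \<mu> \<nu>] \<nu> M_add[of \<mu> \<nu>] by (auto simp: T_def)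
      then show ?thesis by (auto simp: Vir_L free_space_def)
    qed (simp add: free_space_def)
  qed
  have \<Psi>_act: "?\<Psi> (graded_act k x y) = act x (?\<Psi> y)" if "x \<in> vir M" "y \<in> free_space T" for x y
  proof -
    have sub: "pm.subspace (vir M)" unfolding vir_def by (rule subspace_free_space)
    have "x \<in> vir M \<and> ?\<Psi> (graded_act k x y) = act x (?\<Psi> y)"
      using that(1)[unfolded vir_def]
    proof (induction x rule: free_space_induct)
      case zero
      then show ?case using pm.subspace_0[OF sub] by (simp add: gr act_zero_left \<Psi>V)
    next
      case (add x x')
      then show ?case using pm.subspace_add[OF sub] by (simp add: gr A.V.linear_ext_add A.act_add_left \<Psi>V)
    next
      case (scale s x)
      then show ?case using pm.subspace_scale[OF sub] by (simp add: gr A.V.linear_ext_scale A.act_scale_left \<Psi>V)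
    next
      case (single i)
      then have i: "bvec i \<in> vir M" by (auto simp: vir_def free_space_def)
      have "?\<Psi> (graded_act k (bvec i) y) = act (bvec i) (?\<Psi> y)"
        using that(2)
      proof (induction y rule: free_space_induct)
        case zero
        then show ?case by (simp add: gr act_zero_right[OF i])
      next
        case (add y y')
        then show ?case by (simp add: gr A.V.linear_ext_add A.act_add_right[OF i] \<Psi>V)
      next
        case (scale s y)
        then show ?case by (simp add: gr A.V.linear_ext_scale A.act_scale_right[OF i] \<Psi>V)
      next
        case \<nu>: (single \<nu>)
        then have S: "\<alpha> + \<nu> \<in> S" "\<nu> \<in> M" by (auto simp: T_def)
        show ?case
        proof (cases i)
          case (Vir_L \<mu>)
          then have \<mu>: "\<mu> \<in> M" using single by auto
          have "act (vir_L \<mu>) (b \<nu>) = scale (g (\<alpha> + \<nu>) * f (\<alpha> + \<nu>) (\<alpha> + (\<mu> + \<nu>))) (e (\<alpha> + (\<mu> + \<nu>)))"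
            unfolding b_def using A.act_scale_right[OF L_in[OF \<mu>] e_V] act_L_e[OF \<mu>, of "\<alpha> + \<nu>"]
            by (simp add: add_ac)
          also have "\<dots> = scale (k \<mu> \<nu>) (b (\<mu> + \<nu>))"
          proof (cases "\<alpha> + (\<mu> + \<nu>) \<in> S")
            case True
            then show ?thesis using k[OF \<mu> S(2,1)] by (simp add: b_def)
          next
            case False
            then show ?thesis by (simp add: b_def S_def)
          qed
          finally show ?thesis by (simp add: Vir_L gr)
        next
          case Vir_c
          have "act vir_c (b \<nu>) = 0"
            unfolding b_def using A.act_scale_right[OF c_in e_V] act_c_e \<gamma>_zero[OF S(1)] by simp
          then show ?thesis by (simp add: Vir_c gr)
        qed
      qed
      then show ?case using i by blast
    qed
    then show ?thesis by blast
  qed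
  define J where "J = inv_into (free_space T) ?\<Psi>"
  have J: "bij_betw J V (free_space T)" unfolding J_def by (rule bij_betw_inv_into[OF bij])
  have JT: "J v \<in> free_space T" if "v \<in> V" for v using bij_betwE[OF J] that by blast
  have \<Psi>J: "?\<Psi> (J v) = v" if "v \<in> V" for v unfolding J_def using bij_betw_inv_into_right[OF bij that] .
  have J_eq: "J v = x" if "v = ?\<Psi> x" "x \<in> free_space T" for v x
    unfolding J_def that(1) using bij_betw_inv_into_left[OF bij that(2)] .
  have sing: "x +o {0} = {x}" for x :: "'a \<Rightarrow>\<^sub>0 'a" by (simp add: elt_set_plus_def)
  have plus: "{x} + {y} = {x + y}" for x y :: "'a \<Rightarrow>\<^sub>0 'a" by (simp add: set_plus_def)
  have "rep_isomorphic (vir M) (rep_of scale act V) (quotient_rep pm_scale (graded_act k) (free_space T) {0})"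
    unfolding rep_isomorphic_def
  proof (intro exI[of _ "\<lambda>v. {J v}"] conjI ballI allI)
    have "bij_betw (\<lambda>x :: 'a \<Rightarrow>\<^sub>0 'a. {x}) (free_space T) ((\<lambda>v. v +o {0}) ` free_space T)"
      by (simp add: sing bij_betw_def inj_on_def)
    from bij_betw_trans[OF J this]
    show "bij_betw (\<lambda>v. {J v}) (rep_space (rep_of scale act V)) (rep_space (quotient_rep pm_scale (graded_act k) (free_space T) {0}))"
      by (simp add: rep_of_def quotient_rep_def comp_def)
  next
    fix v w assume "v \<in> rep_space (rep_of scale act V)" "w \<in> rep_space (rep_of scale act V)"
    then have vw: "v \<in> V" "w \<in> V" by (simp_all add: rep_of_def)
    have "J (v + w) = J v + J w"
      by (rule J_eq) (simp_all add: A.V.linear_ext_add \<Psi>J vw JT pm.subspace_add[OF subspace_free_space])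
    then show "{J (rep_add (rep_of scale act V) v w)} =
       rep_add (quotient_rep pm_scale (graded_act k) (free_space T) {0}) {J v} {J w}"
      by (simp add: rep_of_def quotient_rep_def plus)
  next
    fix s v assume "v \<in> rep_space (rep_of scale act V)"
    then have v: "v \<in> V" by (simp add: rep_of_def)
    have "J (scale s v) = pm_scale s (J v)"
      by (rule J_eq) (simp_all add: A.V.linear_ext_scale \<Psi>J v JT pm.subspace_scale[OF subspace_free_space])
    then show "{J (rep_scale (rep_of scale act V) s v)} =
       rep_scale (quotient_rep pm_scale (graded_act k) (free_space T) {0}) s {J v}"
      by (simp add: rep_of_def quotient_rep_def plus)
  next
    fix x v assume x: "x \<in> vir M" and "v \<in> rep_space (rep_of scale act V)"
    then have v: "v \<in> V" by (simp add: rep_of_def)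
    have "J (act x v) = graded_act k x (J v)"
      by (rule J_eq) (simp_all add: \<Psi>_act[OF x JT[OF v]] \<Psi>J v gT[OF x JT[OF v]])
    then show "{J (rep_act (rep_of scale act V) x v)} =
       rep_act (quotient_rep pm_scale (graded_act k) (free_space T) {0}) x {J v}"
      by (simp add: rep_of_def quotient_rep_def plus)
  qed
  moreover have "lie_submodule pm_scale (vir M) (graded_act k) (free_space M) (free_space T)"
    unfolding lie_submodule_def
  proof (intro conjI ballI gT)
    show "free_space T \<subseteq> free_space M" by (auto simp: free_space_def T_def)
  qed (rule subspace_free_space)
  moreover have "lie_submodule pm_scale (vir M) (graded_act k) (free_space M) {0}"
    unfolding lie_submodule_def using pm.subspace_0[OF subspace_free_space, of M] by (simp add: gr)
  moreover have "{0 :: 'a \<Rightarrow>\<^sub>0 'a} \<subset> free_space T"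
  proof -
    obtain p where p: "p \<in> S" using S_nonempty by blast
    then have "p - \<alpha> \<in> T" using \<alpha> by (simp add: T_def)
    then have "(bvec (p - \<alpha>) :: 'a \<Rightarrow>\<^sub>0 'a) \<in> free_space T" by (simp add: free_space_def)
    moreover have "bvec (p - \<alpha>) \<noteq> (0 :: 'a \<Rightarrow>\<^sub>0 'a)" by (metis lookup_single_eq lookup_zero zero_neq_one)
    ultimately have "{0 :: 'a \<Rightarrow>\<^sub>0 'a} \<noteq> free_space T" by auto
    moreover have "{0 :: 'a \<Rightarrow>\<^sub>0 'a} \<subseteq> free_space T" using pm.subspace_0[OF subspace_free_space, of T] by simp
    ultimately show ?thesis by (intro psubsetI)
  qed
  ultimately show ?thesis by (intro exI[of _ "{0}"] exI[of _ "free_space T"] conjI)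
qed

section \<open>Identification of the parameters\<close>

definition listed where
  "listed \<longleftrightarrow> (\<exists>actW. (\<exists>a b. actW = act_Aab a b \<or> actW = act_A a \<or> actW = act_B a) \<and>
     (\<exists>N1 N2. lie_submodule pm_scale (vir M) actW (free_space M) N1 \<and>
        lie_submodule pm_scale (vir M) actW (free_space M) N2 \<and> N1 \<subset> N2 \<and>
        rep_isomorphic (vir M) (rep_of scale act V) (quotient_rep pm_scale actW N2 N1)))"

lemma listedI:
  assumes "graded_act k = act_Aab a b \<or> graded_act k = act_A a \<or> graded_act k = act_B a"
    "\<And>p. p \<in> S \<Longrightarrow> p - \<alpha> \<in> M" "\<And>p. g p \<noteq> 0"
    "\<And>\<mu> \<nu>. \<mu> \<in> M \<Longrightarrow> \<nu> \<in> M \<Longrightarrow> \<alpha> + \<nu> \<in> S \<Longrightarrow> \<alpha> + (\<mu> + \<nu>) \<in> S \<Longrightarrow>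
      g (\<alpha> + \<nu>) * f (\<alpha> + \<nu>) (\<alpha> + (\<mu> + \<nu>)) = k \<mu> \<nu> * g (\<alpha> + (\<mu> + \<nu>))"
    "\<And>\<mu> \<nu>. \<mu> \<in> M \<Longrightarrow> \<nu> \<in> M \<Longrightarrow> \<alpha> + \<nu> \<in> S \<Longrightarrow> \<alpha> + (\<mu> + \<nu>) \<notin> S \<Longrightarrow> k \<mu> \<nu> = 0"
  shows listed
proof -
  have "\<exists>a b. graded_act k = act_Aab a b \<or> graded_act k = act_A a \<or> graded_act k = act_B a"
    using assms(1) by (intro exI)
  moreover note iso_subquotient[OF assms(2-5)]
  ultimately show ?thesis unfolding listed_def by (intro exI[of _ "graded_act k"] conjI)
qed

text \<open>In A_(0,0) every L_\<mu> kills v_0, so v_0 spans the one-dimensional trivial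
  module.\<close>

lemma listed_trivial:
  assumes "S = {0}" shows listed
  by (rule listedI[where k = "\<lambda>\<mu> \<nu>. 0 + \<nu> + \<mu> * 0" and a = 0 and b = 0 and \<alpha> = 0 and g = "\<lambda>_. 1"])
    (auto simp: act_Aab_def assms M_zero f_diag)

lemma listed_nontrivial:
  assumes z: "z \<in> S" "z \<noteq> 0" shows listed
proof -
  define W where "W = {q. q - z \<in> M}"
  have "witt_graded M W f" unfolding W_def using z by (rule witt_graded_f)
  then interpret Z: witt_graded M W f .
  obtain \<beta> where \<beta>: "\<And>p q. p \<in> W \<Longrightarrow> q \<in> W \<Longrightarrow> Z.P p q = p * q + \<beta> * (p - q)\<^sup>2"
    using Z.P_constant by blast
  interpret Z: witt_graded_gauge M W f \<beta>
    by unfold_locales (use \<beta> M_nontrivial M_zero in auto)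
  have zW: "z \<in> W" by (simp add: W_def M_zero)
  have SW: "S \<subseteq> W" using S_coset[OF z(1)] by (auto simp: W_def)
  have WS: "p \<in> S" if "p \<in> W" "p \<noteq> 0" for p using S_nonzero[OF z] that by (simp add: W_def)
  have W_iff: "z + \<nu> \<in> W \<longleftrightarrow> \<nu> \<in> M" for \<nu> by (simp add: W_def)
  show ?thesis
  proof (cases "\<beta> = 0 \<and> 0 \<in> W")
    case False
    obtain b g where g: "\<And>p. p \<in> W \<Longrightarrow> g p \<noteq> 0"
      "\<And>p q. p \<in> W \<Longrightarrow> q \<in> W \<Longrightarrow> g p * f p q = ((1 - b) * p + b * q) * g q"
    proof (cases "\<beta> = 0")
      case True
      then have W0: "W - {0} = W" using False by auto
      obtain g where "\<forall>p. g p \<noteq> 0" "\<forall>p\<in>W - {0}. \<forall>q\<in>W - {0}. g p * f p q = q * g q"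
        using Z.gauge_special[OF zW True] by blast
      \<comment> \<open>\<open>gauge_special\<close> is normalised so that the coefficient is the
        target weight, which is b = 1.\<close>
      then show ?thesis using that[of g 1] unfolding W0 by simp
    next
      case False
      then show ?thesis using Z.gauge_generic[OF zW False] that by blast
    qed
    have S: "S = W"
    proof (rule ccontr)
      assume "S \<noteq> W"
      then have 0: "0 \<in> W" "0 \<notin> S" using SW WS by blast+
      then have "\<beta> \<noteq> 0" using False by blast
      moreover have "\<beta> * z\<^sup>2 = 0" using \<beta>[OF 0(1) zW] f_off(1)[OF 0(2)] by (simp add: Z.P_def)
      ultimately show False using z(2) by simp
    qed
    show ?thesis
    proof (rule listedI[where k = "\<lambda>\<mu> \<nu>. z + \<nu> + \<mu> * b" and a = z and b = b and \<alpha> = z and g = "\<lambda>p. if p \<in> W then g p else 1"])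
      show "p - z \<in> M" if "p \<in> S" for p using that by (simp add: S W_def)
    next
      fix \<mu> \<nu> assume "z + \<nu> \<in> S" "z + (\<mu> + \<nu>) \<in> S"
      then show "(if z + \<nu> \<in> W then g (z + \<nu>) else 1) * f (z + \<nu>) (z + (\<mu> + \<nu>)) =
        (z + \<nu> + \<mu> * b) * (if z + (\<mu> + \<nu>) \<in> W then g (z + (\<mu> + \<nu>)) else 1)"
        using g(2)[of "z + \<nu>" "z + (\<mu> + \<nu>)"] by (simp add: S algebra_simps)
    next
      fix \<mu> \<nu> assume "\<mu> \<in> M" "\<nu> \<in> M" "z + (\<mu> + \<nu>) \<notin> S"
      then show "z + \<nu> + \<mu> * b = 0" using M_add by (simp add: S W_iff)
    qed (use g(1) in \<open>auto simp: act_Aab_def\<close>)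
  next
    case True
    then have \<beta>0: "\<beta> = 0" and 0: "0 \<in> W" by auto
    obtain g c0 c1 d0 d1 where g0: "\<forall>p. g p \<noteq> 0" "\<forall>p\<in>W - {0}. \<forall>q\<in>W - {0}. g p * f p q = q * g q"
      and c': "\<forall>q\<in>W - {0}. f 0 q = q * (c0 + c1 * q) * g q"
      and d': "\<forall>p\<in>W - {0}. g p * f p 0 = d0 + d1 * p"
      and cd: "c0 = 0 \<and> c1 = 0 \<or> d0 = 0 \<and> d1 = 0"
      using Z.gauge_zero_weight[OF 0 \<beta>0] by (elim exE conjE) (rule that)
    note g = spec[OF g0(1)] bspec[OF bspec[OF g0(2)]] and c = bspec[OF c'] and d = bspec[OF d']
    have zM: "z \<in> M" using M_minus[of "- z"] 0 by (simp add: W_def)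
    have WM: "W = M"
    proof (rule set_eqI)
      show "q \<in> W \<longleftrightarrow> q \<in> M" for q
        using M_add[of "q - z" z] M_diff[of q z] zM by (auto simp: W_def)
    qed
    have SM: "p \<in> M" if "p \<in> S" for p using that SW WM by blast
    have MS: "p \<in> S" if "p \<in> M" "p \<noteq> 0" for p using that WS WM by blast
    have f00: "f 0 0 = 0" using f_diag[of 0] f_off(1)[of 0 0] by blast
    show ?thesis
    proof (cases "0 \<in> S")
      case False
      \<comment> \<open>In A_(0,1) the coefficient is the target weight, so no arrow enters weight 0
        and the other weights span a submodule.\<close>
      then have S: "S = M - {0}" using SM MS by blast
      show ?thesis
      proof (rule listedI[where k = "\<lambda>\<mu> \<nu>. 0 + \<nu> + \<mu> * 1" and a = 0 and b = 1 and \<alpha> = 0 and g = g])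
        fix \<mu> \<nu> assume "0 + \<nu> \<in> S" "0 + (\<mu> + \<nu>) \<in> S"
        then show "g (0 + \<nu>) * f (0 + \<nu>) (0 + (\<mu> + \<nu>)) = (0 + \<nu> + \<mu> * 1) * g (0 + (\<mu> + \<nu>))"
          using g(2)[of \<nu> "\<mu> + \<nu>"] by (simp add: S WM add.commute)
      next
        fix \<mu> \<nu> assume "\<mu> \<in> M" "\<nu> \<in> M" "0 + (\<mu> + \<nu>) \<notin> S"
        then show "0 + \<nu> + \<mu> * 1 = 0" using M_add[of \<mu> \<nu>] by (simp add: S add.commute)
      qed (simp_all add: act_Aab_def S g(1))
    next
      case S0: True
      have SM': "S = M" using SM MS S0 by blast
      have "\<not> (c0 = 0 \<and> c1 = 0 \<and> d0 = 0 \<and> d1 = 0)"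
      proof
        assume cd0: "c0 = 0 \<and> c1 = 0 \<and> d0 = 0 \<and> d1 = 0"
        have "S \<subseteq> {0} \<or> S \<inter> {0} = {}"
        proof (rule S_split)
          fix p \<mu> assume "\<mu> \<in> M" and *: "(p \<in> {0}) \<noteq> (p + \<mu> \<in> {0})"
          show "f p (p + \<mu>) = 0"
          proof (cases "p \<in> S \<and> p + \<mu> \<in> S")
            case True
            then show ?thesis using * c[of "p + \<mu>"] d[of p] g(1)[of p] cd0 by (auto simp: SM' WM)
          qed (use f_off in blast)
        qed
        then show False using z S0 by blast
      qed
      \<comment> \<open>Up to the scale of e_0, the arrows out of 0 depend on the ratio of c0 and c1
        and those into 0 on the ratio of d0 and d1. Finite ratios give A_a with a = c0 / c1 and B_a
        with a = -d0 / d1; the points at infinity are A_(0,1) and A_(0,0).\<close>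
      then consider (A) "d0 = 0" "d1 = 0" "c1 \<noteq> 0" | (A1) "d0 = 0" "d1 = 0" "c1 = 0" "c0 \<noteq> 0"
        | (B) "c0 = 0" "c1 = 0" "d1 \<noteq> 0" | (A0) "c0 = 0" "c1 = 0" "d1 = 0" "d0 \<noteq> 0"
        using cd by blast
      then show ?thesis
      proof cases
        case A
        show ?thesis
        proof (rule listedI[where k = "\<lambda>\<mu> \<nu>. if \<nu> \<noteq> 0 then \<nu> + \<mu> else \<mu> * (\<mu> + c0 / c1)" and a = "c0 / c1"
            and \<alpha> = 0 and g = "\<lambda>p. if p = 0 then 1 / c1 else g p"])
          fix \<mu> \<nu> assume "\<mu> \<in> M" "\<nu> \<in> M"
          then show "(if 0 + \<nu> = 0 then 1 / c1 else g (0 + \<nu>)) * f (0 + \<nu>) (0 + (\<mu> + \<nu>)) =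
            (if \<nu> \<noteq> 0 then \<nu> + \<mu> else \<mu> * (\<mu> + c0 / c1)) * (if 0 + (\<mu> + \<nu>) = 0 then 1 / c1 else g (0 + (\<mu> + \<nu>)))"
            using g(2)[of \<nu> "\<mu> + \<nu>"] c[of \<mu>] d[of \<nu>] A f00 M_add[of \<mu> \<nu>] g(1)[of \<nu>]
            by (cases "\<nu> = 0"; cases "\<mu> + \<nu> = 0") (auto simp: WM field_simps add.commute)
        qed (use A g(1) in \<open>auto simp: act_A_def SM' M_add\<close>)
      next
        case A1
        show ?thesis
        proof (rule listedI[where k = "\<lambda>\<mu> \<nu>. 0 + \<nu> + \<mu> * 1" and a = 0 and b = 1
            and \<alpha> = 0 and g = "\<lambda>p. if p = 0 then 1 / c0 else g p"])
          fix \<mu> \<nu> assume "\<mu> \<in> M" "\<nu> \<in> M"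
          then show "(if 0 + \<nu> = 0 then 1 / c0 else g (0 + \<nu>)) * f (0 + \<nu>) (0 + (\<mu> + \<nu>)) =
            (0 + \<nu> + \<mu> * 1) * (if 0 + (\<mu> + \<nu>) = 0 then 1 / c0 else g (0 + (\<mu> + \<nu>)))"
            using g(2)[of \<nu> "\<mu> + \<nu>"] c[of \<mu>] d[of \<nu>] A1 f00 M_add[of \<mu> \<nu>] g(1)[of \<nu>]
            by (cases "\<nu> = 0"; cases "\<mu> + \<nu> = 0") (auto simp: WM field_simps add.commute)
        qed (use A1 g(1) in \<open>auto simp: act_Aab_def SM' M_add\<close>)
      next
        case B
        \<comment> \<open>Replacing \<open>g p\<close> by \<open>p * g p\<close> for nonzero p turns
          the coefficient of an arrow from its target weight into its source weight, as in B_a; the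
          value -d1 at 0 matches the sign there.\<close>
        define a where "a = - d0 / d1"
        have d0: "d0 = - (a * d1)" using B by (simp add: a_def)
        show ?thesis
        proof (rule listedI[where k = "\<lambda>\<mu> \<nu>. if \<nu> \<noteq> - \<mu> then \<nu> else - \<mu> * (\<mu> + a)" and a = a
            and \<alpha> = 0 and g = "\<lambda>p. if p = 0 then - d1 else p * g p"])
          fix \<mu> \<nu> assume M: "\<mu> \<in> M" "\<nu> \<in> M"
          show "(if 0 + \<nu> = 0 then - d1 else (0 + \<nu>) * g (0 + \<nu>)) * f (0 + \<nu>) (0 + (\<mu> + \<nu>)) =
            (if \<nu> \<noteq> - \<mu> then \<nu> else - \<mu> * (\<mu> + a)) * (if 0 + (\<mu> + \<nu>) = 0 then - d1 else (0 + (\<mu> + \<nu>)) * g (0 + (\<mu> + \<nu>)))"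
          proof (cases "\<nu> \<noteq> 0 \<and> \<mu> + \<nu> = 0")
            case True
            then have \<mu>: "\<mu> = - \<nu>" by (simp add: eq_neg_iff_add_eq_0)
            have "g \<nu> * f \<nu> 0 = (\<nu> - a) * d1" using d[of \<nu>] True M by (simp add: WM d0 algebra_simps)
            then have "\<nu> * g \<nu> * f \<nu> 0 = \<nu> * (\<nu> - a) * d1" by (simp only: mult.assoc)
            then show ?thesis using True by (simp add: \<mu> algebra_simps)
          next
            case False
            have "\<nu> = - \<mu> \<longleftrightarrow> \<mu> + \<nu> = 0" by (auto simp: eq_neg_iff_add_eq_0 add.commute)
            then show ?thesis using M g(2)[of \<nu> "\<mu> + \<nu>"] c[of \<mu>] B f00 M_add[of \<mu> \<nu>] False
              by (cases "\<nu> = 0") (auto simp: WM)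
          qed
        qed (use B g(1) in \<open>auto simp: act_B_def SM' M_add\<close>)
      next
        case A0
        show ?thesis
        proof (rule listedI[where k = "\<lambda>\<mu> \<nu>. 0 + \<nu> + \<mu> * 0" and a = 0 and b = 0
            and \<alpha> = 0 and g = "\<lambda>p. if p = 0 then d0 else p * g p"])
          fix \<mu> \<nu> assume "\<mu> \<in> M" "\<nu> \<in> M"
          then show "(if 0 + \<nu> = 0 then d0 else (0 + \<nu>) * g (0 + \<nu>)) * f (0 + \<nu>) (0 + (\<mu> + \<nu>)) =
            (0 + \<nu> + \<mu> * 0) * (if 0 + (\<mu> + \<nu>) = 0 then d0 else (0 + (\<mu> + \<nu>)) * g (0 + (\<mu> + \<nu>)))"
            using g(2)[of \<nu> "\<mu> + \<nu>"] c[of \<mu>] d[of \<nu>] A0 f00 M_add[of \<mu> \<nu>]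
            by (cases "\<nu> = 0"; cases "\<mu> + \<nu> = 0") (auto simp: WM)
        qed (use A0 g(1) in \<open>auto simp: act_Aab_def SM' M_add\<close>)
      qed
    qed
  qed
qed

end

theorem theorem4p6:
  fixes M :: "'a::field_char_0 set"
    and scale :: "'a \<Rightarrow> 'v::ab_group_add \<Rightarrow> 'v"
    and act :: "('a vir_gen \<Rightarrow>\<^sub>0 'a) \<Rightarrow> 'v \<Rightarrow> 'v"
    and V :: "'v set"
  assumes "0 \<in> M"
    and "\<And>\<mu> \<nu>. \<mu> \<in> M \<Longrightarrow> \<nu> \<in> M \<Longrightarrow> \<mu> + \<nu> \<in> M"
    and "\<And>\<mu>. \<mu> \<in> M \<Longrightarrow> - \<mu> \<in> M"
    and "M \<noteq> {0}"
    and "intermediate_series M scale act V"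
  shows "\<exists>actW. (\<exists>a b. actW = act_Aab a b \<or> actW = act_A a \<or> actW = act_B a) \<and>
    (rep_isomorphic (vir M) (rep_of scale act V) (rep_of pm_scale actW (free_space M)) \<or>
     (\<exists>N1 N2. lie_submodule pm_scale (vir M) actW (free_space M) N1 \<and>
        lie_submodule pm_scale (vir M) actW (free_space M) N2 \<and> N1 \<subset> N2 \<and>
        rep_isomorphic (vir M) (rep_of scale act V) (quotient_rep pm_scale actW N2 N1)))"
proof -
  interpret intermediate_module M scale act V
    using assms by unfold_locales
  have listed
    using listed_trivial listed_nontrivial S_nonempty by (cases "S = {0}") auto
  then obtain actW where *: "\<exists>a b. actW = act_Aab a b \<or> actW = act_A a \<or> actW = act_B a"
    "\<exists>N1 N2. lie_submodule pm_scale (vir M) actW (free_space M) N1 \<and>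
        lie_submodule pm_scale (vir M) actW (free_space M) N2 \<and> N1 \<subset> N2 \<and>
        rep_isomorphic (vir M) (rep_of scale act V) (quotient_rep pm_scale actW N2 N1)"
    unfolding listed_def by (elim exE conjE) (rule that, intro exI, assumption, intro exI conjI)
  show ?thesis by (intro exI[of _ actW] conjI disjI2 *)
qed

end
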